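(* Let $G$ be a finite group. If $\lambda(G)<\frac52$, then every Sylow subgroup of $G$ is cyclic. In particular, $G$ is metacyclic.
   Context: For a finite group $G$, $\mathrm{sub}(G)$ denotes the number of subgroups of $G$ (including the trivial subgroup and $G$), $\pi(G)$ denotes the number of distinct prime divisors of $|G|$ (so $\pi(1)=0$), and $\lambda(G)=\mathrm{sub}(G)/2^{\pi(G)}$. A group is metacyclic if it has a cyclic normal subgroup with cyclic quotient. *)

theory Defs
  imports Complex_Main "HOL-Algebra.Elementary_Groups" "HOL-Computational_Algebra.Primes"
begin

definition num_subgroups :: "('a, 'b) monoid_scheme \<Rightarrow> nat"
  where "num_subgroups G = card {H. subgroup H G}"

definition num_prime_divisors :: "('a, 'b) monoid_scheme \<Rightarrow> nat"
  where "num_prime_divisors G = card {p::nat. prime p \<and> p dvd order G}"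

definition subgroup_ratio :: "('a, 'b) monoid_scheme \<Rightarrow> real"
  where "subgroup_ratio G = real (num_subgroups G) / 2 ^ num_prime_divisors G"

text \<open>If \<open>p\<close> does not divide the order of \<open>G\<close>, the only Sylow \<open>p\<close>-subgroup is the trivial one.\<close>

definition sylow_subgroup :: "nat \<Rightarrow> 'a set \<Rightarrow> ('a, 'b) monoid_scheme \<Rightarrow> bool"
  where "sylow_subgroup p P G \<longleftrightarrow>
    prime p \<and> subgroup P G \<and> card P = p ^ multiplicity p (order G)"

definition metacyclic_group :: "('a, 'b) monoid_scheme \<Rightarrow> bool"
  where "metacyclic_group G \<longleftrightarrow>
    (\<exists>N. N \<lhd> G \<and> cyclic_group (G\<lparr>carrier := N\<rparr>) \<and> cyclic_group (G Mod N))"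

end

theory Submission
  imports Defs "HOL-Algebra.Multiplicative_Group" "HOL-Algebra.Sylow" "HOL-Number_Theory.Totient"
    "HOL-Computational_Algebra.Squarefree"
begin

text \<open>Frobenius' theorem (\<open>d\<close> divides the number of solutions of \<open>x ^ d = 1\<close> whenever \<open>d\<close> divides the
  group order) yields, by partial summation of \<open>1 / \<phi>(ord x)\<close> over the divisor lattice, Richards' bound:
  a group of order \<open>\<Prod>q ^ a\<^sub>q\<close> has at least \<open>\<Prod>(a\<^sub>q + 1)\<close> cyclic subgroups. If the Sylow \<open>p\<close>-subgroups are not
  cyclic, no element has order \<open>p ^ a\<^sub>p\<close>, and the factor \<open>a\<^sub>p + 1\<close> improves to \<open>a\<^sub>p + p\<close>. This is at least
  \<open>5\<close>, so that \<open>\<lambda>(G) \<ge> 5/2\<close>, unless \<open>p = a\<^sub>p = 2\<close>; in this case one may also assume \<open>|G| = 4 m\<close> with \<open>m\<close> odd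
  and squarefree. For \<open>m \<noteq> 1, 3\<close>, either some Sylow subgroup of prime order \<open>q \<noteq> 3\<close> is normal, hence complemented, and one
  inducts on the complement, or it has at least \<open>6\<close> conjugates, and counting the subgroups in which one of
  them is normal suffices.

  If all Sylow subgroups are cyclic, Frobenius' theorem shows that the one for the largest prime is normal.
  It has a complement, and induction along it gives that the derived subgroup is cyclic; the quotient
  is abelian with cyclic Sylow subgroups, hence cyclic.\<close>

text \<open>The inductions pass to centralizers, normalizers and complements, so everything is
  stated for subgroups \<open>H\<close> of one fixed group \<open>G\<close>. Weights
  \<open>1 / \<phi>(ord x)\<close> count cyclic subgroups because a cyclic group of order
  \<open>n\<close> has \<open>\<phi>(n)\<close> generators; they factor over the primes, so one
  prime can be treated at a time. Since the ratio divides by one factor 2 per prime, a non-cyclic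
  Sylow subgroup only has to raise its own factor from 2 to 5. Counting cyclic subgroups misses this
  only for a Klein Sylow 2-subgroup, which has four cyclic subgroups and itself. If another prime
  occurs at least squared, its factor is 3, and 4 * 3 already exceeds 5 * 2; hence the squarefree
  case. The alternating group of degree 4 has ratio exactly 5/2 and only four Sylow 3-subgroups:
  this is why the prime 3 is avoided and \<open>m = 3\<close> is settled separately. In the second
  half the point is that automorphisms of a cyclic group commute, so commutators centralize the
  normal Sylow subgroup, and the derived subgroup of its complement can be merged with it into one
  cyclic group.\<close>

locale finite_group = group +
  assumes finite_carrier [simp, intro]: "finite (carrier G)"
begin

section \<open>Lagrange, Sylow existence and Cauchy inside a fixed finite group\<close>

lemma subgroup_finite: "subgroup H G \<Longrightarrow> finite H"
  using finite_carrier finite_subset subgroup.subset by blast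

lemma subgroup_mem: "subgroup H G \<Longrightarrow> x \<in> H \<Longrightarrow> x \<in> carrier G"
  by (simp add: subgroup.mem_carrier)

lemma subgroup_pow: "subgroup H G \<Longrightarrow> x \<in> H \<Longrightarrow> x [^] (n::nat) \<in> H"
  by (induction n) (auto simp: subgroup.one_closed subgroup.m_closed)

lemma subgroup_card_pos: "subgroup H G \<Longrightarrow> 0 < card H"
  using subgroup.finite_imp_card_positive by auto

lemma card_subgroup_dvd:
  assumes "subgroup K G" "subgroup H G" "K \<subseteq> H"
  shows "card K dvd card H"
proof -
  interpret H: group "G\<lparr>carrier := H\<rparr>" using assms(2) by (rule subgroup_imp_group)
  have "subgroup K (G\<lparr>carrier := H\<rparr>)" using assms by (simp add: subgroup_incl)
  from dvd_triv_right[of "card K" "card (rcosets\<^bsub>G\<lparr>carrier := H\<rparr>\<^esub> K)"] H.lagrange[OF this]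
  show ?thesis by (simp add: order_def)
qed

lemma ord_pos: "x \<in> carrier G \<Longrightarrow> 0 < ord x"
  using ord_ge_1[OF finite_carrier, of x] by linarith

lemma ord_dvd_card:
  assumes "subgroup H G" "x \<in> H"
  shows "ord x dvd card H"
proof -
  have x: "x \<in> carrier G" using assms subgroup_mem by blast
  have "generate G {x} \<subseteq> H" using assms by (simp add: generate_subgroup_incl)
  then have "card (generate G {x}) dvd card H"
    using card_subgroup_dvd assms x generate_is_subgroup[of "{x}"] by simp
  then show ?thesis using generate_pow_card[OF x] by simp
qed

lemma pow_card_eq_one:
  assumes "subgroup H G" "x \<in> H"
  shows "x [^] card H = \<one>"
  using ord_dvd_card[OF assms] pow_eq_id subgroup_mem[OF assms] by blast

text \<open>\<open>sylow_thm\<close> does not ask \<open>p ^ a\<close> to be the full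
  \<open>p\<close>-part, so it supplies a subgroup of every prime power order dividing
  \<open>card H\<close>.\<close>

lemma prime_power_subgroup:
  assumes "subgroup H G" "prime p" "p ^ a dvd card H"
  obtains K where "subgroup K G" "K \<subseteq> H" "card K = p ^ a"
proof -
  interpret H: group "G\<lparr>carrier := H\<rparr>" using assms(1) by (rule subgroup_imp_group)
  obtain m where "card H = p ^ a * m" using assms(3) by blast
  then have "order (G\<lparr>carrier := H\<rparr>) = p ^ a * m" by (simp add: order_def)
  from sylow_thm[OF assms(2) H.is_group this] obtain K where
    "subgroup K (G\<lparr>carrier := H\<rparr>)" "card K = p ^ a"
    using subgroup_finite[OF assms(1)] by auto
  moreover have "subgroup K G" "K \<subseteq> H"
    using incl_subgroup[OF assms(1)] subgroup.subset[of K "G\<lparr>carrier := H\<rparr>"] \<open>subgroup K (G\<lparr>carrier := H\<rparr>)\<close> by auto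
  ultimately show ?thesis using that by blast
qed

lemma cauchy_element:
  assumes "subgroup H G" "prime p" "p dvd card H"
  obtains x where "x \<in> H" "ord x = p"
proof -
  obtain K where K: "subgroup K G" "K \<subseteq> H" "card K = p"
    using prime_power_subgroup[OF assms(1,2), of 1] assms(3) by auto
  have "K \<noteq> {\<one>}" using K(3) assms(2) by auto
  then obtain x where x: "x \<in> K" "x \<noteq> \<one>" using K(1) subgroup.one_closed by fastforce
  have "ord x dvd p" using ord_dvd_card[OF K(1) x(1)] K(3) by simp
  moreover have "ord x \<noteq> 1" using x ord_eq_1 subgroup_mem[OF K(1)] by blast
  ultimately have "ord x = p" using assms(2) prime_nat_iff by blast
  with x K that show ?thesis by blast
qed

subsection \<open>Actions of subgroups\<close>

text \<open>The map \<open>f\<close> stays the same when \<open>H\<close> is replaced by a subgroup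
  or \<open>S\<close> by an invariant subset. It will be conjugation of elements, conjugation of
  subsets, or left translation of subsets.\<close>

definition acts :: "'a set \<Rightarrow> ('a \<Rightarrow> 'c \<Rightarrow> 'c) \<Rightarrow> 'c set \<Rightarrow> bool" where
  "acts H f S \<longleftrightarrow> (\<forall>h\<in>H. \<forall>s\<in>S. f h s \<in> S) \<and> (\<forall>s\<in>S. f \<one> s = s)
     \<and> (\<forall>h\<in>H. \<forall>k\<in>H. \<forall>s\<in>S. f (h \<otimes> k) s = f h (f k s))"

lemma acts_subset: "acts H f S \<Longrightarrow> K \<subseteq> H \<Longrightarrow> acts K f S"
  unfolding acts_def by blast

definition orb :: "'a set \<Rightarrow> ('a \<Rightarrow> 'c \<Rightarrow> 'c) \<Rightarrow> 'c \<Rightarrow> 'c set" where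
  "orb H f s = (\<lambda>h. f h s) ` H"

definition stab :: "'a set \<Rightarrow> ('a \<Rightarrow> 'c \<Rightarrow> 'c) \<Rightarrow> 'c \<Rightarrow> 'a set" where
  "stab H f s = {h \<in> H. f h s = s}"

context
  fixes H f S
  assumes H: "subgroup H G" and act: "acts H f S"
begin

lemma act_closed: "h \<in> H \<Longrightarrow> s \<in> S \<Longrightarrow> f h s \<in> S"
  using act unfolding acts_def by blast

lemma act_one: "s \<in> S \<Longrightarrow> f \<one> s = s"
  using act unfolding acts_def by blast

lemma act_mult: "h \<in> H \<Longrightarrow> k \<in> H \<Longrightarrow> s \<in> S \<Longrightarrow> f (h \<otimes> k) s = f h (f k s)"
  using act unfolding acts_def by blast

lemma act_inv: "h \<in> H \<Longrightarrow> s \<in> S \<Longrightarrow> f (inv h) (f h s) = s"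
  by (metis H act_mult act_one l_inv subgroup.m_inv_closed subgroup_mem)

lemma stab_subgroup: "s \<in> S \<Longrightarrow> subgroup (stab H f s) G"
proof (rule subgroupI)
  assume s: "s \<in> S"
  show "stab H f s \<subseteq> carrier G" unfolding stab_def using subgroup_mem[OF H] by auto
  show "stab H f s \<noteq> {}" unfolding stab_def using subgroup.one_closed[OF H] act_one[OF s] by auto
  fix a assume a: "a \<in> stab H f s"
  then show "inv a \<in> stab H f s"
    unfolding stab_def using subgroup.m_inv_closed[OF H] act_inv[of a s] s by auto
  fix b assume "b \<in> stab H f s"
  with a show "a \<otimes> b \<in> stab H f s"
    unfolding stab_def using subgroup.m_closed[OF H] act_mult[of a b s] s by auto
qed

lemma orb_refl: "s \<in> S \<Longrightarrow> s \<in> orb H f s"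
  unfolding orb_def using H act_one subgroup.one_closed by (metis image_eqI)

lemma orb_subset: "s \<in> S \<Longrightarrow> orb H f s \<subseteq> S"
  unfolding orb_def using act_closed by blast

lemma orb_eq:
  assumes "s \<in> S" "t \<in> orb H f s"
  shows "orb H f t = orb H f s"
proof -
  obtain h where h: "h \<in> H" "t = f h s" using assms unfolding orb_def by blast
  have "f k t \<in> orb H f s" if "k \<in> H" for k
    unfolding orb_def using h that act_mult[of k h s] assms H subgroup.m_closed
    by (metis image_eqI)
  moreover have "f k s \<in> orb H f t" if "k \<in> H" for k
  proof -
    have "f k s = f (k \<otimes> inv h) t"
      using act_mult[of k "inv h" t] h that assms H act_closed[of h s] act_inv[of h s]
        subgroup.m_inv_closed by metis
    then show ?thesis unfolding orb_def using h that H
      by (metis image_eqI subgroup.m_closed subgroup.m_inv_closed)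
  qed
  ultimately show ?thesis unfolding orb_def by blast
qed

lemma orb_eq_iff: "s \<in> S \<Longrightarrow> t \<in> S \<Longrightarrow> orb H f t = orb H f s \<longleftrightarrow> t \<in> orb H f s"
  using orb_eq orb_refl by blast

lemma finite_orb: "finite (orb H f s)"
  unfolding orb_def using subgroup_finite[OF H] by simp

text \<open>The fibre of \<open>h \<mapsto> f h s\<close> over \<open>f g s\<close> is the left
  coset of the stabilizer by \<open>g\<close>, so all fibres have the same size.\<close>

lemma orbit_stabilizer:
  assumes s: "s \<in> S"
  shows "card (orb H f s) * card (stab H f s) = card H"
proof -
  have fin: "finite H" using subgroup_finite[OF H] .
  have "card {h \<in> H. f h s = t} = card (stab H f s)" if t: "t \<in> orb H f s" for t
  proof -
    obtain g where g: "g \<in> H" "t = f g s" using t unfolding orb_def by blast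
    have "(\<lambda>h. g \<otimes> h) ` stab H f s = {h \<in> H. f h s = t}"
    proof (intro equalityI subsetI)
      fix x assume "x \<in> (\<lambda>h. g \<otimes> h) ` stab H f s"
      then show "x \<in> {h \<in> H. f h s = t}"
        using g s act_mult subgroup.m_closed[OF H] by (auto simp: stab_def)
    next
      fix x assume x: "x \<in> {h \<in> H. f h s = t}"
      have "f (inv g \<otimes> x) s = s"
        using act_mult[of "inv g" x s] g x s act_inv[of g s] subgroup.m_inv_closed[OF H] by auto
      then have "inv g \<otimes> x \<in> stab H f s"
        using g x H unfolding stab_def by (simp add: subgroup.m_closed subgroup.m_inv_closed)
      moreover have "x = g \<otimes> (inv g \<otimes> x)"
        using g x H subgroup_mem by (metis (no_types, lifting) inv_solve_left mem_Collect_eq m_closed inv_closed)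
      ultimately show "x \<in> (\<lambda>h. g \<otimes> h) ` stab H f s" by blast
    qed
    moreover have "inj_on (\<lambda>h. g \<otimes> h) (stab H f s)"
      using inj_on_cmult[of g] g H subgroup.subset stab_subgroup[OF s] subgroup_mem
      by (meson inj_on_subset)
    ultimately show ?thesis by (metis card_image)
  qed
  then have "(\<Sum>t\<in>orb H f s. card {h \<in> H. f h s = t}) = card (orb H f s) * card (stab H f s)"
    by simp
  moreover have "(\<Sum>t\<in>orb H f s. card {h \<in> H. f h s = t}) = card H"
    using sum.image_gen[OF fin, of "\<lambda>_. 1::nat" "\<lambda>h. f h s"] unfolding orb_def by simp
  ultimately show ?thesis by simp
qed

text \<open>An invariant weight adds \<open>card (orb H f s) * w s\<close> on each orbit. Weights
  are needed because Frobenius' theorem sums, over conjugacy classes, the number of solutions inside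
  a centralizer.\<close>

lemma dvd_sum_over_orbits:
  fixes w :: "'c \<Rightarrow> nat"
  assumes fin: "finite S"
    and inv: "\<And>h s. h \<in> H \<Longrightarrow> s \<in> S \<Longrightarrow> w (f h s) = w s"
    and dvd: "\<And>s. s \<in> S \<Longrightarrow> M dvd card (orb H f s) * w s"
  shows "M dvd sum w S"
proof -
  have "sum w S = (\<Sum>X\<in>orb H f ` S. sum w {s \<in> S. orb H f s = X})"
    by (rule sum.image_gen[OF fin])
  moreover have "M dvd sum w {t \<in> S. orb H f t = orb H f s}" if s: "s \<in> S" for s
  proof -
    have "{t \<in> S. orb H f t = orb H f s} = orb H f s"
      using orb_eq_iff[OF s] orb_subset[OF s] by blast
    moreover have "w t = w s" if "t \<in> orb H f s" for t
      using that inv s unfolding orb_def by auto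
    ultimately show ?thesis using dvd[OF s] by simp
  qed
  ultimately show ?thesis by (auto intro: dvd_sum)
qed

text \<open>The moved points fall into orbits of \<open>p ^ i\<close> elements with
  \<open>i > 0\<close>.\<close>

lemma p_group_fixed_points:
  assumes fin: "finite S" and p: "prime p" and cH: "card H = p ^ a"
  shows "p dvd card {s \<in> S. \<exists>h\<in>H. f h s \<noteq> s}"
proof -
  let ?T = "{s \<in> S. \<exists>h\<in>H. f h s \<noteq> s}"
  have fixed: "s \<in> S \<Longrightarrow> (\<forall>h\<in>H. f h s = s) \<longleftrightarrow> orb H f s = {s}" for s
    unfolding orb_def using subgroup.one_closed[OF H] by (auto simp: image_iff)
  have T: "orb H f s \<subseteq> ?T" if s: "s \<in> ?T" for s
  proof
    fix t assume t: "t \<in> orb H f s"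
    then have tS: "t \<in> S" "orb H f t = orb H f s" using orb_subset orb_eq s by auto
    have "orb H f t \<noteq> {t}" using fixed[of s] s orb_refl[of s] tS by auto
    with fixed[of t] tS show "t \<in> ?T" by blast
  qed
  have actT: "acts H f ?T"
    unfolding acts_def
  proof (intro conjI ballI)
    fix h s assume "h \<in> H" "s \<in> ?T"
    then show "f h s \<in> ?T" using T[of s] unfolding orb_def by blast
  qed (use act in \<open>auto simp: acts_def\<close>)
  have "p dvd sum (\<lambda>_. 1) ?T"
  proof (rule finite_group.dvd_sum_over_orbits[OF _ H actT])
    fix s assume s: "s \<in> ?T"
    have "card (orb H f s) dvd p ^ a" using orbit_stabilizer[of s] s cH by (metis (mono_tags, lifting) dvd_triv_left mem_Collect_eq)
    then obtain i where i: "card (orb H f s) = p ^ i" using p divides_primepow_nat by blast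
    have "orb H f s \<noteq> {s}" using fixed[of s] s by auto
    then have "card (orb H f s) \<noteq> 1" using orb_refl[of s] s by (auto simp: card_1_singleton_iff)
    then have "i \<noteq> 0" using i by (metis power_0)
    then show "p dvd card (orb H f s) * 1" using i by (simp add: dvd_power)
  next
    show "finite_group G" by (rule finite_group_axioms)
    show "finite ?T" using fin by simp
  qed (rule refl)
  then show ?thesis by simp
qed

end

subsection \<open>Conjugation\<close>

definition conjugate :: "'a \<Rightarrow> 'a \<Rightarrow> 'a" where "conjugate g x = g \<otimes> x \<otimes> inv g"

lemma conj_closed [simp]: "g \<in> carrier G \<Longrightarrow> x \<in> carrier G \<Longrightarrow> conjugate g x \<in> carrier G"
  unfolding conjugate_def by simp

lemma conj_mult: "g \<in> carrier G \<Longrightarrow> x \<in> carrier G \<Longrightarrow> y \<in> carrier G \<Longrightarrow> conjugate g (x \<otimes> y) = conjugate g x \<otimes> conjugate g y"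
  unfolding conjugate_def by (simp add: m_assoc inv_solve_left)

lemma conj_conj: "g \<in> carrier G \<Longrightarrow> h \<in> carrier G \<Longrightarrow> x \<in> carrier G \<Longrightarrow> conjugate (g \<otimes> h) x = conjugate g (conjugate h x)"
  unfolding conjugate_def by (simp add: m_assoc inv_mult_group)

lemma conj_one [simp]: "x \<in> carrier G \<Longrightarrow> conjugate \<one> x = x"
  unfolding conjugate_def by simp

lemma conj_of_one [simp]: "g \<in> carrier G \<Longrightarrow> conjugate g \<one> = \<one>"
  unfolding conjugate_def by simp

lemma conj_inv: "g \<in> carrier G \<Longrightarrow> x \<in> carrier G \<Longrightarrow> conjugate (inv g) (conjugate g x) = x"
  using conj_conj[of "inv g" g x] by simp

lemma conj_inv': "g \<in> carrier G \<Longrightarrow> x \<in> carrier G \<Longrightarrow> conjugate g (conjugate (inv g) x) = x"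
  using conj_conj[of g "inv g" x] by simp

lemma conj_m_inv: "g \<in> carrier G \<Longrightarrow> x \<in> carrier G \<Longrightarrow> conjugate g (inv x) = inv (conjugate g x)"
  unfolding conjugate_def by (simp add: m_assoc inv_mult_group)

lemma conj_inj: "g \<in> carrier G \<Longrightarrow> inj_on (conjugate g) (carrier G)"
  by (rule inj_on_inverseI[of _ "conjugate (inv g)"]) (rule conj_inv)

lemma conj_pow: "g \<in> carrier G \<Longrightarrow> x \<in> carrier G \<Longrightarrow> conjugate g (x [^] (n::nat)) = conjugate g x [^] n"
  by (induction n) (simp_all add: conj_mult)

lemma conj_eq_self_iff: "g \<in> carrier G \<Longrightarrow> x \<in> carrier G \<Longrightarrow> conjugate g x = x \<longleftrightarrow> g \<otimes> x = x \<otimes> g"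
  unfolding conjugate_def by (metis inv_solve_right m_closed)

lemma conj_in_subgroup: "subgroup H G \<Longrightarrow> g \<in> H \<Longrightarrow> x \<in> H \<Longrightarrow> conjugate g x \<in> H"
  unfolding conjugate_def by (simp add: subgroup.m_closed subgroup.m_inv_closed)

lemma conj_pow_eq_one_iff:
  "g \<in> carrier G \<Longrightarrow> x \<in> carrier G \<Longrightarrow> conjugate g x [^] (n::nat) = \<one> \<longleftrightarrow> x [^] n = \<one>"
  using conj_pow[of g x n] conj_inv[of g "x [^] n"] conj_of_one[of "inv g"] by auto

subsection \<open>Frobenius' theorem\<close>

lemma pow_mod_cong:
  fixes a b n :: nat
  assumes "x \<in> carrier G" "x [^] n = \<one>" "[a = b] (mod n)"
  shows "x [^] a = x [^] b"
proof -
  have "x [^] c = x [^] (c mod n)" for c :: nat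
  proof -
    have "x [^] c = x [^] (n * (c div n) + c mod n)" by simp
    also have "\<dots> = (x [^] n) [^] (c div n) \<otimes> x [^] (c mod n)"
      using assms(1) by (simp only: nat_pow_mult[symmetric] nat_pow_pow[symmetric])
    finally show ?thesis using assms by simp
  qed
  then show ?thesis using assms(3) unfolding cong_def by metis
qed

lemma acts_conjugate: "subgroup H G \<Longrightarrow> acts H conjugate H"
  unfolding acts_def by (simp add: conj_in_subgroup subgroup_mem conj_conj)

lemma stab_conjugate: "subgroup H G \<Longrightarrow> y \<in> H \<Longrightarrow> stab H conjugate y = {z \<in> H. z \<otimes> y = y \<otimes> z}"
  unfolding stab_def using conj_eq_self_iff subgroup_mem by blast

text \<open>A solution \<open>x\<close> splits uniquely into commuting powers
  \<open>y = x [^] \<alpha>\<close> and \<open>z = x [^] \<beta>\<close> with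
  \<open>y [^] u = \<one>\<close> and \<open>z [^] v = \<one>\<close>, where \<open>\<alpha>\<close>
  and \<open>\<beta>\<close> are the Chinese remainder idempotents. For fixed \<open>y\<close> the
  factor \<open>z\<close> ranges over the centralizer, which is the stabilizer of \<open>y\<close>
  under conjugation.\<close>

lemma card_pow_mult_eq_one:
  assumes H: "subgroup H G" and uv: "coprime u v"
  shows "card {x \<in> H. x [^] (u * v :: nat) = \<one>}
    = (\<Sum>y\<in>{y \<in> H. y [^] u = \<one>}. card {z \<in> stab H conjugate y. z [^] v = \<one>})"
proof -
  let ?Y = "{y \<in> H. y [^] u = \<one>}" and ?X = "{x \<in> H. x [^] (u * v) = \<one>}"
  let ?Z = "\<lambda>y. {z \<in> stab H conjugate y. z [^] v = \<one>}"
  have fin: "finite H" using subgroup_finite[OF H] .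
  have car: "\<And>x. x \<in> H \<Longrightarrow> x \<in> carrier G" using subgroup_mem[OF H] .
  obtain \<alpha> where \<alpha>: "[\<alpha> = 1] (mod u)" "[\<alpha> = 0] (mod v)"
    using binary_chinese_remainder_nat[OF uv] by blast
  obtain \<beta> where \<beta>: "[\<beta> = 0] (mod u)" "[\<beta> = 1] (mod v)"
    using binary_chinese_remainder_nat[OF uv] by blast
  have sum1: "[\<alpha> + \<beta> = 1] (mod (u * v))"
    using cong_add[OF \<alpha>(1) \<beta>(1)] cong_add[OF \<alpha>(2) \<beta>(2)] uv
    by (intro coprime_cong_mult_nat) auto
  have "bij_betw (\<lambda>(y, z). y \<otimes> z) (Sigma ?Y ?Z) ?X"
  proof (rule bij_betw_byWitness[where f' = "\<lambda>x. (x [^] \<alpha>, x [^] \<beta>)"])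
    show "\<forall>a\<in>Sigma ?Y ?Z. (\<lambda>x. (x [^] \<alpha>, x [^] \<beta>)) (case a of (y, z) \<Rightarrow> y \<otimes> z) = a"
    proof clarify
      fix y z assume y: "y \<in> H" "y [^] u = \<one>" and z: "z \<in> stab H conjugate y" "z [^] v = \<one>"
      then have c: "z \<in> H" "z \<otimes> y = y \<otimes> z" using stab_conjugate[OF H] by auto
      note cc = car[OF y(1)] car[OF c(1)]
      have "(y \<otimes> z) [^] \<alpha> = y [^] \<alpha> \<otimes> z [^] \<alpha>" "(y \<otimes> z) [^] \<beta> = y [^] \<beta> \<otimes> z [^] \<beta>"
        using cc c(2) by (simp_all add: pow_mult_distrib)
      moreover have "y [^] \<alpha> = y [^] (1::nat)" "z [^] \<beta> = z [^] (1::nat)"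
        "y [^] \<beta> = y [^] (0::nat)" "z [^] \<alpha> = z [^] (0::nat)"
        using pow_mod_cong[OF cc(1) y(2)] pow_mod_cong[OF cc(2) z(2)] \<alpha> \<beta> by blast+
      ultimately show "(y \<otimes> z) [^] \<alpha> = y \<and> (y \<otimes> z) [^] \<beta> = z"
        using cc by simp
    qed
    show "\<forall>x\<in>?X. (case (x [^] \<alpha>, x [^] \<beta>) of (y, z) \<Rightarrow> y \<otimes> z) = x"
    proof clarify
      fix x assume x: "x \<in> H" "x [^] (u * v) = \<one>"
      have "x [^] (\<alpha> + \<beta>) = x [^] (1::nat)"
        by (rule pow_mod_cong[OF car[OF x(1)] x(2) sum1])
      then show "x [^] \<alpha> \<otimes> x [^] \<beta> = x" using x car by (simp add: nat_pow_mult)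
    qed
    show "(\<lambda>(y, z). y \<otimes> z) ` Sigma ?Y ?Z \<subseteq> ?X"
    proof clarify
      fix y z assume y: "y \<in> H" "y [^] u = \<one>" and z: "z \<in> stab H conjugate y" "z [^] v = \<one>"
      then have c: "z \<in> H" "z \<otimes> y = y \<otimes> z" using stab_conjugate[OF H] by auto
      note cc = car[OF y(1)] car[OF c(1)]
      have "(y \<otimes> z) [^] (u * v) = y [^] (u * v) \<otimes> z [^] (u * v)"
        using cc c(2) by (simp add: pow_mult_distrib)
      also have "\<dots> = (y [^] u) [^] v \<otimes> (z [^] v) [^] u"
        using cc by (simp add: nat_pow_pow mult.commute)
      finally show "y \<otimes> z \<in> H \<and> (y \<otimes> z) [^] (u * v) = \<one>"
        using y z c subgroup.m_closed[OF H] by simp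
    qed
    show "(\<lambda>x. (x [^] \<alpha>, x [^] \<beta>)) ` ?X \<subseteq> Sigma ?Y ?Z"
    proof (rule image_subsetI)
      fix x assume "x \<in> ?X"
      then have x: "x \<in> H" "x [^] (u * v) = \<one>" by auto
      have xc: "x \<in> carrier G" using car x by blast
      have "v dvd \<alpha>" "u dvd \<beta>" using \<alpha> \<beta> by (simp_all add: cong_0_iff)
      then have "u * v dvd \<alpha> * u" "u * v dvd \<beta> * v" by (simp_all add: mult.commute mult_dvd_mono)
      moreover have "ord x dvd u * v" using x xc pow_eq_id by simp
      ultimately have "x [^] (\<alpha> * u) = \<one>" "x [^] (\<beta> * v) = \<one>"
        using xc pow_eq_id dvd_trans by blast+
      moreover have "x [^] \<beta> \<otimes> x [^] \<alpha> = x [^] \<alpha> \<otimes> x [^] \<beta>"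
        using xc by (simp add: nat_pow_mult add.commute)
      ultimately show "(x [^] \<alpha>, x [^] \<beta>) \<in> Sigma ?Y ?Z"
        using stab_conjugate[OF H] subgroup_pow[OF H] x xc by (simp add: nat_pow_pow)
    qed
  qed
  then have "card ?X = card (Sigma ?Y ?Z)" by (simp add: bij_betw_same_card)
  also have "\<dots> = (\<Sum>y\<in>?Y. card (?Z y))"
    using fin by (intro card_SigmaI) (auto simp: stab_def)
  finally show ?thesis .
qed

section \<open>Generators of cyclic subgroups\<close>

lemma generators_eq:
  assumes x: "x \<in> carrier G"
  shows "{y \<in> carrier G. generate G {y} = generate G {x}} = (\<lambda>k. x [^] k) ` totatives (ord x)"
proof (intro equalityI subsetI)
  fix y assume "y \<in> {y \<in> carrier G. generate G {y} = generate G {x}}"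
  then have y: "y \<in> carrier G" "generate G {y} = generate G {x}" by auto
  have "y \<in> generate G {x}" using y by (metis generate.incl insertI1)
  then obtain k :: nat where k: "y = x [^] k"
    using generate_pow_on_finite_carrier[OF finite_carrier x] by blast
  have "ord y = ord x" using y x generate_pow_card by metis
  then have cop: "coprime k (ord x)" using k pow_ord_eq_ord_iff[OF finite_carrier x] by simp
  \<comment> \<open>\<open>totatives\<close> lie between 1 and \<open>ord x\<close>, so the
    remainder 0, possible only for \<open>ord x = 1\<close>, is replaced by
    \<open>ord x\<close>.\<close>
  define l where "l = (if k mod ord x = 0 then ord x else k mod ord x)"
  have "x [^] l = x [^] k"
    using x unfolding l_def by (intro pow_mod_cong[where n = "ord x"]) (auto simp: cong_def)
  moreover have "l \<in> totatives (ord x)"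
    using cop ord_pos[OF x] unfolding l_def in_totatives_iff
    by (auto simp: less_imp_le coprime_iff_gcd_eq_1 gcd.commute gcd_nat.absorb1 mod_eq_0_iff_dvd simp flip: dvd_eq_mod_eq_0 intro!: Nat.gr0I)
  ultimately show "y \<in> (\<lambda>k. x [^] k) ` totatives (ord x)" using k by (metis image_eqI)
next
  fix y assume "y \<in> (\<lambda>k. x [^] k) ` totatives (ord x)"
  then obtain k where k: "coprime k (ord x)" "y = x [^] k" by (auto simp: in_totatives_iff)
  have y: "y \<in> carrier G" using x k by simp
  have "ord y = ord x" using k pow_ord_eq_ord_iff[OF finite_carrier x] by simp
  then have c: "card (generate G {y}) = card (generate G {x})" using x y generate_pow_card by simp
  have "y \<in> generate G {x}"
    using generate_pow_on_finite_carrier[OF finite_carrier x] k by blast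
  then have sub: "generate G {y} \<subseteq> generate G {x}"
    using generate_subgroup_incl[of "{y}" "generate G {x}"] generate_is_subgroup[of "{x}"] x by simp
  have "finite (generate G {x})"
    using subgroup_finite generate_is_subgroup[of "{x}"] x by simp
  from card_subset_eq[OF this sub c] y show "y \<in> {y \<in> carrier G. generate G {y} = generate G {x}}" by simp
qed

lemma card_generators:
  assumes x: "x \<in> carrier G"
  shows "card {y \<in> carrier G. generate G {y} = generate G {x}} = totient (ord x)"
proof -
  have "inj_on (\<lambda>k. x [^] k) (totatives (ord x))"
    by (rule inj_on_subset[OF ord_inj'[OF x]]) (auto simp: in_totatives_iff)
  then show ?thesis unfolding generators_eq[OF x] by (simp add: card_image totient_def)
qed

lemma generate_subset_subgroup: "subgroup H G \<Longrightarrow> x \<in> H \<Longrightarrow> generate G {x} \<subseteq> H"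
  by (simp add: generate_subgroup_incl)

lemma generators_in_subgroup:
  assumes "subgroup H G" "x \<in> H"
  shows "{y \<in> H. generate G {y} = generate G {x}} = {y \<in> carrier G. generate G {y} = generate G {x}}"
  using generate_subset_subgroup[OF assms] subgroup_mem[OF assms(1)] generate.incl[of _ "{_}" G]
  by blast

text \<open>The elements of order \<open>n\<close> are grouped by the cyclic subgroup they generate;
  each group consists of its \<open>totient n\<close> generators.\<close>

lemma totient_dvd_card_ord:
  assumes H: "subgroup H G"
  shows "totient n dvd card {x \<in> H. ord x = n}"
proof -
  let ?E = "{x \<in> H. ord x = n}"
  have "card ?E = (\<Sum>C\<in>(\<lambda>x. generate G {x}) ` ?E. card {y \<in> ?E. generate G {y} = C})"
    using sum.image_gen[of ?E "\<lambda>_. 1::nat" "\<lambda>x. generate G {x}"] subgroup_finite[OF H] by simp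
  moreover have "card {y \<in> ?E. generate G {y} = generate G {x}} = totient n" if x: "x \<in> ?E" for x
  proof -
    have "{y \<in> ?E. generate G {y} = generate G {x}} = {y \<in> H. generate G {y} = generate G {x}}"
      using x generate_pow_card subgroup_mem[OF H] by (metis (no_types, lifting) mem_Collect_eq)
    then show ?thesis
      using generators_in_subgroup[OF H, of x] card_generators[of x] subgroup_mem[OF H] x by simp
  qed
  ultimately show ?thesis by (auto intro: dvd_sum)
qed

lemma stab_conjugate_conjugate:
  assumes H: "subgroup H G" and h: "h \<in> H" and y: "y \<in> H"
  shows "stab H conjugate (conjugate h y) = conjugate h ` stab H conjugate y"
proof -
  have car: "\<And>x. x \<in> H \<Longrightarrow> x \<in> carrier G" using subgroup_mem[OF H] .
  have *: "conjugate g z \<in> stab H conjugate (conjugate g x)"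
    if "g \<in> H" "x \<in> H" "z \<in> stab H conjugate x" for g x z
  proof -
    have z: "z \<in> H" "z \<otimes> x = x \<otimes> z" using that stab_conjugate[OF H] by auto
    have "conjugate g z \<otimes> conjugate g x = conjugate g x \<otimes> conjugate g z"
      using conj_mult[of g z x] conj_mult[of g x z] z that car by simp
    then show ?thesis
      unfolding stab_conjugate[OF H conj_in_subgroup[OF H that(1,2)]]
      using conj_in_subgroup[OF H that(1) z(1)] by simp
  qed
  show ?thesis
  proof (intro equalityI subsetI)
    fix z assume z: "z \<in> stab H conjugate (conjugate h y)"
    have ih: "inv h \<in> H" by (rule subgroup.m_inv_closed[OF H h])
    have "conjugate (inv h) z \<in> stab H conjugate (conjugate (inv h) (conjugate h y))"
      using *[OF ih conj_in_subgroup[OF H h y] z] .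
    then have "conjugate (inv h) z \<in> stab H conjugate y" using conj_inv car h y by simp
    moreover have "z = conjugate h (conjugate (inv h) z)"
      using conj_inv' car h z unfolding stab_def by simp
    ultimately show "z \<in> conjugate h ` stab H conjugate y" by blast
  next
    fix z assume "z \<in> conjugate h ` stab H conjugate y"
    then show "z \<in> stab H conjugate (conjugate h y)" using *[OF h y] by blast
  qed
qed

lemma card_stab_pow_eq_one_conjugate:
  assumes H: "subgroup H G" and h: "h \<in> H" and y: "y \<in> H"
  shows "card {z \<in> stab H conjugate (conjugate h y). z [^] (n::nat) = \<one>}
    = card {z \<in> stab H conjugate y. z [^] n = \<one>}"
proof -
  have car: "\<And>x. x \<in> H \<Longrightarrow> x \<in> carrier G" using subgroup_mem[OF H] .
  have S: "stab H conjugate y \<subseteq> H" unfolding stab_def by blast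
  have "{z \<in> stab H conjugate (conjugate h y). z [^] n = \<one>}
      = conjugate h ` {z \<in> stab H conjugate y. z [^] n = \<one>}"
    unfolding stab_conjugate_conjugate[OF assms]
    using conj_pow_eq_one_iff S car h by blast
  moreover have "inj_on (conjugate h) {z \<in> stab H conjugate y. z [^] n = \<one>}"
    using S car by (intro inj_on_subset[OF conj_inj]) (use h in auto)
  ultimately show ?thesis by (simp add: card_image)
qed

text \<open>Frobenius' theorem for the powers of one prime, named because it is the induction
  hypothesis handed to centralizers.\<close>

definition prime_power_solutions :: "nat \<Rightarrow> 'a set \<Rightarrow> bool" where
  "prime_power_solutions p K \<longleftrightarrow> (\<forall>j. p ^ j dvd card K \<longrightarrow> p ^ j dvd card {z \<in> K. z [^] (p ^ j) = \<one>})"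

text \<open>If \<open>p ^ j\<close> divides the order of the centralizer, the hypothesis on it
  suffices. Otherwise its \<open>p\<close>-part is a smaller \<open>p ^ b\<close>, the solutions for
  \<open>p ^ j\<close> are those for \<open>p ^ b\<close>, and the missing power of \<open>p\<close>
  is in the size of the conjugacy class.\<close>

lemma prime_power_dvd_class_sum:
  assumes H: "subgroup H G" and p: "prime p" and j: "p ^ j dvd card H" and y: "y \<in> H"
    and Q: "prime_power_solutions p (stab H conjugate y)"
  shows "p ^ j dvd card (orb H conjugate y) * card {z \<in> stab H conjugate y. z [^] (p ^ j) = \<one>}"
proof -
  let ?C = "stab H conjugate y"
  have C: "subgroup ?C G" using stab_subgroup[OF H acts_conjugate[OF H] y] .
  have os: "card (orb H conjugate y) * card ?C = card H"
    using orbit_stabilizer[OF H acts_conjugate[OF H] y] .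
  show ?thesis
  proof (cases "p ^ j dvd card ?C")
    case True
    then show ?thesis using Q unfolding prime_power_solutions_def by (simp add: dvd_mult)
  next
    case False
    define b where "b = multiplicity p (card ?C)"
    have "card ?C \<noteq> 0" using subgroup_card_pos[OF C] by simp
    then obtain s where s: "card ?C = p ^ b * s" "\<not> p dvd s"
      using multiplicity_decompose'[of "card ?C" p] p unfolding b_def
      by (metis not_prime_unit)
    have cop: "coprime (p ^ j) s" using s(2) p by (simp add: prime_imp_coprime)
    have "b \<le> j"
    proof (rule ccontr)
      assume "\<not> b \<le> j"
      then have "p ^ j dvd p ^ b" by (intro le_imp_power_dvd) simp
      then show False using False s(1) by (simp add: dvd_mult2)
    qed
    have "z [^] (p ^ j) = \<one> \<longleftrightarrow> z [^] (p ^ b) = \<one>" if "z \<in> ?C" for z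
    proof -
      have z: "z \<in> carrier G" "ord z dvd p ^ b * s"
        using that subgroup_mem[OF C] ord_dvd_card[OF C] s(1) by auto
      have "ord z dvd p ^ j \<longleftrightarrow> ord z dvd p ^ b"
      proof
        assume a: "ord z dvd p ^ j"
        then have "coprime (ord z) s" using coprime_divisors[OF a dvd_refl cop] by simp
        then show "ord z dvd p ^ b" using z(2) by (simp add: coprime_dvd_mult_left_iff)
      next
        assume "ord z dvd p ^ b"
        then show "ord z dvd p ^ j" by (rule dvd_trans[OF _ le_imp_power_dvd[OF \<open>b \<le> j\<close>]])
      qed
      then show ?thesis using pow_eq_id z(1) by simp
    qed
    then have eq: "{z \<in> ?C. z [^] (p ^ j) = \<one>} = {z \<in> ?C. z [^] (p ^ b) = \<one>}" by blast
    have "p ^ b dvd card {z \<in> ?C. z [^] (p ^ b) = \<one>}"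
      using Q s(1) unfolding prime_power_solutions_def by auto
    then have 1: "card (orb H conjugate y) * p ^ b dvd card (orb H conjugate y) * card {z \<in> ?C. z [^] (p ^ b) = \<one>}"
      by (rule mult_dvd_mono[OF dvd_refl])
    have "p ^ j dvd (card (orb H conjugate y) * p ^ b) * s"
      using j os s(1) by (simp add: mult.assoc)
    then have "p ^ j dvd card (orb H conjugate y) * p ^ b"
      using cop by (simp add: coprime_dvd_mult_left_iff)
    then show ?thesis unfolding eq by (rule dvd_trans[OF _ 1])
  qed
qed

text \<open>The set \<open>Y\<close> is left open since it is both the set of non-central
  \<open>p'\<close>-elements and the set of all solutions of
  \<open>y [^] u = \<one>\<close>.\<close>

lemma sum_dvd_if_prime_power_solutions:
  assumes H: "subgroup H G" and p: "prime p" and j: "p ^ j dvd card H"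
    and Y: "Y \<subseteq> H" and conj: "\<And>h y. h \<in> H \<Longrightarrow> y \<in> Y \<Longrightarrow> conjugate h y \<in> Y"
    and Q: "\<And>y. y \<in> Y \<Longrightarrow> prime_power_solutions p (stab H conjugate y)"
  shows "p ^ j dvd (\<Sum>y\<in>Y. card {z \<in> stab H conjugate y. z [^] (p ^ j) = \<one>})"
proof -
  have "acts H conjugate Y" using acts_conjugate[OF H] Y conj unfolding acts_def by blast
  then show ?thesis
  proof (rule dvd_sum_over_orbits[OF H])
    show "finite Y" using Y subgroup_finite[OF H] finite_subset by blast
    show "card {z \<in> stab H conjugate (conjugate h s). z [^] (p ^ j) = \<one>} =
        card {z \<in> stab H conjugate s. z [^] (p ^ j) = \<one>}" if "h \<in> H" "s \<in> Y" for h s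
      using card_stab_pow_eq_one_conjugate[OF H] that Y by blast
    show "p ^ j dvd card (orb H conjugate s) * card {z \<in> stab H conjugate s. z [^] (p ^ j) = \<one>}"
      if "s \<in> Y" for s
      using prime_power_dvd_class_sum[OF H p j _ Q] that Y by blast
  qed
qed

lemma conj_pow_solutions_closed:
  assumes H: "subgroup H G" and "h \<in> H" "y \<in> {y \<in> H. y [^] (u::nat) = \<one>}"
  shows "conjugate h y \<in> {y \<in> H. y [^] u = \<one>}"
  using assms conj_in_subgroup[OF H] conj_pow_eq_one_iff subgroup_mem[OF H] by simp

text \<open>Counting all elements of \<open>H\<close> through their \<open>p'\<close>-part \<open>y\<close>, the non-central \<open>y\<close> contribute a multiple
  of \<open>p ^ a\<close> by induction, and the number of central ones is prime to \<open>p\<close>.\<close>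

lemma card_p_elements_dvd:
  assumes H: "subgroup H G" and p: "prime p" and cH: "card H = p ^ a * r" "\<not> p dvd r"
    and IH: "\<And>K. subgroup K G \<Longrightarrow> K \<subseteq> H \<Longrightarrow> card K < card H \<Longrightarrow> prime_power_solutions p K"
  shows "p ^ a dvd card {x \<in> H. x [^] (p ^ a) = \<one>}"
proof -
  have fin: "finite H" using subgroup_finite[OF H] .
  have car: "\<And>x. x \<in> H \<Longrightarrow> x \<in> carrier G" using subgroup_mem[OF H] .
  let ?Y = "{y \<in> H. y [^] r = \<one>}"
  let ?w = "\<lambda>y. card {z \<in> stab H conjugate y. z [^] (p ^ a) = \<one>}"
  define Z where "Z = {y \<in> ?Y. stab H conjugate y = H}"
  define N where "N = {y \<in> ?Y. stab H conjugate y \<noteq> H}"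
  have cop: "coprime r (p ^ a)" using cH(2) p by (simp add: prime_imp_coprime coprime_commute)
  have "{x \<in> H. x [^] (r * p ^ a) = \<one>} = H"
    using pow_card_eq_one[OF H] cH(1) by (auto simp: mult.commute)
  then have "card H = sum ?w ?Y" using card_pow_mult_eq_one[OF H cop] by simp
  also have "?Y = Z \<union> N" unfolding Z_def N_def by blast
  also have "sum ?w (Z \<union> N) = sum ?w Z + sum ?w N"
    using fin by (intro sum.union_disjoint) (auto simp: Z_def N_def)
  also have "sum ?w Z = card Z * card {x \<in> H. x [^] (p ^ a) = \<one>}"
    unfolding Z_def by simp
  finally have split: "card H = card Z * card {x \<in> H. x [^] (p ^ a) = \<one>} + sum ?w N" .
  have wN: "p ^ a dvd sum ?w N"
  proof (rule sum_dvd_if_prime_power_solutions[OF H p])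
    show "p ^ a dvd card H" using cH by simp
    show "N \<subseteq> H" unfolding N_def by blast
    show "prime_power_solutions p (stab H conjugate y)" if "y \<in> N" for y
    proof (rule IH)
      show "subgroup (stab H conjugate y) G"
        using stab_subgroup[OF H acts_conjugate[OF H]] that unfolding N_def by blast
      show "stab H conjugate y \<subseteq> H" unfolding stab_def by blast
      then show "card (stab H conjugate y) < card H"
        using that fin unfolding N_def by (intro psubset_card_mono) auto
    qed
    fix h y assume h: "h \<in> H" and y: "y \<in> N"
    \<comment> \<open>With exponent 0 the equation holds for every \<open>z\<close>, so the two
      counts are those of the whole centralizers.\<close>
    have "card (stab H conjugate (conjugate h y)) = card (stab H conjugate y)"
      using card_stab_pow_eq_one_conjugate[OF H h, of y 0] y unfolding N_def by simp
    then have "stab H conjugate (conjugate h y) \<noteq> H"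
      using y fin card_subset_eq[of H "stab H conjugate y"] unfolding N_def stab_def by auto
    then show "conjugate h y \<in> N"
      using conj_pow_solutions_closed[OF H h] y unfolding N_def by blast
  qed
  then have d: "p ^ a dvd card Z * card {x \<in> H. x [^] (p ^ a) = \<one>}"
  proof -
    have "p ^ a dvd card H" using cH(1) by simp
    then show ?thesis using dvd_add_left_iff[OF wN] split by simp
  qed
  have Zd: "Z = {y \<in> H. y [^] r = \<one> \<and> (\<forall>z\<in>H. z \<otimes> y = y \<otimes> z)}"
    unfolding Z_def using stab_conjugate[OF H] by blast
  \<comment> \<open>Once the central solutions form a subgroup, Cauchy's theorem applies to it: an
    element of order \<open>p\<close> in \<open>Z\<close> would give \<open>p dvd r\<close>.\<close>
  have "subgroup Z G"
  proof (rule subgroupI)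
    show "Z \<subseteq> carrier G" unfolding Zd using car by blast
    have "\<one> \<in> Z" unfolding Zd using subgroup.one_closed[OF H] car by simp
    then show "Z \<noteq> {}" by blast
    fix x assume x: "x \<in> Z"
    have "z \<otimes> inv x = inv x \<otimes> z" if z: "z \<in> H" for z
    proof -
      have "x \<in> carrier G" "z \<in> carrier G" "z \<otimes> x = x \<otimes> z" using x z car unfolding Zd by auto
      then show ?thesis by (metis inv_closed inv_solve_left inv_solve_right m_assoc m_closed)
    qed
    then show "inv x \<in> Z"
      using x car subgroup.m_inv_closed[OF H] unfolding Zd by (auto simp: nat_pow_inv)
    fix y assume y: "y \<in> Z"
    have "z \<otimes> (x \<otimes> y) = x \<otimes> y \<otimes> z" if z: "z \<in> H" for z
    proof -
      have c: "x \<in> carrier G" "y \<in> carrier G" "z \<in> carrier G" "z \<otimes> x = x \<otimes> z" "z \<otimes> y = y \<otimes> z"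
        using x y z car unfolding Zd by auto
      have "z \<otimes> (x \<otimes> y) = x \<otimes> z \<otimes> y" using c by (simp flip: m_assoc)
      then show ?thesis using c by (simp add: m_assoc)
    qed
    moreover have "x \<otimes> y \<in> H" using x y subgroup.m_closed[OF H] unfolding Zd by blast
    moreover have "(x \<otimes> y) [^] r = x [^] r \<otimes> y [^] r"
    proof (rule pow_mult_distrib)
      show "x \<otimes> y = y \<otimes> x" "x \<in> carrier G" "y \<in> carrier G" using x y car unfolding Zd by blast+
    qed
    moreover have "x [^] r = \<one>" "y [^] r = \<one>" using x y unfolding Zd by blast+
    ultimately show "x \<otimes> y \<in> Z" unfolding Zd by auto
  qed
  have "\<not> p dvd card Z"
  proof
    assume "p dvd card Z"
    then obtain x where x: "x \<in> Z" "ord x = p" using cauchy_element[OF \<open>subgroup Z G\<close> p] by blast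
    then have "p dvd r" using pow_eq_id[of x r] car unfolding Zd by auto
    then show False using cH(2) by simp
  qed
  then have "coprime (p ^ a) (card Z)" using p by (simp add: prime_imp_coprime)
  then show ?thesis using d by (simp add: coprime_dvd_mult_right_iff)
qed

text \<open>Induction on the order settles the full exponent \<open>a\<close>. Descending from
  \<open>p ^ Suc i\<close> to \<open>p ^ i\<close> removes the elements of order exactly
  \<open>p ^ Suc i\<close>; their number is a multiple of \<open>totient (p ^ Suc i)\<close>, hence
  of \<open>p ^ i\<close>, hence of \<open>p ^ j\<close>.\<close>

lemma prime_power_solutions_subgroup:
  assumes p: "prime p" and "subgroup H G"
  shows "prime_power_solutions p H"
  using assms(2)
proof (induction "card H" arbitrary: H rule: less_induct)
  case (less H)
  note H = less.prems
  define a where "a = multiplicity p (card H)"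
  have "card H \<noteq> 0" using subgroup_card_pos[OF H] by simp
  then obtain r where r: "card H = p ^ a * r" "\<not> p dvd r"
    using multiplicity_decompose'[of "card H" p] p unfolding a_def by (metis not_prime_unit)
  have top: "p ^ a dvd card {x \<in> H. x [^] (p ^ a) = \<one>}"
    using card_p_elements_dvd[OF H p r] less.hyps by blast
  show ?case
    unfolding prime_power_solutions_def
  proof (intro allI impI)
    fix j assume j: "p ^ j dvd card H"
    then have "j \<le> a" unfolding a_def using \<open>card H \<noteq> 0\<close> p
      by (metis multiplicity_geI not_prime_unit)
    then show "p ^ j dvd card {z \<in> H. z [^] (p ^ j) = \<one>}"
    proof -
      have "p ^ j dvd card {z \<in> H. z [^] (p ^ i) = \<one>}" if "j \<le> i" "i \<le> a" for i
        using that(2,1)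
      proof (induction rule: inc_induct)
        case base
        show ?case using dvd_trans[OF le_imp_power_dvd[OF \<open>j \<le> a\<close>] top] .
      next
        case (step i)
        let ?A = "{z \<in> H. z [^] (p ^ i) = \<one>}" and ?B = "{z \<in> H. z [^] (p ^ Suc i) = \<one>}"
        have "?B = ?A \<union> {z \<in> H. ord z = p ^ Suc i}"
        proof -
          have "ord z dvd p ^ Suc i \<longleftrightarrow> ord z dvd p ^ i \<or> ord z = p ^ Suc i" for z
            unfolding divides_primepow_nat[OF p] by (auto simp: le_Suc_eq)
          then show ?thesis using pow_eq_id subgroup_mem[OF H] by auto
        qed
        moreover have "?A \<inter> {z \<in> H. ord z = p ^ Suc i} = {}"
        proof -
          have "\<not> p ^ Suc i dvd p ^ i" using p prime_gt_1_nat[OF p]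
            by (metis Suc_n_not_le_n power_dvd_imp_le)
          then show ?thesis using pow_eq_id subgroup_mem[OF H] by auto
        qed
        ultimately have "card ?B = card ?A + card {z \<in> H. ord z = p ^ Suc i}"
          using subgroup_finite[OF H] by (simp add: card_Un_disjoint)
        moreover have o: "p ^ j dvd card {z \<in> H. ord z = p ^ Suc i}"
        proof -
          have "p ^ j dvd p ^ i" using le_imp_power_dvd[OF step.prems] .
          also have "p ^ i dvd totient (p ^ Suc i)" using totient_prime_power_Suc[OF p] by simp
          also have "\<dots> dvd card {z \<in> H. ord z = p ^ Suc i}" by (rule totient_dvd_card_ord[OF H])
          finally show ?thesis .
        qed
        ultimately show ?case using dvd_add_left_iff[OF o] step by simp
      qed
      then show ?thesis using \<open>j \<le> a\<close> by blast
    qed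
  qed
qed

text \<open>One prime at a time: with \<open>d = p ^ j * u\<close>, the solutions are split by their
  part \<open>y\<close> satisfying \<open>y [^] u = \<one>\<close>, and the number of cofactors in
  centralizers is summed over conjugacy classes.\<close>

theorem frobenius:
  assumes H: "subgroup H G" and d: "d dvd card H"
  shows "d dvd card {x \<in> H. x [^] d = \<one>}"
proof -
  have d0: "d \<noteq> 0" using d subgroup_card_pos[OF H] by (metis dvd_0_left_iff less_irrefl)
  have B0: "card {x \<in> H. x [^] d = \<one>} \<noteq> 0"
    using subgroup_finite[OF H] subgroup.one_closed[OF H] by auto
  have "multiplicity p d \<le> multiplicity p (card {x \<in> H. x [^] d = \<one>})" if p: "prime p" for p
  proof -
    define j where "j = multiplicity p d"
    obtain u where u: "d = p ^ j * u" "\<not> p dvd u"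
      using multiplicity_decompose'[of d p] p d0 unfolding j_def by (metis not_prime_unit)
    have cop: "coprime u (p ^ j)" using u(2) p by (simp add: prime_imp_coprime coprime_commute)
    have "p ^ j dvd card H" using d u(1) by (metis dvd_mult_left)
    then have "p ^ j dvd card {x \<in> H. x [^] d = \<one>}"
      unfolding u(1) mult.commute[of "p ^ j"] card_pow_mult_eq_one[OF H cop]
    proof (rule sum_dvd_if_prime_power_solutions[OF H p])
      show "prime_power_solutions p (stab H conjugate y)" if "y \<in> {y \<in> H. y [^] u = \<one>}" for y
        using prime_power_solutions_subgroup[OF p] stab_subgroup[OF H acts_conjugate[OF H]] that by blast
    qed (use conj_pow_solutions_closed[OF H] in blast)+
    then show ?thesis using B0 p unfolding j_def by (metis multiplicity_geI not_prime_unit)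
  qed
  then show ?thesis using d0 B0 by (intro multiplicity_le_imp_dvd) auto
qed

end

subsection \<open>Counting cyclic subgroups\<close>

text \<open>Only the bound on the \<open>p\<close>-exponent involves \<open>b\<close>. So the
  solution sets of \<open>x [^] (p ^ b * m) = \<one>\<close> for growing \<open>b\<close> are
  layered by the \<open>p\<close>-exponent of \<open>ord x\<close>.\<close>

lemma dvd_prime_power_mult_iff:
  fixes p :: nat
  assumes p: "prime p" and m: "\<not> p dvd m" and o: "n \<noteq> 0"
  shows "n dvd p ^ b * m \<longleftrightarrow> multiplicity p n \<le> b \<and> n div p ^ multiplicity p n dvd m"
proof -
  define i where "i = multiplicity p n"
  obtain s where s: "n = p ^ i * s" "\<not> p dvd s"
    using multiplicity_decompose'[of n p] p o unfolding i_def by (metis not_prime_unit)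
  have p0: "p ^ i > 0" using p by (simp add: prime_gt_0_nat)
  then have sdiv: "n div p ^ i = s" using s(1) by simp
  have cs: "coprime s (p ^ b)" using s(2) p by (simp add: prime_imp_coprime coprime_commute)
  have cm: "coprime (p ^ i) m" using m p by (simp add: prime_imp_coprime)
  have "n dvd p ^ b * m \<longleftrightarrow> i \<le> b \<and> s dvd m"
  proof
    assume a: "n dvd p ^ b * m"
    have "p ^ i dvd p ^ b * m" "s dvd p ^ b * m" using a s(1) dvd_mult_left dvd_mult_right by blast+
    then have "p ^ i dvd p ^ b" "s dvd m"
      using cm cs by (simp_all add: coprime_dvd_mult_left_iff coprime_dvd_mult_right_iff)
    then show "i \<le> b \<and> s dvd m" using power_dvd_imp_le[of p i b] prime_gt_1_nat[OF p] by blast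
  next
    assume "i \<le> b \<and> s dvd m"
    then show "n dvd p ^ b * m" unfolding s(1) by (auto intro: mult_dvd_mono le_imp_power_dvd)
  qed
  then show ?thesis using sdiv unfolding i_def by simp
qed

text \<open>Abel summation: the weights \<open>1 / totient (p ^ j)\<close> do not increase, so the
  sum is smallest for \<open>A j = K * p ^ j\<close>, where the first term and each of the
  \<open>b\<close> increments contribute \<open>K\<close>. The surplus of \<open>A b\<close> over
  \<open>K * p ^ b\<close> is kept in the bound, because the improvement for non-cyclic Sylow
  subgroups comes from it.\<close>

lemma weighted_increment_sum:
  fixes A :: "nat \<Rightarrow> real" and K :: real
  assumes p: "prime p" and A: "\<And>j. j \<le> b \<Longrightarrow> K * real (p ^ j) \<le> A j"
  shows "K * real (b + 1) + (A b - K * real (p ^ b)) / real (totient (p ^ b))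
    \<le> A 0 + (\<Sum>j<b. (A (Suc j) - A j) / real (totient (p ^ Suc j)))"
  using A
proof (induction b)
  case 0
  then show ?case by simp
next
  case (Suc b)
  let ?f = "real (totient (p ^ b))" and ?g = "real (totient (p ^ Suc b))"
  have p1: "p > 1" using prime_gt_1_nat[OF p] .
  have gpos: "?g > 0" and fpos: "?f > 0" using p1 by auto
  have g: "?g = real p ^ Suc b - real p ^ b"
    using p1 unfolding totient_prime_power_Suc[OF p] by (simp add: of_nat_diff algebra_simps)
  have fg: "?f \<le> ?g"
    using totient_dvd_mono[of "p ^ b" "p ^ Suc b"] p1 by simp
  have "(A b - K * p ^ b) / ?g \<le> (A b - K * p ^ b) / ?f"
    using Suc.prems[of b] fg fpos gpos by (intro divide_left_mono mult_pos_pos) auto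
  moreover have "K * real (b + 1) + (A b - K * real (p ^ b)) / ?f
    \<le> A 0 + (\<Sum>j<b. (A (Suc j) - A j) / real (totient (p ^ Suc j)))"
    using Suc by (simp add: add.commute)
  moreover have "K * (Suc b + 1) + (A (Suc b) - K * p ^ Suc b) / ?g
      = K * (b + 1) + (A b - K * p ^ b) / ?g + (A (Suc b) - A b) / ?g"
  proof -
    have "K = K * (real p ^ Suc b - real p ^ b) / ?g" unfolding g[symmetric] using gpos by simp
    then show ?thesis by (simp add: algebra_simps diff_divide_distrib add_divide_distrib)
  qed
  ultimately show ?case by simp
qed

lemma prod_prime_power_eq:
  fixes n :: nat
  assumes "finite T" "prime_factors n \<subseteq> T" "n > 0" "\<And>q. q \<in> T \<Longrightarrow> prime q"
  shows "(\<Prod>q\<in>T. q ^ multiplicity q n) = n"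
proof -
  have "(\<Prod>q\<in>T. q ^ multiplicity q n) = (\<Prod>q\<in>prime_factors n. q ^ multiplicity q n)"
  proof (rule prod.mono_neutral_right[OF assms(1,2)])
    show "\<forall>i\<in>T - prime_factors n. i ^ multiplicity i n = 1"
      using assms(3,4) by (auto simp: prime_factors_multiplicity)
  qed
  also have "\<dots> = n" using prod_prime_factors[of n] assms(3) by simp
  finally show ?thesis .
qed

lemma coprime_prod_prime_powers:
  fixes p :: nat
  assumes "finite T" "prime p" "p \<notin> T" "\<And>q. q \<in> T \<Longrightarrow> prime q"
  shows "coprime (p ^ i) (\<Prod>q\<in>T. q ^ e q)"
proof (rule prod_coprime_right)
  fix q assume "q \<in> T"
  then have "coprime p q" using assms by (metis primes_coprime)
  then show "coprime (p ^ i) (q ^ e q)" by simp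
qed

lemma totient_prod_prime_powers:
  fixes e :: "nat \<Rightarrow> nat"
  assumes "finite T" "\<And>q. q \<in> T \<Longrightarrow> prime q"
  shows "totient (\<Prod>q\<in>T. q ^ e q) = (\<Prod>q\<in>T. totient (q ^ e q))"
  using assms
proof (induction T rule: finite_induct)
  case (insert p T)
  then show ?case using coprime_prod_prime_powers[of T p "e p" e] by (simp add: totient_mult_coprime)
qed simp

section \<open>Richards' bound, weighting one prime after another\<close>

context finite_group
begin

text \<open>The invariant of the induction over primes: \<open>u\<close> collects the primes already
  weighted, \<open>v\<close> is a part not yet touched, and \<open>K\<close> is the product of the
  factors gained. The start \<open>w = 1\<close>, \<open>u = 1\<close>, \<open>K = 1\<close> is
  Frobenius' theorem.\<close>

definition dominates :: "'a set \<Rightarrow> ('a \<Rightarrow> real) \<Rightarrow> nat \<Rightarrow> real \<Rightarrow> bool" where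
  "dominates H w u K \<longleftrightarrow>
    (\<forall>v. coprime u v \<longrightarrow> u * v dvd card H \<longrightarrow> K * v \<le> (\<Sum>x | x \<in> H \<and> x [^] (u * v) = \<one>. w x))"

lemma dominates_one: "subgroup H G \<Longrightarrow> dominates H (\<lambda>_. 1) 1 1"
  unfolding dominates_def
proof (intro allI impI)
  fix v assume H: "subgroup H G" and v: "1 * v dvd card H"
  have "v dvd card {x \<in> H. x [^] v = \<one>}" using frobenius[OF H] v by simp
  moreover have "card {x \<in> H. x [^] v = \<one>} > 0"
    using subgroup_finite[OF H] subgroup.one_closed[OF H] by (auto simp: card_gt_0_iff)
  ultimately have "v \<le> card {x \<in> H. x [^] v = \<one>}" by (rule dvd_imp_le)
  then show "1 * real v \<le> (\<Sum>x | x \<in> H \<and> x [^] (1 * v) = \<one>. 1)" by simp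
qed

text \<open>The local factor at \<open>p\<close> of \<open>1 / totient (ord x)\<close>.\<close>

definition prime_weight :: "nat \<Rightarrow> 'a \<Rightarrow> real" where
  "prime_weight p x = 1 / totient (p ^ multiplicity p (ord x))"

text \<open>Solutions for \<open>p ^ Suc j * m\<close> that are not solutions for
  \<open>p ^ j * m\<close> have \<open>p\<close>-exponent exactly \<open>Suc j\<close>, so the new
  weight is constant on each layer.\<close>

lemma sum_prime_weight:
  fixes m :: nat and w :: "'a \<Rightarrow> real"
  assumes H: "subgroup H G" and p: "prime p" and m: "\<not> p dvd m"
  defines "A \<equiv> \<lambda>j. \<Sum>x | x \<in> H \<and> x [^] (p ^ j * m) = \<one>. w x"
  shows "(\<Sum>x | x \<in> H \<and> x [^] (p ^ b * m) = \<one>. w x * prime_weight p x)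
    = A 0 + (\<Sum>j<b. (A (Suc j) - A j) / totient (p ^ Suc j))"
proof (induction b)
  case 0
  have "multiplicity p (ord x) = 0" if x: "x \<in> H" "x [^] m = \<one>" for x
  proof -
    have xc: "x \<in> carrier G" using subgroup_mem[OF H x(1)] .
    have "ord x dvd p ^ 0 * m" using x(2) pow_eq_id[OF xc] by simp
    then have "multiplicity p (ord x) \<le> 0"
      using dvd_prime_power_mult_iff[OF p m, of "ord x" 0] ord_pos[OF xc] by blast
    then show ?thesis by simp
  qed
  then show ?case unfolding A_def prime_weight_def by (auto intro!: sum.cong)
next
  case (Suc b)
  let ?S = "\<lambda>j. {x. x \<in> H \<and> x [^] (p ^ j * m) = \<one>}"
  let ?D = "?S (Suc b) - ?S b"
  have iff: "x \<in> ?S j \<longleftrightarrow> x \<in> H \<and> multiplicity p (ord x) \<le> j \<and> ord x div p ^ multiplicity p (ord x) dvd m" for x j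
    using dvd_prime_power_mult_iff[OF p m, of "ord x" j] pow_eq_id[of x "p ^ j * m"] ord_pos[of x] subgroup_mem[OF H]
    by blast
  have fin: "finite (?S j)" for j using subgroup_finite[OF H] by simp
  have sub: "?S b \<subseteq> ?S (Suc b)" using iff le_SucI by blast
  have mult: "multiplicity p (ord x) = Suc b" if "x \<in> ?D" for x
  proof -
    have "multiplicity p (ord x) \<le> Suc b" "\<not> multiplicity p (ord x) \<le> b"
      using that iff[of x b] iff[of x "Suc b"] by blast+
    then show ?thesis by linarith
  qed
  have "(\<Sum>x\<in>?S (Suc b). w x * prime_weight p x)
      = (\<Sum>x\<in>?S b. w x * prime_weight p x) + (\<Sum>x\<in>?D. w x * prime_weight p x)"
    using sum.subset_diff[OF sub fin] by (simp add: add.commute)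
  also have "(\<Sum>x\<in>?D. w x * prime_weight p x) = (\<Sum>x\<in>?D. w x / totient (p ^ Suc b))"
    unfolding prime_weight_def using mult by (intro sum.cong) auto
  also have "\<dots> = (\<Sum>x\<in>?D. w x) / totient (p ^ Suc b)" by (simp add: sum_divide_distrib)
  also have "(\<Sum>x\<in>?D. w x) = A (Suc b) - A b"
    unfolding A_def using sum_diff[OF fin sub] by simp
  finally show ?case using Suc by simp
qed

text \<open>The hypothesis with cofactor \<open>p ^ j * v\<close> bounds the weighted count of each
  layer from below by \<open>K * v * p ^ j\<close>. Abel summation turns the \<open>a + 1\<close>
  levels into the factor \<open>a + 1\<close>, and the surplus is dropped.\<close>

lemma dominates_prime_power:
  assumes H: "subgroup H G" and p: "prime p" and u: "\<not> p dvd u" and a: "a > 0"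
    and dom: "dominates H w u K"
  shows "dominates H (\<lambda>x. w x * prime_weight p x) (u * p ^ a) (K * (a + 1))"
  unfolding dominates_def
proof (intro allI impI)
  fix v assume cop: "coprime (u * p ^ a) v" and v: "u * p ^ a * v dvd card H"
  define A where "A = (\<lambda>j. \<Sum>x | x \<in> H \<and> x [^] (p ^ j * (u * v)) = \<one>. w x)"
  have "coprime (p ^ a) v" using cop by simp
  then have "coprime p v" using a by simp
  then have "\<not> p dvd v" using p by (metis coprime_absorb_left not_prime_unit)
  then have m: "\<not> p dvd u * v" using u p by (simp add: prime_dvd_mult_iff)
  have AK: "K * v * p ^ j \<le> A j" if "j \<le> a" for j
  proof -
    have "coprime u (p ^ j * v)"
      using cop u p prime_imp_coprime[OF p u] by (auto simp: coprime_commute)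
    moreover have "u * (p ^ j * v) dvd card H"
    proof (rule dvd_trans[OF _ v])
      show "u * (p ^ j * v) dvd u * p ^ a * v"
        using that by (simp add: mult.assoc mult_dvd_mono le_imp_power_dvd)
    qed
    ultimately have "K * real (p ^ j * v) \<le> (\<Sum>x | x \<in> H \<and> x [^] (u * (p ^ j * v)) = \<one>. w x)"
      using dom unfolding dominates_def by blast
    then show ?thesis unfolding A_def by (simp add: mult_ac)
  qed
  have "K * v * (a + 1) + (A a - K * v * p ^ a) / totient (p ^ a)
    \<le> A 0 + (\<Sum>j<a. (A (Suc j) - A j) / totient (p ^ Suc j))"
    by (rule weighted_increment_sum[OF p AK])
  also have "\<dots> = (\<Sum>x | x \<in> H \<and> x [^] (p ^ a * (u * v)) = \<one>. w x * prime_weight p x)"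
    unfolding A_def using sum_prime_weight[OF H p m] by simp
  finally have "K * v * (a + 1) + (A a - K * v * p ^ a) / totient (p ^ a)
    \<le> (\<Sum>x | x \<in> H \<and> x [^] (p ^ a * (u * v)) = \<one>. w x * prime_weight p x)" .
  moreover have "0 \<le> (A a - K * v * p ^ a) / totient (p ^ a)" using AK[of a] by simp
  ultimately show "K * (a + 1) * v \<le> (\<Sum>x | x \<in> H \<and> x [^] (u * p ^ a * v) = \<one>. w x * prime_weight p x)"
    by (simp add: mult_ac)
qed

text \<open>An order with \<open>p\<close>-exponent \<open>a\<close> would have a power of order
  \<open>p ^ a\<close>, so the solutions for \<open>p ^ a * v\<close> already solve
  \<open>p ^ (a - 1) * v\<close>. Frobenius at level \<open>a\<close> therefore gives level
  \<open>a - 1\<close> a surplus of at least \<open>v * (p ^ a - p ^ (a - 1))\<close>. Divided by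
  \<open>totient (p ^ (a - 1)) = p ^ (a - 2) * (p - 1)\<close> this is \<open>v * p\<close>, added
  to \<open>v * a\<close> from the levels up to \<open>a - 1\<close>.\<close>

lemma dominates_prime_power_noncyclic:
  assumes H: "subgroup H G" and p: "prime p" and a: "a \<ge> 2"
    and no: "\<And>x. x \<in> H \<Longrightarrow> ord x \<noteq> p ^ a"
  shows "dominates H (prime_weight p) (p ^ a) (a + p)"
  unfolding dominates_def
proof (intro allI impI)
  fix v assume cop: "coprime (p ^ a) v" and v: "p ^ a * v dvd card H"
  define A where "A = (\<lambda>j. \<Sum>x | x \<in> H \<and> x [^] (p ^ j * v) = \<one>. 1 :: real)"
  obtain c where c: "a = Suc (Suc c)" using a by (metis Suc_le_D numeral_2_eq_2 Suc_le_mono)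
  have "coprime p v" using cop a by simp
  then have m: "\<not> p dvd v" using p by (metis coprime_absorb_left not_prime_unit)
  have p1: "p > 1" using prime_gt_1_nat[OF p] .
  have AK: "real v * p ^ j \<le> A j" if "j \<le> a" for j
  proof -
    have "p ^ j * v dvd card H"
    proof (rule dvd_trans[OF _ v])
      show "p ^ j * v dvd p ^ a * v" using that by (simp add: mult_dvd_mono le_imp_power_dvd)
    qed
    then have "1 * real (p ^ j * v) \<le> (\<Sum>x | x \<in> H \<and> x [^] (1 * (p ^ j * v)) = \<one>. 1)"
      using dominates_one[OF H] unfolding dominates_def by fastforce
    then show ?thesis unfolding A_def by (simp add: mult_ac)
  qed
  have eq: "{x. x \<in> H \<and> x [^] (p ^ a * v) = \<one>} = {x. x \<in> H \<and> x [^] (p ^ Suc c * v) = \<one>}"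
  proof -
    have "ord x dvd p ^ a * v \<longleftrightarrow> ord x dvd p ^ Suc c * v" if x: "x \<in> H" for x
    proof -
      have xc: "x \<in> carrier G" and o0: "ord x \<noteq> 0" using x subgroup_mem[OF H] ord_pos[of x] by auto
      have "multiplicity p (ord x) \<noteq> a"
      proof
        assume "multiplicity p (ord x) = a"
        then obtain s where s: "ord x = p ^ a * s"
          using multiplicity_dvd[of p "ord x"] by blast
        have "s \<noteq> 0" using s o0 by (metis mult_0_right)
        then have "ord (x [^] s) = p ^ a" using ord_pow[OF xc, of s] s by simp
        then show False using no subgroup_pow[OF H x] by blast
      qed
      then show ?thesis unfolding dvd_prime_power_mult_iff[OF p m o0] c by auto
    qed
    then show ?thesis using pow_eq_id subgroup_mem[OF H] by blast
  qed
  have "real v * (Suc c + 1) + (A (Suc c) - real v * p ^ Suc c) / totient (p ^ Suc c)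
    \<le> A 0 + (\<Sum>j<Suc c. (A (Suc j) - A j) / totient (p ^ Suc j))"
    using AK c by (intro weighted_increment_sum[OF p AK]) auto
  also have "\<dots> = (\<Sum>x | x \<in> H \<and> x [^] (p ^ Suc c * v) = \<one>. 1 * prime_weight p x)"
    unfolding A_def using sum_prime_weight[OF H p m, of "\<lambda>_. 1" "Suc c"] by simp
  finally have 1: "real v * a + (A (Suc c) - real v * p ^ Suc c) / totient (p ^ Suc c)
    \<le> (\<Sum>x | x \<in> H \<and> x [^] (p ^ a * v) = \<one>. prime_weight p x)"
    unfolding eq using c by simp
  have "A (Suc c) = A a" unfolding A_def eq ..
  then have "real v * p ^ a - real v * p ^ Suc c \<le> A (Suc c) - real v * p ^ Suc c"
    using AK[of a] by simp
  moreover have "totient (p ^ Suc c) > 0" using p1 by simp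
  ultimately have "(real v * p ^ a - real v * p ^ Suc c) / totient (p ^ Suc c)
      \<le> (A (Suc c) - real v * p ^ Suc c) / totient (p ^ Suc c)"
    by (intro divide_right_mono) auto
  moreover have "(real v * p ^ a - real v * p ^ Suc c) / totient (p ^ Suc c) = v * p"
  proof -
    have "real (totient (p ^ Suc c)) = real p ^ c * (real p - 1)"
      using p1 unfolding totient_prime_power_Suc[OF p] by (simp add: of_nat_diff)
    moreover have "real v * p ^ a - real v * p ^ Suc c = (v * p) * (real p ^ c * (real p - 1))"
      unfolding c by (simp add: algebra_simps)
    moreover have "real p ^ c * (real p - 1) \<noteq> 0" using p1 by simp
    ultimately show ?thesis by simp
  qed
  ultimately show "real (a + p) * v \<le> (\<Sum>x | x \<in> H \<and> x [^] (p ^ a * v) = \<one>. prime_weight p x)"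
    using 1 by (simp add: algebra_simps)
qed

lemma dominates_prod:
  assumes H: "subgroup H G" and dom: "dominates H w u K" and "finite S"
    and "\<And>q. q \<in> S \<Longrightarrow> prime q \<and> \<not> q dvd u \<and> e q > 0"
  shows "dominates H (\<lambda>x. w x * (\<Prod>q\<in>S. prime_weight q x)) (u * (\<Prod>q\<in>S. q ^ e q)) (K * (\<Prod>q\<in>S. real (e q + 1)))"
  using assms(3,4)
proof (induction S rule: finite_induct)
  case empty
  then show ?case using dom by simp
next
  case (insert q S)
  have q: "prime q" "\<not> q dvd u" "e q > 0" using insert.prems by auto
  have "coprime (q ^ 1) (\<Prod>q\<in>S. q ^ e q)"
    using insert by (intro coprime_prod_prime_powers) auto
  then have "\<not> q dvd (\<Prod>q\<in>S. q ^ e q)"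
    using q(1) by (metis coprime_absorb_left not_prime_unit power_one_right)
  then have "\<not> q dvd u * (\<Prod>q\<in>S. q ^ e q)" using q by (simp add: prime_dvd_mult_iff)
  have dS: "dominates H (\<lambda>x. w x * (\<Prod>q\<in>S. prime_weight q x)) (u * (\<Prod>q\<in>S. q ^ e q)) (K * (\<Prod>q\<in>S. real (e q + 1)))"
    using insert by blast
  show ?case
    using dominates_prime_power[OF H q(1) \<open>\<not> q dvd u * (\<Prod>q\<in>S. q ^ e q)\<close> q(3) dS] insert.hyps
    by (simp add: mult_ac)
qed

text \<open>For \<open>n = card H\<close> these are all cyclic subgroups of \<open>H\<close>.
  Smaller \<open>n\<close> keep only orders dividing \<open>n\<close>, which later separates them
  from the groups containing a Sylow \<open>q\<close>-subgroup.\<close>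

definition cyclic_subgroups :: "'a set \<Rightarrow> nat \<Rightarrow> 'a set set" where
  "cyclic_subgroups H n = (\<lambda>x. generate G {x}) ` {x \<in> H. x [^] n = \<one>}"

text \<open>Each cyclic subgroup is hit by its \<open>totient (ord x)\<close> generators, whose
  weights add up to 1.\<close>

lemma card_cyclic_subgroups:
  assumes H: "subgroup H G"
  shows "real (card (cyclic_subgroups H n)) = (\<Sum>x | x \<in> H \<and> x [^] n = \<one>. 1 / totient (ord x))"
proof -
  let ?E = "{x \<in> H. x [^] n = \<one>}" and ?g = "\<lambda>x. generate G {x}"
  have fin: "finite ?E" using subgroup_finite[OF H] by simp
  have car: "\<And>x. x \<in> H \<Longrightarrow> x \<in> carrier G" using subgroup_mem[OF H] .
  have "(\<Sum>x\<in>?E. 1 / real (totient (ord x)))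
      = (\<Sum>C\<in>?g ` ?E. \<Sum>x\<in>{x \<in> ?E. ?g x = C}. 1 / real (totient (ord x)))"
    by (rule sum.image_gen[OF fin])
  also have "\<dots> = (\<Sum>C\<in>?g ` ?E. 1)"
  proof (rule sum.cong[OF refl])
    fix C assume "C \<in> ?g ` ?E"
    then obtain y where y: "y \<in> H" "y [^] n = \<one>" "C = ?g y" by auto
    have o: "ord x = ord y" if "x \<in> H" "?g x = ?g y" for x
      using generate_pow_card car that y by metis
    have "{x \<in> ?E. ?g x = C} = {x \<in> H. ?g x = ?g y}"
    proof -
      have "x [^] n = \<one>" if x: "x \<in> H" "?g x = ?g y" for x
        using o[OF x] y(2) pow_eq_id[OF car[OF x(1)], of n] pow_eq_id[OF car[OF y(1)], of n] by simp
      then show ?thesis unfolding y(3) by blast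
    qed
    then have c: "card {x \<in> ?E. ?g x = C} = totient (ord y)"
      using generators_in_subgroup[OF H y(1)] card_generators car y(1) by simp
    have "(\<Sum>x\<in>{x \<in> ?E. ?g x = C}. 1 / real (totient (ord x)))
        = (\<Sum>x\<in>{x \<in> ?E. ?g x = C}. 1 / real (totient (ord y)))"
    proof (rule sum.cong[OF refl])
      fix x assume "x \<in> {x \<in> ?E. ?g x = C}"
      then have "x \<in> H" "?g x = ?g y" using y(3) by simp_all
      from o[OF this] show "1 / real (totient (ord x)) = 1 / real (totient (ord y))" by (rule arg_cong)
    qed
    also have "\<dots> = 1" unfolding sum_constant c using ord_pos[OF car[OF y(1)]] by simp
    finally show "(\<Sum>x\<in>{x \<in> ?E. ?g x = C}. 1 / real (totient (ord x))) = 1" .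
  qed
  finally show ?thesis unfolding cyclic_subgroups_def by simp
qed

lemma prod_prime_weight:
  assumes x: "x \<in> carrier G" "x [^] n = \<one>" and T: "finite T" "prime_factors n \<subseteq> T" "\<And>q. q \<in> T \<Longrightarrow> prime q"
    and n: "n > 0"
  shows "(\<Prod>q\<in>T. prime_weight q x) = 1 / totient (ord x)"
proof -
  have "ord x dvd n" using x pow_eq_id by simp
  then have "prime_factors (ord x) \<subseteq> T" using T(2) n dvd_prime_factors[of n "ord x"] by auto
  then have "ord x = (\<Prod>q\<in>T. q ^ multiplicity q (ord x))"
    using prod_prime_power_eq[OF T(1) _ _ T(3)] ord_pos[OF x(1)] by simp
  then have "totient (ord x) = (\<Prod>q\<in>T. totient (q ^ multiplicity q (ord x)))"
    using totient_prod_prime_powers[OF T(1,3), of "\<lambda>q. multiplicity q (ord x)"] by simp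
  then show ?thesis unfolding prime_weight_def by (simp add: prod_dividef)
qed

lemma card_cyclic_subgroups_ge:
  assumes H: "subgroup H G"
  shows "(\<Prod>q\<in>prime_factors (card H). multiplicity q (card H) + 1) \<le> card (cyclic_subgroups H (card H))"
proof -
  let ?T = "prime_factors (card H)" and ?e = "\<lambda>q. multiplicity q (card H)"
  have pos: "card H > 0" using subgroup_card_pos[OF H] .
  have N: "(\<Prod>q\<in>?T. q ^ ?e q) = card H" using pos by (intro prod_prime_power_eq) auto
  have "dominates H (\<lambda>x. 1 * (\<Prod>q\<in>?T. prime_weight q x)) (1 * (\<Prod>q\<in>?T. q ^ ?e q)) (1 * (\<Prod>q\<in>?T. real (?e q + 1)))"
  proof (rule dominates_prod[OF H dominates_one[OF H]])
    show "finite ?T" by simp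
    show "prime q \<and> \<not> q dvd 1 \<and> 0 < ?e q" if "q \<in> ?T" for q
      using that by (auto simp: prime_factors_multiplicity)
  qed
  \<comment> \<open>All primes are absorbed, so the remaining cofactor is
    \<open>v = 1\<close>.\<close>
  then have "(\<Prod>q\<in>?T. real (?e q + 1)) \<le> (\<Sum>x | x \<in> H \<and> x [^] card H = \<one>. \<Prod>q\<in>?T. prime_weight q x)"
    unfolding dominates_def N by (auto dest: spec[of _ 1])
  also have "\<dots> = (\<Sum>x | x \<in> H \<and> x [^] card H = \<one>. 1 / totient (ord x))"
    using pos subgroup_mem[OF H] by (intro sum.cong prod_prime_weight[where n = "card H"]) auto
  finally have "real (\<Prod>q\<in>?T. ?e q + 1) \<le> card (cyclic_subgroups H (card H))"
    unfolding card_cyclic_subgroups[OF H] by simp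
  then show ?thesis by linarith
qed

text \<open>A proper divisor \<open>n\<close> of \<open>card H\<close> is allowed since the Klein
  case also counts only the cyclic subgroups of order prime to some \<open>q\<close>.\<close>

lemma card_cyclic_subgroups_noncyclic_ge:
  assumes H: "subgroup H G" and p: "prime p" and a: "2 \<le> a" and no: "\<And>x. x \<in> H \<Longrightarrow> ord x \<noteq> p ^ a"
    and S: "finite S" "\<And>q. q \<in> S \<Longrightarrow> prime q \<and> q \<noteq> p \<and> e q > 0"
    and n: "n = p ^ a * (\<Prod>q\<in>S. q ^ e q)" "n dvd card H"
  shows "(a + p) * (\<Prod>q\<in>S. e q + 1) \<le> card (cyclic_subgroups H n)"
proof -
  have pos: "n > 0" using n(2) subgroup_card_pos[OF H] by (metis dvd_0_left_iff gr0I less_irrefl)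
  have "dominates H (\<lambda>x. prime_weight p x * (\<Prod>q\<in>S. prime_weight q x)) n (real (a + p) * (\<Prod>q\<in>S. real (e q + 1)))"
    unfolding n(1)
  proof (rule dominates_prod[OF H dominates_prime_power_noncyclic[OF H p a no] S(1)])
    show "prime q \<and> \<not> q dvd p ^ a \<and> 0 < e q" if "q \<in> S" for q
      using S(2)[OF that] p by (metis prime_dvd_power primes_dvd_imp_eq)
  qed
  then have "real (a + p) * (\<Prod>q\<in>S. real (e q + 1)) \<le> (\<Sum>x | x \<in> H \<and> x [^] n = \<one>. prime_weight p x * (\<Prod>q\<in>S. prime_weight q x))"
    unfolding dominates_def using n(2) by (auto dest: spec[of _ 1])
  also have "\<dots> = (\<Sum>x | x \<in> H \<and> x [^] n = \<one>. \<Prod>q\<in>insert p S. prime_weight q x)"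
    using S(2) by (intro sum.cong refl prod.insert[symmetric] S(1)) blast
  also have "\<dots> = (\<Sum>x | x \<in> H \<and> x [^] n = \<one>. 1 / totient (ord x))"
  proof (intro sum.cong prod_prime_weight[where n = n] refl)
    show "prime_factors n \<subseteq> insert p S"
    proof
      fix q assume "q \<in> prime_factors n"
      then have q: "prime q" "q dvd p ^ a * (\<Prod>q\<in>S. q ^ e q)" using n(1) by auto
      then consider "q dvd p ^ a" | "q dvd (\<Prod>q\<in>S. q ^ e q)" using prime_dvd_mult_iff by blast
      then show "q \<in> insert p S"
      proof cases
        case 1
        then show ?thesis using q(1) p by (metis insertI1 prime_dvd_power primes_dvd_imp_eq)
      next
        case 2
        then obtain r where "r \<in> S" "q dvd r ^ e r" using prime_dvd_prod_iff[OF S(1) q(1), of "\<lambda>r. r ^ e r"] by auto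
        then have "q dvd r" "prime r" using q(1) S(2) prime_dvd_power by blast+
        then have "q = r" using q(1) primes_dvd_imp_eq by blast
        then show ?thesis using \<open>r \<in> S\<close> by simp
      qed
    qed
  next
    show "x \<in> carrier G" "x [^] n = \<one>" if "x \<in> {x. x \<in> H \<and> x [^] n = \<one>}" for x
      using that subgroup_mem[OF H] by blast+
    show "finite (insert p S)" using S(1) by simp
    show "prime q" if "q \<in> insert p S" for q using that S(2) p by blast
    show "n > 0" by (rule pos)
  qed
  finally have "real ((a + p) * (\<Prod>q\<in>S. e q + 1)) \<le> card (cyclic_subgroups H n)"
    unfolding card_cyclic_subgroups[OF H] by simp
  then show ?thesis by linarith
qed

subsection \<open>Sylow subgroups and complements\<close>

definition subgroups_in :: "'a set \<Rightarrow> 'a set set" where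
  "subgroups_in H = {K. subgroup K G \<and> K \<subseteq> H}"

lemma finite_subgroups_in: "subgroup H G \<Longrightarrow> finite (subgroups_in H)"
  unfolding subgroups_in_def using subgroup_finite by (simp add: finite_subset[of _ "Pow H"] subset_iff)

lemma set_mult_iff: "z \<in> X <#> P \<longleftrightarrow> (\<exists>x\<in>X. \<exists>g\<in>P. z = x \<otimes> g)"
  unfolding set_mult_def by blast

lemma set_mult_subset: "subgroup H G \<Longrightarrow> X \<subseteq> H \<Longrightarrow> P \<subseteq> H \<Longrightarrow> X <#> P \<subseteq> H"
  unfolding set_mult_def using subgroup.m_closed by fastforce

lemma mult_conjugate: "g \<in> carrier G \<Longrightarrow> x \<in> carrier G \<Longrightarrow> g \<otimes> x = conjugate g x \<otimes> g"
  unfolding conjugate_def by (simp add: m_assoc)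

lemma subgroup_set_mult:
  assumes X: "subgroup X G" and P: "subgroup P G"
    and n: "\<And>g x. g \<in> P \<Longrightarrow> x \<in> X \<Longrightarrow> conjugate g x \<in> X"
  shows "subgroup (X <#> P) G"
proof (rule subgroupI)
  have Xc: "\<And>x. x \<in> X \<Longrightarrow> x \<in> carrier G" and Pc: "\<And>x. x \<in> P \<Longrightarrow> x \<in> carrier G"
    using subgroup_mem X P by blast+
  show "X <#> P \<subseteq> carrier G" using Xc Pc unfolding set_mult_def by auto
  show "X <#> P \<noteq> {}" using subgroup.one_closed[OF X] subgroup.one_closed[OF P] unfolding set_mult_def by blast
  fix a assume "a \<in> X <#> P"
  then obtain x g where a: "x \<in> X" "g \<in> P" "a = x \<otimes> g" unfolding set_mult_iff by blast
  have ig: "inv g \<in> P" and ix: "inv x \<in> X"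
    using a subgroup.m_inv_closed[OF P] subgroup.m_inv_closed[OF X] by blast+
  have "inv a = inv g \<otimes> inv x" using a Xc Pc by (simp add: inv_mult_group)
  also have "\<dots> = conjugate (inv g) (inv x) \<otimes> inv g" using mult_conjugate ig ix Xc Pc by blast
  finally show "inv a \<in> X <#> P" unfolding set_mult_iff using n[OF ig ix] ig by blast
  fix b assume "b \<in> X <#> P"
  then obtain y h where b: "y \<in> X" "h \<in> P" "b = y \<otimes> h" unfolding set_mult_iff by blast
  have "a \<otimes> b = x \<otimes> (g \<otimes> y) \<otimes> h" using a b Xc Pc by (simp add: m_assoc)
  also have "g \<otimes> y = conjugate g y \<otimes> g" using mult_conjugate a b Xc Pc by blast
  also have "x \<otimes> (conjugate g y \<otimes> g) \<otimes> h = (x \<otimes> conjugate g y) \<otimes> (g \<otimes> h)"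
    using a b Xc Pc by (simp add: m_assoc)
  finally show "a \<otimes> b \<in> X <#> P"
    unfolding set_mult_iff
    using subgroup.m_closed[OF X a(1) n[OF a(2) b(1)]] subgroup.m_closed[OF P a(2) b(2)] by blast
qed

lemma subset_set_mult:
  assumes "subgroup X G" "subgroup P G"
  shows "X \<subseteq> X <#> P" "P \<subseteq> X <#> P"
proof -
  show "X \<subseteq> X <#> P"
  proof
    fix x assume x: "x \<in> X"
    then have "x = x \<otimes> \<one>" using subgroup_mem assms(1) by simp
    then show "x \<in> X <#> P" unfolding set_mult_iff using x subgroup.one_closed[OF assms(2)] by blast
  qed
  show "P \<subseteq> X <#> P"
  proof
    fix x assume x: "x \<in> P"
    then have "x = \<one> \<otimes> x" using subgroup_mem assms(2) by simp
    then show "x \<in> X <#> P" unfolding set_mult_iff using x subgroup.one_closed[OF assms(1)] by blast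
  qed
qed

lemma card_set_mult:
  assumes X: "subgroup X G" and P: "subgroup P G" and disj: "X \<inter> P = {\<one>}"
  shows "card (X <#> P) = card X * card P"
proof -
  have Xc: "\<And>x. x \<in> X \<Longrightarrow> x \<in> carrier G" and Pc: "\<And>x. x \<in> P \<Longrightarrow> x \<in> carrier G"
    using subgroup_mem X P by blast+
  have "inj_on (\<lambda>(x, g). x \<otimes> g) (X \<times> P)"
  proof (rule inj_onI, clarify)
    fix x g y h assume a: "x \<in> X" "g \<in> P" "y \<in> X" "h \<in> P" "x \<otimes> g = y \<otimes> h"
    have "inv y \<otimes> x = h \<otimes> inv g"
      using a Xc Pc by (metis inv_closed inv_solve_left inv_solve_right m_assoc m_closed)
    moreover have "inv y \<otimes> x \<in> X" "h \<otimes> inv g \<in> P"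
      using a X P by (simp_all add: subgroup.m_closed subgroup.m_inv_closed)
    ultimately have "inv y \<otimes> x = \<one>" "h \<otimes> inv g = \<one>" using disj by auto
    then show "x = y \<and> g = h" using a Xc Pc by (metis inv_comm inv_equality inv_inv inv_closed)
  qed
  moreover have "X <#> P = (\<lambda>(x, g). x \<otimes> g) ` (X \<times> P)" unfolding set_mult_def by auto
  ultimately show ?thesis by (simp add: card_image card_cartesian_product)
qed

definition normalizes :: "'a set \<Rightarrow> 'a set \<Rightarrow> bool" where
  "normalizes P X \<longleftrightarrow> (\<forall>g\<in>P. conjugate g ` X = X)"

lemma normalizes_conjugate_in: "normalizes P X \<Longrightarrow> g \<in> P \<Longrightarrow> x \<in> X \<Longrightarrow> conjugate g x \<in> X"
  unfolding normalizes_def by blast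

lemma acts_conjugate_sets: "subgroup H G \<Longrightarrow> acts H (\<lambda>g X. conjugate g ` X) {X. X \<subseteq> carrier G}"
  unfolding acts_def
proof (intro conjI ballI)
  fix s assume s: "s \<in> {X. X \<subseteq> carrier G}"
  show "conjugate \<one> ` s = s" using s by (force simp: image_iff)
  fix h assume "subgroup H G" "h \<in> H"
  then have h: "h \<in> carrier G" using subgroup_mem by blast
  show "conjugate h ` s \<in> {X. X \<subseteq> carrier G}" using s h by auto
  fix k assume "subgroup H G" "k \<in> H"
  then have k: "k \<in> carrier G" using subgroup_mem by blast
  show "conjugate (h \<otimes> k) ` s = conjugate h ` conjugate k ` s"
    unfolding image_image using s h k by (intro image_cong) (auto simp: conj_conj)
qed

lemma conjugate_image_subgroup:
  assumes g: "g \<in> carrier G" and X: "subgroup X G"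
  shows "subgroup (conjugate g ` X) G"
proof (rule subgroupI)
  have Xc: "\<And>x. x \<in> X \<Longrightarrow> x \<in> carrier G" using subgroup_mem[OF X] .
  show "conjugate g ` X \<subseteq> carrier G" using g Xc by auto
  show "conjugate g ` X \<noteq> {}" using subgroup.one_closed[OF X] by blast
  fix a assume "a \<in> conjugate g ` X"
  then obtain x where a: "x \<in> X" "a = conjugate g x" by blast
  show "inv a \<in> conjugate g ` X"
    using a conj_m_inv[OF g Xc[OF a(1)]] subgroup.m_inv_closed[OF X a(1)] by (metis image_eqI)
  fix b assume "b \<in> conjugate g ` X"
  then obtain y where b: "y \<in> X" "b = conjugate g y" by blast
  show "a \<otimes> b \<in> conjugate g ` X"
    using a b conj_mult[OF g Xc[OF a(1)] Xc[OF b(1)]] subgroup.m_closed[OF X a(1) b(1)] by (metis image_eqI)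
qed

lemma card_conjugate_image: "g \<in> carrier G \<Longrightarrow> X \<subseteq> carrier G \<Longrightarrow> card (conjugate g ` X) = card X"
  by (rule card_image) (rule inj_on_subset[OF conj_inj])

text \<open>The left cosets of \<open>X\<close> in \<open>X <#> P\<close> form a single \<open>P\<close>-orbit, so their number is a power of \<open>p\<close>.\<close>

lemma sylow_normalizes_imp_eq:
  assumes H: "subgroup H G" and p: "prime p" and max: "\<not> p ^ Suc a dvd card H"
    and P: "subgroup P G" "P \<subseteq> H" "card P = p ^ a" and X: "subgroup X G" "X \<subseteq> H" "card X = p ^ a"
    and n: "normalizes P X"
  shows "P = X"
proof -
  let ?f = "\<lambda>g S. (\<lambda>x. g \<otimes> x) ` S" and ?K = "X <#> P"
  have Xc: "\<And>x. x \<in> X \<Longrightarrow> x \<in> carrier G" and Pc: "\<And>x. x \<in> P \<Longrightarrow> x \<in> carrier G"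
    using subgroup_mem X P by blast+
  have K: "subgroup ?K G" "?K \<subseteq> H"
    using subgroup_set_mult[OF X(1) P(1)] normalizes_conjugate_in[OF n] set_mult_subset[OF H X(2) P(2)]
    by blast+
  have act: "acts L ?f {X. X \<subseteq> carrier G}" if "subgroup L G" for L
    unfolding acts_def
  proof (intro conjI ballI)
    fix s assume s: "s \<in> {X. X \<subseteq> carrier G}"
    show "?f \<one> s = s" using s by (force simp: image_iff)
    fix h assume "h \<in> L"
    then have h: "h \<in> carrier G" using that subgroup_mem by blast
    show "?f h s \<in> {X. X \<subseteq> carrier G}" using s h by auto
    fix k assume "k \<in> L"
    then have k: "k \<in> carrier G" using that subgroup_mem by blast
    show "?f (h \<otimes> k) s = ?f h (?f k s)"
      unfolding image_image using s h k by (intro image_cong) (auto simp: m_assoc)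
  qed
  have Xs: "X \<in> {X. X \<subseteq> carrier G}" using Xc by blast
  have xX: "?f x X = X" if x: "x \<in> X" for x
  proof (intro equalityI subsetI)
    fix y assume "y \<in> ?f x X" then show "y \<in> X" using x subgroup.m_closed[OF X(1)] by blast
  next
    fix y assume y: "y \<in> X"
    have "y = x \<otimes> (inv x \<otimes> y)" using x y Xc by (simp flip: m_assoc)
    moreover have "inv x \<otimes> y \<in> X"
      using x y subgroup.m_closed[OF X(1)] subgroup.m_inv_closed[OF X(1)] by blast
    ultimately show "y \<in> ?f x X" by blast
  qed
  have stabX: "g \<in> X" if "g \<in> carrier G" "?f g X = X" for g
  proof -
    have "g \<otimes> \<one> \<in> X" using that(2) subgroup.one_closed[OF X(1)] by blast
    then show ?thesis using that(1) by simp
  qed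
  have "stab ?K ?f X = X"
    unfolding stab_def using xX stabX subgroup_mem[OF K(1)] subset_set_mult[OF X(1) P(1)] by blast
  then have oK: "card (orb ?K ?f X) * p ^ a = card ?K"
    using orbit_stabilizer[OF K(1) act[OF K(1)] Xs] X(3) by simp
  have "orb ?K ?f X = orb P ?f X"
  proof (intro equalityI subsetI)
    fix S assume "S \<in> orb ?K ?f X"
    then obtain x g where xg: "x \<in> X" "g \<in> P" "S = ?f (x \<otimes> g) X" unfolding orb_def by (auto simp: set_mult_iff)
    have gc: "g \<in> carrier G" "inv g \<in> P" using xg Pc subgroup.m_inv_closed[OF P(1)] by blast+
    have "g \<otimes> conjugate (inv g) x = x \<otimes> g"
      unfolding conjugate_def using xg Xc gc by (simp flip: m_assoc)
    moreover have cx: "conjugate (inv g) x \<in> X" using normalizes_conjugate_in[OF n gc(2) xg(1)] .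
    ultimately have "S = ?f g (?f (conjugate (inv g) x) X)"
      using xg(3) gc Xc unfolding image_image by (simp flip: m_assoc cong: image_cong_simp)
    then have "S = ?f g X" using xX[OF cx] by simp
    then show "S \<in> orb P ?f X" unfolding orb_def using xg(2) by blast
  next
    fix S assume "S \<in> orb P ?f X"
    then show "S \<in> orb ?K ?f X" unfolding orb_def using subset_set_mult[OF X(1) P(1)] by blast
  qed
  moreover have "card (orb P ?f X) dvd p ^ a"
    using orbit_stabilizer[OF P(1) act[OF P(1)] Xs] P(3) by (metis dvd_triv_left)
  ultimately obtain i where i: "card (orb ?K ?f X) = p ^ i" using p divides_primepow_nat by metis
  \<comment> \<open>A positive exponent would put \<open>p ^ Suc a\<close> into
    \<open>card ?K\<close>, hence into \<open>card H\<close>.\<close>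
  have "i = 0"
  proof (rule ccontr)
    assume "i \<noteq> 0"
    then have "p dvd p ^ i" by (simp add: dvd_power)
    then have "p ^ Suc a dvd p ^ i * p ^ a" by (simp add: mult_dvd_mono)
    also have "\<dots> dvd card H" using oK i card_subgroup_dvd[OF K(1) H K(2)] by simp
    finally show False using max by blast
  qed
  then have "card ?K = card X" using oK i X(3) by simp
  then have "X = ?K"
    using card_subset_eq[OF subgroup_finite[OF K(1)] subset_set_mult(1)[OF X(1) P(1)]] by simp
  then have "P \<subseteq> X" using subset_set_mult(2)[OF X(1) P(1)] by simp
  then show ?thesis using card_subset_eq[OF subgroup_finite[OF X(1)]] X(3) P(3) by simp
qed

section \<open>Conjugacy of Sylow subgroups and their number modulo \<open>p\<close>\<close>

abbreviation conjugates :: "'a set \<Rightarrow> 'a set \<Rightarrow> 'a set set" where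
  "conjugates H X \<equiv> orb H (\<lambda>g X. conjugate g ` X) X"

abbreviation normalizer_in :: "'a set \<Rightarrow> 'a set \<Rightarrow> 'a set" where
  "normalizer_in H X \<equiv> stab H (\<lambda>g X. conjugate g ` X) X"

lemma normalizes_normalizer_in: "normalizes (normalizer_in H X) X"
  unfolding normalizes_def stab_def by blast

lemma normalizes_self: "subgroup X G \<Longrightarrow> normalizes X X"
  unfolding normalizes_def
proof
  fix g assume X: "subgroup X G" and g: "g \<in> X"
  have gc: "g \<in> carrier G" using g X subgroup_mem by blast
  show "conjugate g ` X = X"
  proof (intro equalityI subsetI)
    fix y assume "y \<in> conjugate g ` X" then show "y \<in> X" using conj_in_subgroup[OF X g] by blast
  next
    fix y assume y: "y \<in> X"
    then have "y = conjugate g (conjugate (inv g) y)" using conj_inv' gc X subgroup_mem by simp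
    moreover have "conjugate (inv g) y \<in> X"
      using conj_in_subgroup[OF X subgroup.m_inv_closed[OF X g] y] .
    ultimately show "y \<in> conjugate g ` X" by blast
  qed
qed

context
  fixes H X p a
  assumes H: "subgroup H G" and p: "prime p" and max: "\<not> p ^ Suc a dvd card H"
    and X: "subgroup X G" "X \<subseteq> H" "card X = p ^ a"
begin

lemma conjugatesD:
  assumes "Y \<in> conjugates H X"
  shows "subgroup Y G" "Y \<subseteq> H" "card Y = p ^ a"
proof -
  obtain g where g: "g \<in> H" "Y = conjugate g ` X" using assms unfolding orb_def by blast
  have gc: "g \<in> carrier G" using g subgroup_mem[OF H] by blast
  have Xc: "X \<subseteq> carrier G" using X subgroup.subset by blast
  show "subgroup Y G" using g(2) conjugate_image_subgroup[OF gc X(1)] by simp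
  show "Y \<subseteq> H" using g conj_in_subgroup[OF H g(1)] X(2) by blast
  show "card Y = p ^ a" using card_conjugate_image[OF gc Xc] g(2) X(3) by simp
qed

lemma subgroup_in_normalizer: "subgroup (normalizer_in H X) G" "X \<subseteq> normalizer_in H X" "normalizer_in H X \<subseteq> H"
proof -
  have Xc: "X \<in> {X. X \<subseteq> carrier G}" using X subgroup.subset by blast
  show "subgroup (normalizer_in H X) G" by (rule stab_subgroup[OF H acts_conjugate_sets[OF H] Xc])
  show "X \<subseteq> normalizer_in H X" using normalizes_self[OF X(1)] X(2) unfolding normalizes_def stab_def by blast
  show "normalizer_in H X \<subseteq> H" unfolding stab_def by blast
qed

lemma card_conjugates: "card (conjugates H X) * card (normalizer_in H X) = card H"
  using orbit_stabilizer[OF H acts_conjugate_sets[OF H], of X] X subgroup.subset by blast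

lemma conjugates_not_dvd: "\<not> p dvd card (conjugates H X)"
proof
  assume "p dvd card (conjugates H X)"
  moreover have "p ^ a dvd card (normalizer_in H X)"
    using card_subgroup_dvd[OF X(1) subgroup_in_normalizer(1,2)] X(3) by simp
  ultimately have "p * p ^ a dvd card (conjugates H X) * card (normalizer_in H X)" by (rule mult_dvd_mono)
  then show False using card_conjugates max by simp
qed

text \<open>Let \<open>P\<close> act on the conjugates of \<open>X\<close>. A conjugate fixed by
  \<open>P\<close> is normalized by it and hence equals \<open>P\<close>, so all others are moved
  points of a \<open>p\<close>-group. As \<open>P\<close> need not be a conjugate, this yields both
  conjugacy and the count modulo \<open>p\<close>.\<close>

lemma fixed_conjugates:
  assumes P: "subgroup P G" "P \<subseteq> H" "card P = p ^ a"
  shows "p dvd card (conjugates H X - {P})"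
proof -
  let ?f = "\<lambda>g X. conjugate g ` X"
  have Xc: "X \<in> {X. X \<subseteq> carrier G}" using X subgroup.subset by blast
  have closed: "?f h Y \<in> conjugates H X" if "h \<in> H" "Y \<in> conjugates H X" for h Y
  proof -
    have Yc: "Y \<in> {X. X \<subseteq> carrier G}"
      using orb_subset[OF H acts_conjugate_sets[OF H] Xc] that(2) by blast
    have "?f h Y \<in> conjugates H Y" using that(1) unfolding orb_def by blast
    then show ?thesis using orb_eq[OF H acts_conjugate_sets[OF H] Xc that(2)] by simp
  qed
  have "acts P ?f (conjugates H X)"
  proof -
    have "acts H ?f (conjugates H X)"
      unfolding acts_def
    proof (intro conjI ballI)
      fix Y assume Y: "Y \<in> conjugates H X"
      then have Yc: "Y \<in> {X. X \<subseteq> carrier G}"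
        using orb_subset[OF H acts_conjugate_sets[OF H] Xc] by blast
      show "?f \<one> Y = Y" by (rule act_one[OF H acts_conjugate_sets[OF H] Yc])
      fix h assume h: "h \<in> H"
      show "?f h Y \<in> conjugates H X" by (rule closed[OF h Y])
      fix k assume k: "k \<in> H"
      show "?f (h \<otimes> k) Y = ?f h (?f k Y)" by (rule act_mult[OF H acts_conjugate_sets[OF H] h k Yc])
    qed
    then show ?thesis using acts_subset P(2) by blast
  qed
  from p_group_fixed_points[OF P(1) this finite_orb[OF H acts_conjugate_sets[OF H]] p P(3)]
  have "p dvd card {Y \<in> conjugates H X. \<exists>h\<in>P. ?f h Y \<noteq> Y}" .
  also have "{Y \<in> conjugates H X. \<exists>h\<in>P. ?f h Y \<noteq> Y} = conjugates H X - {P}"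
  proof -
    have "(\<forall>h\<in>P. ?f h Y = Y) \<longleftrightarrow> Y = P" if Y: "Y \<in> conjugates H X" for Y
    proof
      assume "\<forall>h\<in>P. ?f h Y = Y"
      then have "normalizes P Y" unfolding normalizes_def .
      from sylow_normalizes_imp_eq[OF H p max P conjugatesD[OF Y] this] show "Y = P" ..
    next
      assume "Y = P"
      show "\<forall>h\<in>P. ?f h Y = Y"
        using normalizes_self[OF P(1)] unfolding normalizes_def \<open>Y = P\<close> .
    qed
    then have "Y \<in> conjugates H X \<and> (\<exists>h\<in>P. ?f h Y \<noteq> Y) \<longleftrightarrow> Y \<in> conjugates H X \<and> Y \<noteq> P" for Y
      by metis
    then show ?thesis unfolding set_diff_eq by simp
  qed
  finally show ?thesis .
qed

text \<open>If \<open>P\<close> were not among the conjugates, removing it would change nothing and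
  \<open>p\<close> would divide their number, the index of a group containing
  \<open>X\<close>.\<close>

lemma sylow_conjugate:
  assumes P: "subgroup P G" "P \<subseteq> H" "card P = p ^ a"
  obtains g where "g \<in> H" "P = conjugate g ` X"
proof -
  have "P \<in> conjugates H X"
  proof (rule ccontr)
    assume "P \<notin> conjugates H X"
    then have "conjugates H X - {P} = conjugates H X" by blast
    then show False using fixed_conjugates[OF P] conjugates_not_dvd by simp
  qed
  then show ?thesis using that unfolding orb_def by blast
qed

lemma card_conjugates_cong_1: "p dvd card (conjugates H X) - 1"
proof -
  have "X \<in> conjugates H X"
    using orb_refl[OF H acts_conjugate_sets[OF H], of X] X(1) subgroup.subset by blast
  then show ?thesis using fixed_conjugates[OF X] finite_orb[OF H acts_conjugate_sets[OF H]] by (simp add: card_Diff_singleton)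
qed

end

text \<open>With \<open>R\<close> a transversal of \<open>Q\<close> in \<open>H\<close> and \<open>r\<^sub>g \<in> R\<close> the representative of \<open>Q g\<close>, the map
  \<open>F g = (\<Prod>r\<in>R. g r (r\<^sub>g\<^sub>r)\<^sup>-\<^sup>1)\<close> into \<open>Q\<close> satisfies \<open>F (g h) = (g (F h) g\<^sup>-\<^sup>1) (F g)\<close>, and \<open>F x = x ^ k\<close> on \<open>Q\<close>;
  its kernel is a complement.\<close>

theorem abelian_normal_complement:
  assumes H: "subgroup H G" and Q: "subgroup Q G" "Q \<subseteq> H" and n: "normalizes H Q"
    and comm: "\<And>x y. x \<in> Q \<Longrightarrow> y \<in> Q \<Longrightarrow> x \<otimes> y = y \<otimes> x"
    and cH: "card H = card Q * k" and cop: "coprime (card Q) k"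
  obtains C where "subgroup C G" "C \<subseteq> H" "Q \<inter> C = {\<one>}" "card C = k" "Q <#> C = H"
proof -
  have Hc: "\<And>x. x \<in> H \<Longrightarrow> x \<in> carrier G" and Qc: "\<And>x. x \<in> Q \<Longrightarrow> x \<in> carrier G"
    and QH: "\<And>x. x \<in> Q \<Longrightarrow> x \<in> H"
    using subgroup_mem H Q by blast+
  note Hm = subgroup.m_closed[OF H] and Hi = subgroup.m_inv_closed[OF H]
    and Qm = subgroup.m_closed[OF Q(1)] and Qi = subgroup.m_inv_closed[OF Q(1)]
  have conjQ: "\<And>g x. g \<in> H \<Longrightarrow> x \<in> Q \<Longrightarrow> conjugate g x \<in> Q"
    using normalizes_conjugate_in[OF n] .
  have finH: "finite H" and finQ: "finite Q" using subgroup_finite H Q(1) by blast+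
  have cQ: "card Q > 0" using subgroup_card_pos[OF Q(1)] .

  \<comment> \<open>The choice is made from the coset as a set, so that \<open>rep\<close> is
    constant on it.\<close>
  define rep where "rep g = (SOME y. y \<in> (\<lambda>x. x \<otimes> g) ` Q)" for g
  have rep_in: "\<exists>x\<in>Q. rep g = x \<otimes> g" for g
  proof -
    have "\<exists>y. y \<in> (\<lambda>x. x \<otimes> g) ` Q" using subgroup.one_closed[OF Q(1)] by blast
    then have "rep g \<in> (\<lambda>x. x \<otimes> g) ` Q" unfolding rep_def by (rule someI_ex)
    then show ?thesis by blast
  qed
  have repH: "rep g \<in> H" if "g \<in> H" for g using rep_in[of g] QH Hm that by metis
  have rep_mult: "rep (x \<otimes> g) = rep g" if x: "x \<in> Q" and g: "g \<in> H" for x g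
  proof -
    have "(\<lambda>y. y \<otimes> (x \<otimes> g)) ` Q = (\<lambda>y. y \<otimes> g) ` Q"
    proof (intro equalityI subsetI)
      fix z assume "z \<in> (\<lambda>y. y \<otimes> (x \<otimes> g)) ` Q"
      then obtain y where y: "y \<in> Q" "z = y \<otimes> (x \<otimes> g)" by blast
      then have "z = (y \<otimes> x) \<otimes> g" using x g Qc Hc by (simp add: m_assoc)
      then show "z \<in> (\<lambda>y. y \<otimes> g) ` Q" using Qm[OF y(1) x] by blast
    next
      fix z assume "z \<in> (\<lambda>y. y \<otimes> g) ` Q"
      then obtain y where y: "y \<in> Q" "z = y \<otimes> g" by blast
      have "inv x \<otimes> (x \<otimes> g) = g" using x g Qc Hc by (simp flip: m_assoc)
      then have "z = (y \<otimes> inv x) \<otimes> (x \<otimes> g)" using y x g Qc Hc by (simp add: m_assoc)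
      then show "z \<in> (\<lambda>y. y \<otimes> (x \<otimes> g)) ` Q" using Qm[OF y(1) Qi[OF x]] by blast
    qed
    then show ?thesis unfolding rep_def by simp
  qed
  define R where "R = rep ` H"
  have RH: "r \<in> H" if "r \<in> R" for r using that repH unfolding R_def by blast
  have Rrep: "rep r = r" if r: "r \<in> R" for r
  proof -
    obtain g where g: "g \<in> H" "r = rep g" using r unfolding R_def by blast
    obtain x where x: "x \<in> Q" "rep g = x \<otimes> g" using rep_in by blast
    show ?thesis using rep_mult[OF x(1) g(1)] x(2) g(2) by simp
  qed
  have finR: "finite R" unfolding R_def using finH by simp

  have "card {h \<in> H. rep h = r} = card Q" if r: "r \<in> R" for r
  proof -
    have "{h \<in> H. rep h = r} = (\<lambda>x. x \<otimes> r) ` Q"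
    proof (intro equalityI subsetI)
      fix h assume "h \<in> {h \<in> H. rep h = r}"
      then have h: "h \<in> H" "rep h = r" by auto
      obtain x where x: "x \<in> Q" "r = x \<otimes> h" using rep_in[of h] h(2) by auto
      have "h = inv x \<otimes> r" using x h Qc Hc by (simp flip: m_assoc)
      then show "h \<in> (\<lambda>x. x \<otimes> r) ` Q" using Qi[OF x(1)] by blast
    next
      fix h assume "h \<in> (\<lambda>x. x \<otimes> r) ` Q"
      then obtain x where "x \<in> Q" "h = x \<otimes> r" by blast
      then show "h \<in> {h \<in> H. rep h = r}" using rep_mult RH[OF r] Rrep[OF r] Hm QH by simp
    qed
    moreover have "inj_on (\<lambda>x. x \<otimes> r) Q"
      using inj_on_multc[OF Hc[OF RH[OF r]]] Qc by (meson inj_on_subset subsetI)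
    ultimately show ?thesis by (simp add: card_image)
  qed
  then have "card H = card R * card Q"
    using sum.image_gen[OF finH, of "\<lambda>_. 1::nat" rep] unfolding R_def by simp
  then have cR: "card R = k" using cH cQ by simp

  \<comment> \<open>The element of \<open>Q\<close> by which \<open>g \<otimes> r\<close> misses the
    transversal; modulo it, left multiplication by \<open>g\<close> permutes
    \<open>R\<close>.\<close>
  define \<kappa> where "\<kappa> g r = g \<otimes> r \<otimes> inv (rep (g \<otimes> r))" for g r
  have \<kappa>Q: "\<kappa> g r \<in> Q" if g: "g \<in> H" and r: "r \<in> R" for g r
  proof -
    obtain x where x: "x \<in> Q" "rep (g \<otimes> r) = x \<otimes> (g \<otimes> r)" using rep_in by blast
    have gr: "g \<otimes> r \<in> carrier G" using g RH[OF r] Hm Hc by blast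
    have "\<kappa> g r = inv x"
      unfolding \<kappa>_def x(2) inv_mult_group[OF Qc[OF x(1)] gr] using gr Qc[OF x(1)] by (simp flip: m_assoc)
    then show ?thesis using Qi[OF x(1)] by simp
  qed
  define act where "act g r = rep (g \<otimes> r)" for g r
  have actR: "act g r \<in> R" if "g \<in> H" "r \<in> R" for g r
    unfolding act_def R_def using Hm that(1) RH[OF that(2)] by blast
  have \<kappa>eq: "g \<otimes> r = \<kappa> g r \<otimes> act g r" if g: "g \<in> H" and r: "r \<in> R" for g r
    unfolding \<kappa>_def act_def using Hc[OF Hm[OF g RH[OF r]]] Hc[OF repH[OF Hm[OF g RH[OF r]]]]
    by (simp add: m_assoc)
  have act_inj: "inj_on (act g) R" if g: "g \<in> H" for g
  proof (rule inj_onI)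
    fix r s assume r: "r \<in> R" and s: "s \<in> R" and e: "act g r = act g s"
    have kr: "\<kappa> g r \<in> Q" and ks: "\<kappa> g s \<in> Q" using \<kappa>Q g r s by blast+
    note c = Hc[OF g] Hc[OF RH[OF r]] Hc[OF RH[OF s]] Qc[OF kr] Qc[OF ks] Hc[OF RH[OF actR[OF g s]]]
    have "act g s = inv (\<kappa> g s) \<otimes> (g \<otimes> s)" using \<kappa>eq[OF g s] c by (simp flip: m_assoc)
    then have "g \<otimes> r = (\<kappa> g r \<otimes> inv (\<kappa> g s)) \<otimes> (g \<otimes> s)" using \<kappa>eq[OF g r] e c by (simp add: m_assoc)
    moreover define x where "x = \<kappa> g r \<otimes> inv (\<kappa> g s)"
    ultimately have gr: "g \<otimes> r = x \<otimes> (g \<otimes> s)" by simp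
    have xQ: "x \<in> Q" unfolding x_def using Qm[OF kr Qi[OF ks]] .
    have "r = inv g \<otimes> (g \<otimes> r)" using c by (simp flip: m_assoc)
    also have "\<dots> = conjugate (inv g) x \<otimes> s"
      unfolding gr conjugate_def using c Qc[OF xQ] by (simp add: m_assoc)
    finally have "rep r = rep s" using rep_mult[OF conjQ[OF Hi[OF g] xQ] RH[OF s]] by simp
    then show "r = s" using Rrep r s by simp
  qed
  have act_bij: "act g ` R = R" if g: "g \<in> H" for g
    using endo_inj_surj[OF finR _ act_inj[OF g]] actR[OF g] by blast
  have \<kappa>mult: "\<kappa> (g \<otimes> h) r = conjugate g (\<kappa> h r) \<otimes> \<kappa> g (act h r)" if g: "g \<in> H" and h: "h \<in> H" and r: "r \<in> R" for g h r
  proof -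
    let ?s = "act h r"
    have s: "?s \<in> R" using actR h r by blast
    note kh = \<kappa>Q[OF h r] note ckh = conjQ[OF g kh] note kg = \<kappa>Q[OF g s]
    note c = Hc[OF g] Hc[OF h] Hc[OF RH[OF r]] Hc[OF RH[OF s]] Qc[OF kh] Qc[OF ckh] Qc[OF kg]
    have "g \<otimes> h \<otimes> r = g \<otimes> (h \<otimes> r)" using c by (simp add: m_assoc)
    also have "\<dots> = g \<otimes> (\<kappa> h r \<otimes> ?s)" using \<kappa>eq[OF h r] by simp
    also have "\<dots> = (g \<otimes> \<kappa> h r) \<otimes> ?s" using c by (simp add: m_assoc)
    also have "\<dots> = conjugate g (\<kappa> h r) \<otimes> (g \<otimes> ?s)" using mult_conjugate[OF c(1) c(5)] c by (simp add: m_assoc)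
    finally have e: "g \<otimes> h \<otimes> r = conjugate g (\<kappa> h r) \<otimes> (g \<otimes> ?s)" .
    have re: "rep (conjugate g (\<kappa> h r) \<otimes> (g \<otimes> ?s)) = rep (g \<otimes> ?s)"
      using rep_mult[OF ckh Hm[OF g RH[OF s]]] .
    have rc: "rep (g \<otimes> ?s) \<in> carrier G" using Hc[OF repH[OF Hm[OF g RH[OF s]]]] .
    have "\<kappa> (g \<otimes> h) r = conjugate g (\<kappa> h r) \<otimes> (g \<otimes> ?s) \<otimes> inv (rep (g \<otimes> ?s))"
      unfolding \<kappa>_def[of "g \<otimes> h"] e re ..
    then show ?thesis unfolding \<kappa>_def[of g] using c rc by (simp add: m_assoc)
  qed

  let ?Q = "G\<lparr>carrier := Q\<rparr>"
  interpret Q: comm_group ?Q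
    using subgroup_imp_group[OF Q(1)] comm by (intro group.group_comm_groupI) auto
  define F where "F g = finprod ?Q (\<kappa> g) R" for g
  have FQ: "F g \<in> Q" if "g \<in> H" for g
    unfolding F_def using Q.finprod_closed[of "\<kappa> g" R] \<kappa>Q[OF that] by auto
  have conj_prod: "conjugate g (finprod ?Q f S) = finprod ?Q (\<lambda>r. conjugate g (f r)) S"
    if g: "g \<in> H" and S: "finite S" "\<And>r. r \<in> S \<Longrightarrow> f r \<in> Q" for g f S
    using S
  proof (induction S rule: finite_induct)
    case empty
    then show ?case using Q.finprod_empty Hc[OF g] by simp
  next
    case (insert r S)
    have fQ: "f \<in> S \<rightarrow> carrier ?Q" "(\<lambda>r. conjugate g (f r)) \<in> S \<rightarrow> carrier ?Q"
      using insert.prems conjQ[OF g] by auto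
    have "finprod ?Q f S \<in> Q" using Q.finprod_closed[OF fQ(1)] by simp
    then have "conjugate g (f r \<otimes> finprod ?Q f S) = conjugate g (f r) \<otimes> conjugate g (finprod ?Q f S)"
      using conj_mult Hc[OF g] Qc insert.prems by simp
    then show ?case
      using Q.finprod_insert[OF insert.hyps fQ(1)] Q.finprod_insert[OF insert.hyps fQ(2)]
        insert conjQ[OF g] by simp
  qed
  have Fmult: "F (g \<otimes> h) = conjugate g (F h) \<otimes> F g" if g: "g \<in> H" and h: "h \<in> H" for g h
  proof -
    have 1: "(\<lambda>r. conjugate g (\<kappa> h r)) \<in> R \<rightarrow> carrier ?Q" "(\<lambda>r. \<kappa> g (act h r)) \<in> R \<rightarrow> carrier ?Q"
      "\<kappa> g \<in> act h ` R \<rightarrow> carrier ?Q"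
      using conjQ[OF g] \<kappa>Q g h actR by auto
    have "F (g \<otimes> h) = finprod ?Q (\<lambda>r. conjugate g (\<kappa> h r) \<otimes> \<kappa> g (act h r)) R"
      unfolding F_def using \<kappa>mult[OF g h] 1 Qm by (intro Q.finprod_cong') (auto simp: Pi_iff)
    also have "\<dots> = finprod ?Q (\<lambda>r. conjugate g (\<kappa> h r)) R \<otimes> finprod ?Q (\<lambda>r. \<kappa> g (act h r)) R"
      using Q.finprod_multf[OF 1(1,2)] by simp
    also have "finprod ?Q (\<lambda>r. conjugate g (\<kappa> h r)) R = conjugate g (F h)"
      unfolding F_def using conj_prod[OF g finR] \<kappa>Q[OF h] by simp
    \<comment> \<open>Since \<open>act h\<close> permutes \<open>R\<close>, the product can be
      reindexed along it.\<close>
    also have "finprod ?Q (\<lambda>r. \<kappa> g (act h r)) R = F g"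
      unfolding F_def using Q.finprod_reindex[OF 1(3) act_inj[OF h]] act_bij[OF h] by simp
    finally show ?thesis .
  qed
  have Fx: "F x = x [^] k" if x: "x \<in> Q" for x
  proof -
    have kx: "\<kappa> x r = x" if r: "r \<in> R" for r
    proof -
      have "rep (x \<otimes> r) = r" using rep_mult[OF x RH[OF r]] Rrep[OF r] by simp
      then show ?thesis unfolding \<kappa>_def using Qc[OF x] Hc[OF RH[OF r]] by (simp add: m_assoc)
    qed
    have "F x = finprod ?Q (\<lambda>_. x) R" unfolding F_def using kx x by (intro Q.finprod_cong') auto
    also have "\<dots> = x [^]\<^bsub>?Q\<^esub> card R" using Q.finprod_const[of x R] x by simp
    finally show ?thesis using cR nat_pow_consistent by metis
  qed
  have F1: "F \<one> = \<one>" using Fx[OF subgroup.one_closed[OF Q(1)]] by simp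

  define C where "C = {g \<in> H. F g = \<one>}"
  \<comment> \<open>\<open>F\<close> is only a crossed homomorphism, but conjugation fixes
    \<open>\<one>\<close>, so its kernel is still a subgroup.\<close>
  have C: "subgroup C G"
  proof (rule subgroupI)
    show "C \<subseteq> carrier G" unfolding C_def using Hc by blast
    show "C \<noteq> {}" unfolding C_def using F1 subgroup.one_closed[OF H] by blast
    fix g assume g: "g \<in> C"
    then have gH: "g \<in> H" "F g = \<one>" unfolding C_def by auto
    have "F (inv g \<otimes> g) = conjugate (inv g) (F g) \<otimes> F (inv g)" using Fmult[OF Hi[OF gH(1)] gH(1)] .
    then have "F (inv g) = \<one>" using gH F1 Hc[OF gH(1)] Qc[OF FQ[OF Hi[OF gH(1)]]] by simp
    then show "inv g \<in> C" unfolding C_def using Hi[OF gH(1)] by simp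
    fix h assume h: "h \<in> C"
    then have hH: "h \<in> H" "F h = \<one>" unfolding C_def by auto
    show "g \<otimes> h \<in> C" unfolding C_def using Fmult[OF gH(1) hH(1)] gH hH Hm Hc by simp
  qed
  have CH: "C \<subseteq> H" unfolding C_def by blast
  have QC: "Q \<inter> C = {\<one>}"
  proof (intro equalityI subsetI)
    fix x assume x: "x \<in> Q \<inter> C"
    then have "x [^] k = \<one>" using Fx unfolding C_def by auto
    then have "ord x dvd k" using pow_eq_id x Qc by blast
    moreover have "ord x dvd card Q" using ord_dvd_card[OF Q(1)] x by blast
    ultimately have "ord x = 1" using cop by (metis coprime_common_divisor_nat)
    then show "x \<in> {\<one>}" using ord_eq_1 x Qc by blast
  next
    fix x assume "x \<in> {\<one>}"
    then show "x \<in> Q \<inter> C" using subgroup.one_closed[OF Q(1)] subgroup.one_closed[OF C] by blast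
  qed
  \<comment> \<open>With \<open>t\<close> inverse to \<open>k\<close> modulo \<open>card Q\<close>,
    the element \<open>x = inv (F g) [^] t\<close> of \<open>Q\<close> has
    \<open>F x = x [^] k = inv (F g)\<close>. As \<open>Q\<close> is abelian,
    \<open>F (x \<otimes> g) = \<one>\<close>, so \<open>g\<close> is moved into the kernel by an
    element of \<open>Q\<close>.\<close>
  obtain t where t: "[k * t = 1] (mod card Q)"
    using cong_solve_coprime_nat[of k "card Q"] cop by (auto simp: coprime_commute)
  have "H \<subseteq> Q <#> C"
  proof
    fix g assume g: "g \<in> H"
    define x where "x = inv (F g) [^] t"
    have iF: "inv (F g) \<in> Q" using Qi[OF FQ[OF g]] .
    have x: "x \<in> Q" unfolding x_def using subgroup_pow[OF Q(1) iF] .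
    have "x [^] k = inv (F g) [^] (k * t)"
      unfolding x_def using nat_pow_pow[OF Qc[OF iF], of t k] by (simp add: mult.commute)
    also have "\<dots> = inv (F g) [^] (1::nat)"
      by (rule pow_mod_cong[OF Qc[OF iF] pow_card_eq_one[OF Q(1) iF] t])
    finally have xk: "x [^] k = inv (F g)" using Qc[OF iF] by simp
    have "conjugate x (F g) = F g"
      using conj_eq_self_iff[OF Qc[OF x] Qc[OF FQ[OF g]]] comm[OF x FQ[OF g]] by simp
    then have "F (x \<otimes> g) = \<one>"
      using Fmult[OF QH[OF x] g] Fx[OF x] xk Qc[OF FQ[OF g]] by simp
    then have xg: "x \<otimes> g \<in> C" unfolding C_def using Hm[OF QH[OF x] g] by simp
    have "g = inv x \<otimes> (x \<otimes> g)" using Qc[OF x] Hc[OF g] by (simp flip: m_assoc)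
    then show "g \<in> Q <#> C" unfolding set_mult_iff using Qi[OF x] xg by blast
  qed
  then have QCH: "Q <#> C = H" using set_mult_subset[OF H Q(2) CH] by blast
  then have "card C = k" using card_set_mult[OF Q(1) C QC] cH cQ by simp
  with that C CH QC QCH show ?thesis by blast
qed

end

subsection \<open>Elementary abelian Sylow 2-subgroups of order 4\<close>

lemma two_power_card_le_prod:
  fixes e :: "'c \<Rightarrow> nat"
  assumes "\<And>q. q \<in> T \<Longrightarrow> e q \<ge> 1"
  shows "2 ^ card T \<le> (\<Prod>q\<in>T. e q + 1)"
proof -
  have "(\<Prod>q\<in>T. 2) \<le> (\<Prod>q\<in>T. e q + 1)"
    using assms by (intro prod_mono) force
  then show ?thesis by simp
qed

lemma prod_multiplicity_ge:
  fixes s :: nat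
  assumes s: "odd s" and k: "k = 2 ^ j * s"
  shows "(j + 1) * 2 ^ card (prime_factors s) \<le> (\<Prod>q\<in>prime_factors k. multiplicity q k + 1)"
proof -
  have s0: "s \<noteq> 0" using s by (metis even_zero)
  have mult1: "multiplicity q k \<ge> 1" if "q \<in> prime_factors s" for q
  proof -
    have "prime q" "q dvd s" using that by auto
    then have "q ^ 1 dvd k" unfolding k by simp
    then show ?thesis using \<open>prime q\<close> s0 k by (intro multiplicity_geI) auto
  qed
  show ?thesis
  proof (cases "j = 0")
    case True
    then show ?thesis using two_power_card_le_prod[of "prime_factors s" "\<lambda>q. multiplicity q k"] mult1 k by simp
  next
    case False
    have "prime_factors k = insert 2 (prime_factors s)"
      unfolding k using s0 False by (simp add: prime_factors_product prime_factors_power prime_prime_factors)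
    moreover have "2 \<notin> prime_factors s" using s by auto
    moreover have "multiplicity 2 k = j"
      unfolding k using s s0 by (simp add: prime_elem_multiplicity_mult_distrib not_dvd_imp_multiplicity_0)
    ultimately have e: "(\<Prod>q\<in>prime_factors k. multiplicity q k + 1) = (j + 1) * (\<Prod>q\<in>prime_factors s. multiplicity q k + 1)"
      by simp
    have "2 ^ card (prime_factors s) \<le> (\<Prod>q\<in>prime_factors s. multiplicity q k + 1)"
      by (rule two_power_card_le_prod) (rule mult1)
    then show ?thesis unfolding e by (rule mult_le_mono2)
  qed
qed

lemma two_power_times_odd:
  fixes n :: nat
  assumes "n \<noteq> 0"
  obtains b r where "n = 2 ^ b * r" "odd r"
proof -
  have "\<not> is_unit (2::nat)" by simp
  from multiplicity_decompose'[OF assms this] that show thesis by blast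
qed

lemma three_power_card_le_odd:
  fixes r :: nat
  assumes "odd r"
  shows "3 ^ card (prime_factors r) \<le> r"
proof -
  have r0: "r > 0" using assms by (metis even_zero gr0I)
  have "(\<Prod>q\<in>prime_factors r. 3) \<le> (\<Prod>q\<in>prime_factors r. q ^ multiplicity q r)"
  proof (rule prod_mono)
    fix q assume q: "q \<in> prime_factors r"
    then have "prime q" "q dvd r" by auto
    then have "odd q" using assms dvd_trans by blast
    have "q \<noteq> 2" using \<open>odd q\<close> by auto
    with prime_ge_2_nat[OF \<open>prime q\<close>] have "q \<ge> 3" by linarith
    moreover have "multiplicity q r > 0" using q by (simp add: prime_factors_multiplicity)
    then have "q ^ 1 \<le> q ^ multiplicity q r" using \<open>q \<ge> 3\<close> by (intro power_increasing) auto
    ultimately show "0 \<le> (3::nat) \<and> 3 \<le> q ^ multiplicity q r" by simp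
  qed
  also have "\<dots> = r" using r0 by (intro prod_prime_power_eq) auto
  finally show ?thesis by simp
qed

lemma card_prime_factors_mult:
  fixes r s :: nat
  assumes "coprime r s" "r \<noteq> 0" "s \<noteq> 0"
  shows "card (prime_factors (r * s)) = card (prime_factors r) + card (prime_factors s)"
proof -
  have "prime_factors r \<inter> prime_factors s = {}"
  proof (rule ccontr)
    assume "prime_factors r \<inter> prime_factors s \<noteq> {}"
    then obtain q where "prime q" "q dvd r" "q dvd s" by auto
    then show False using coprime_common_divisor_nat[OF assms(1), of q] by simp
  qed
  then show ?thesis using assms by (simp add: prime_factors_product card_Un_disjoint)
qed

text \<open>Here \<open>2 ^ b * r\<close> is the number of conjugates of a Sylow subgroup and
  \<open>3 - b\<close> the factor contributed by the remaining \<open>2 ^ (2 - b)\<close> in the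
  normalizer. Equality holds for \<open>b = 1\<close>, \<open>r = 3\<close>. The case
  \<open>b = 2\<close>, \<open>r = 1\<close> of four conjugates would violate the bound and is
  excluded by requiring six.\<close>

lemma conjugate_count_bound:
  fixes r :: nat
  assumes r: "odd r" and b: "b \<le> 2" and n: "6 \<le> 2 ^ b * r"
  shows "6 * 2 ^ card (prime_factors r) \<le> 2 ^ b * r * (3 - b)"
proof -
  define w where "w = card (prime_factors r)"
  have w3: "3 ^ w \<le> r" unfolding w_def using three_power_card_le_odd[OF r] .
  have p: "(2::nat) ^ i \<le> 3 ^ i" for i by (intro power_mono) auto
  consider "b = 0" | "b = 1" | "b = 2" using b by linarith
  then have "6 * 2 ^ w \<le> 2 ^ b * r * (3 - b)"
  proof cases
    case 1
    have "2 * 2 ^ w \<le> r"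
    proof (cases "w \<le> 1")
      case True
      then have "(2::nat) ^ w \<le> 2 ^ 1" by (intro power_increasing) auto
      then show ?thesis using n 1 by simp
    next
      case False
      then obtain v where "w = v + 2" by (metis add.commute le_Suc_ex not_less_eq_eq one_add_one plus_1_eq_Suc)
      then show ?thesis using w3 p[of v] by (simp add: power_add)
    qed
    then show ?thesis using 1 by simp
  next
    case 2
    have "3 * 2 ^ w \<le> 2 * r"
    proof (cases w)
      case 0
      then show ?thesis using n 2 by simp
    next
      case (Suc v)
      then show ?thesis using w3 p[of v] by simp
    qed
    then show ?thesis using 2 by simp
  next
    case 3
    have "3 * 2 ^ w \<le> 2 * r"
    proof (cases w)
      case 0
      have "r \<noteq> 1" using n 3 by auto
      then show ?thesis using n 3 0 by simp
    next
      case (Suc v)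
      then show ?thesis using w3 p[of v] by simp
    qed
    then show ?thesis using 3 by simp
  qed
  then show ?thesis unfolding w_def .
qed

section \<open>Counting beyond the cyclic subgroups\<close>

context finite_group
begin

text \<open>The map \<open>Y \<mapsto> Q <#> Y\<close> is injective, because intersecting with
  \<open>C\<close> recovers \<open>Y\<close>.\<close>

lemma card_overgroups_ge:
  assumes H: "subgroup H G" and Q: "subgroup Q G" "Q \<subseteq> H" and n: "normalizes H Q"
    and C: "subgroup C G" "C \<subseteq> H" "Q \<inter> C = {\<one>}"
  shows "card (subgroups_in C) \<le> card {X \<in> subgroups_in H. Q \<subseteq> X}"
proof (rule card_inj_on_le)
  have trace: "(Q <#> Y) \<inter> C = Y" if Y: "Y \<in> subgroups_in C" for Y
  proof (intro equalityI subsetI)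
    have Ys: "subgroup Y G" "Y \<subseteq> C" using Y unfolding subgroups_in_def by auto
    fix z assume "z \<in> (Q <#> Y) \<inter> C"
    then obtain x y where xy: "x \<in> Q" "y \<in> Y" "z = x \<otimes> y" "z \<in> C" unfolding set_mult_def by auto
    have c: "x \<in> carrier G" "y \<in> carrier G" "y \<in> C" using xy Ys Q(1) subgroup_mem by blast+
    have "x = z \<otimes> inv y" using xy(3) c by (simp add: m_assoc)
    then have "x \<in> C" using subgroup.m_closed[OF C(1) xy(4)] subgroup.m_inv_closed[OF C(1) c(3)] by simp
    then have "x = \<one>" using xy(1) C(3) by blast
    then show "z \<in> Y" using xy c by simp
  next
    have Ys: "subgroup Y G" "Y \<subseteq> C" using Y unfolding subgroups_in_def by auto
    fix z assume "z \<in> Y"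
    then show "z \<in> (Q <#> Y) \<inter> C" using subset_set_mult(2)[OF Q(1) Ys(1)] Ys(2) by blast
  qed
  show "inj_on (\<lambda>Y. Q <#> Y) (subgroups_in C)" by (rule inj_onI) (metis trace)
  show "(\<lambda>Y. Q <#> Y) ` subgroups_in C \<subseteq> {X \<in> subgroups_in H. Q \<subseteq> X}"
  proof (rule image_subsetI)
    fix Y assume "Y \<in> subgroups_in C"
    then have Ys: "subgroup Y G" "Y \<subseteq> H" using C(2) unfolding subgroups_in_def by auto
    have "subgroup (Q <#> Y) G"
      using subgroup_set_mult[OF Q(1) Ys(1)] normalizes_conjugate_in[OF n] Ys(2) by blast
    then show "Q <#> Y \<in> {X \<in> subgroups_in H. Q \<subseteq> X}"
      using set_mult_subset[OF H Q(2) Ys(2)] subset_set_mult(1)[OF Q(1) Ys(1)]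
      unfolding subgroups_in_def by blast
  qed
  show "finite {X \<in> subgroups_in H. Q \<subseteq> X}" using finite_subgroups_in[OF H] by simp
qed

text \<open>The subgroups of \<open>C\<close> and the subgroups containing \<open>Q\<close> are
  disjoint families, as the nontrivial \<open>Q\<close> meets \<open>C\<close> trivially. The factor
  2 pays for the one prime lost in passing to \<open>C\<close>.\<close>

lemma card_subgroups_in_ge_double:
  assumes H: "subgroup H G" and Q: "subgroup Q G" "Q \<subseteq> H" "Q \<noteq> {\<one>}" and n: "normalizes H Q"
    and C: "subgroup C G" "C \<subseteq> H" "Q \<inter> C = {\<one>}"
  shows "2 * card (subgroups_in C) \<le> card (subgroups_in H)"
proof -
  have "subgroups_in C \<inter> {X \<in> subgroups_in H. Q \<subseteq> X} = {}"
  proof -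
    have "\<not> Q \<subseteq> X" if "X \<subseteq> C" for X
      using that C(3) Q(3) subgroup.one_closed[OF Q(1)] by blast
    then show ?thesis unfolding subgroups_in_def by blast
  qed
  moreover have fin: "finite (subgroups_in C)" "finite {X \<in> subgroups_in H. Q \<subseteq> X}"
    using finite_subgroups_in C(1) H by simp_all
  ultimately have "card (subgroups_in C \<union> {X \<in> subgroups_in H. Q \<subseteq> X})
      = card (subgroups_in C) + card {X \<in> subgroups_in H. Q \<subseteq> X}"
    by (intro card_Un_disjoint)
  moreover have "subgroups_in C \<union> {X \<in> subgroups_in H. Q \<subseteq> X} \<subseteq> subgroups_in H"
    using C(2) unfolding subgroups_in_def by blast
  then have "card (subgroups_in C \<union> {X \<in> subgroups_in H. Q \<subseteq> X}) \<le> card (subgroups_in H)"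
    using card_mono finite_subgroups_in[OF H] by blast
  ultimately show ?thesis using card_overgroups_ge[OF H Q(1,2) n C] by linarith
qed

lemma cyclic_subgroups_subset: "subgroup H G \<Longrightarrow> cyclic_subgroups H n \<subseteq> subgroups_in H"
  unfolding cyclic_subgroups_def subgroups_in_def
  using generate_subset_subgroup generate_is_subgroup[of "{_}"] subgroup_mem by auto

lemma card_subgroups_in_ge:
  assumes H: "subgroup H G"
  shows "(\<Prod>q\<in>prime_factors (card H). multiplicity q (card H) + 1) \<le> card (subgroups_in H)"
  using card_cyclic_subgroups_ge[OF H] card_mono[OF finite_subgroups_in[OF H] cyclic_subgroups_subset[OF H]]
  by (rule order_trans)

lemma prime_order_commute:
  assumes Q: "subgroup Q G" "card Q = q" "prime q" and "x \<in> Q" "y \<in> Q"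
  shows "x \<otimes> y = y \<otimes> x"
proof -
  obtain z where z: "z \<in> Q" "ord z = q" using cauchy_element[OF Q(1) Q(3)] Q(2) by auto
  have zc: "z \<in> carrier G" using z Q(1) subgroup_mem by blast
  have "card (generate G {z}) = card Q" using generate_pow_card[OF zc] z Q(2) by simp
  then have "generate G {z} = Q"
    using card_subset_eq[OF subgroup_finite[OF Q(1)] generate_subset_subgroup[OF Q(1) z(1)]] by simp
  then obtain i j :: nat where "x = z [^] i" "y = z [^] j"
    using assms(4,5) generate_pow_on_finite_carrier[OF finite_carrier zc] by blast
  then show ?thesis using zc by (simp add: nat_pow_mult add.commute)
qed

lemma prime_order_complement:
  assumes H: "subgroup H G" and Q: "subgroup Q G" "Q \<subseteq> H" "card Q = q" and n: "normalizes H Q"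
    and q: "prime q" and cH: "card H = q * k" "\<not> q dvd k"
  obtains C where "subgroup C G" "C \<subseteq> H" "Q \<inter> C = {\<one>}" "card C = k"
proof -
  have "coprime (card Q) k" using q cH(2) Q(3) by (simp add: prime_imp_coprime)
  from abelian_normal_complement[OF H Q(1,2) n prime_order_commute[OF Q(1,3) q] _ this] cH(1) Q(3) that
  show ?thesis by blast
qed

text \<open>For a non-normal Sylow subgroup \<open>Q\<close> of prime order \<open>q\<close>, the groups between a conjugate of \<open>Q\<close> and
  its normalizer are pairwise distinct, and none of them has order prime to \<open>q\<close>.\<close>

lemma card_subgroups_in_ge_conjugates:
  assumes H: "subgroup H G" and q: "prime q" and max: "\<not> q ^ Suc 1 dvd card H"
    and Q: "subgroup Q G" "Q \<subseteq> H" "card Q = q" and l: "\<not> q dvd l"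
    and k: "card H = card (conjugates H Q) * (q * k)"
  shows "card (cyclic_subgroups H l) + card (conjugates H Q) * (\<Prod>p\<in>prime_factors k. multiplicity p k + 1)
    \<le> card (subgroups_in H)"
proof -
  let ?O = "conjugates H Q" and ?B = "\<Prod>p\<in>prime_factors k. multiplicity p k + 1"
  define U where "U Y = {X \<in> subgroups_in (normalizer_in H Y). Y \<subseteq> X}" for Y
  have cQ: "card Q = q ^ 1" using Q(3) by simp
  note Od = conjugatesD[OF H q max Q(1,2) cQ]
  have Qc: "Q \<in> {X. X \<subseteq> carrier G}" using Q(1) subgroup.subset by blast
  have finO: "finite ?O" using finite_orb[OF H acts_conjugate_sets[OF H]] .
  have kq: "\<not> q dvd k"
  proof
    assume "q dvd k"
    then have "q * q dvd card H" unfolding k by (simp add: mult_dvd_mono dvd_mult)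
    then show False using max by simp
  qed
  have N: "subgroup (normalizer_in H Y) G" "Y \<subseteq> normalizer_in H Y" "normalizer_in H Y \<subseteq> H"
    "card (normalizer_in H Y) = q * k" if Y: "Y \<in> ?O" for Y
  proof -
    show "subgroup (normalizer_in H Y) G" "Y \<subseteq> normalizer_in H Y" "normalizer_in H Y \<subseteq> H"
      using subgroup_in_normalizer[OF H q max Od[OF Y]] by blast+
    have "conjugates H Y = ?O" using orb_eq[OF H acts_conjugate_sets[OF H] Qc Y] .
    then have "card ?O * card (normalizer_in H Y) = card ?O * (q * k)"
      using card_conjugates[OF H q max Od[OF Y]] k by simp
    moreover have "card ?O \<noteq> 0" using Y finO by auto
    ultimately show "card (normalizer_in H Y) = q * k" by simp
  qed
  \<comment> \<open>\<open>Y\<close> has a complement of order \<open>k\<close> in its normalizer.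
    The subgroups of that complement inject into \<open>U Y\<close>, and Richards' bound applies to
    them.\<close>
  have "?B \<le> card (U Y)" if Y: "Y \<in> ?O" for Y
  proof -
    have cY: "card Y = q" using Od(3)[OF Y] by simp
    obtain C where C: "subgroup C G" "C \<subseteq> normalizer_in H Y" "Y \<inter> C = {\<one>}" "card C = k"
      using prime_order_complement[OF N(1)[OF Y] Od(1)[OF Y] N(2)[OF Y] cY normalizes_normalizer_in q N(4)[OF Y] kq] .
    show ?thesis
      unfolding U_def
      using card_overgroups_ge[OF N(1)[OF Y] Od(1)[OF Y] N(2)[OF Y] normalizes_normalizer_in C(1-3)]
        card_subgroups_in_ge[OF C(1)] C(4) by simp
  qed
  then have "card ?O * ?B \<le> (\<Sum>Y\<in>?O. card (U Y))"
    using sum_bounded_below[of ?O ?B "\<lambda>Y. card (U Y)"] by simp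
  also have "\<dots> = card (\<Union>Y\<in>?O. U Y)"
  proof (rule card_UN_disjoint[symmetric, OF finO])
    show "\<forall>Y\<in>?O. finite (U Y)" unfolding U_def using finite_subgroups_in N(1) by simp
    show "\<forall>Y\<in>?O. \<forall>Z\<in>?O. Y \<noteq> Z \<longrightarrow> U Y \<inter> U Z = {}"
    proof (intro ballI impI)
      fix Y Z assume Y: "Y \<in> ?O" and Z: "Z \<in> ?O" and ne: "Y \<noteq> Z"
      have False if X: "X \<in> U Y" "X \<in> U Z" for X
      proof -
        \<comment> \<open>A common \<open>X\<close> contains \<open>Z\<close> and normalizes
          \<open>Y\<close>, but a Sylow subgroup normalizing another one equals it.\<close>
        have "Z \<subseteq> normalizer_in H Y" using X unfolding U_def subgroups_in_def by blast
        then have "normalizes Z Y" using normalizes_normalizer_in unfolding normalizes_def by blast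
        then show False using sylow_normalizes_imp_eq[OF H q max Od[OF Z] Od[OF Y]] ne by simp
      qed
      then show "U Y \<inter> U Z = {}" by blast
    qed
  qed
  finally have 1: "card ?O * ?B \<le> card (\<Union>Y\<in>?O. U Y)" .
  have sub: "(\<Union>Y\<in>?O. U Y) \<subseteq> subgroups_in H"
    unfolding U_def subgroups_in_def using N(3) by blast
  have disj: "cyclic_subgroups H l \<inter> (\<Union>Y\<in>?O. U Y) = {}"
  proof -
    have False if X: "X \<in> cyclic_subgroups H l" "X \<in> U Y" "Y \<in> ?O" for X Y
    proof -
      obtain x where x: "x \<in> H" "x [^] l = \<one>" "X = generate G {x}"
        using X(1) unfolding cyclic_subgroups_def by blast
      have xc: "x \<in> carrier G" using x subgroup_mem[OF H] by blast
      have Xs: "subgroup X G" "Y \<subseteq> X" using X(2) unfolding U_def subgroups_in_def by auto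
      have "q dvd card X" using card_subgroup_dvd[OF Od(1)[OF X(3)] Xs] Od(3)[OF X(3)] by simp
      also have "card X dvd l" using x(2,3) generate_pow_card[OF xc] pow_eq_id[OF xc, of l] by simp
      finally show False using l by simp
    qed
    then show ?thesis by blast
  qed
  have fin: "finite (cyclic_subgroups H l)" "finite (\<Union>Y\<in>?O. U Y)"
    using finite_subset[OF cyclic_subgroups_subset[OF H] finite_subgroups_in[OF H]]
      finite_subset[OF sub finite_subgroups_in[OF H]] .
  have "card (cyclic_subgroups H l) + card (\<Union>Y\<in>?O. U Y) = card (cyclic_subgroups H l \<union> (\<Union>Y\<in>?O. U Y))"
    using card_Un_disjoint[OF fin disj] by simp
  also have "\<dots> \<le> card (subgroups_in H)"
    using cyclic_subgroups_subset[OF H] sub by (intro card_mono finite_subgroups_in[OF H]) blast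
  finally show ?thesis using 1 by linarith
qed

text \<open>The case \<open>a = p = 2\<close>, where \<open>a + p = 4\<close> is the number of
  cyclic subgroups of the Klein group.\<close>

lemma card_cyclic_subgroups_klein_ge:
  assumes H: "subgroup H G" and no: "\<And>x. x \<in> H \<Longrightarrow> ord x \<noteq> 4" and m: "odd m" "4 * m dvd card H"
  shows "4 * 2 ^ card (prime_factors m) \<le> card (cyclic_subgroups H (4 * m))"
proof -
  have m0: "m > 0" using m(1) by (metis even_zero gr0I)
  have e: "multiplicity q m \<ge> 1" if "q \<in> prime_factors m" for q
    using that by (auto simp: prime_factors_multiplicity)
  have "(2 + 2) * (\<Prod>q\<in>prime_factors m. multiplicity q m + 1) \<le> card (cyclic_subgroups H (4 * m))"
  proof (rule card_cyclic_subgroups_noncyclic_ge[OF H two_is_prime_nat])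
    show "ord x \<noteq> 2 ^ 2" if "x \<in> H" for x using no[OF that] by simp
    show "prime q \<and> q \<noteq> 2 \<and> multiplicity q m > 0" if "q \<in> prime_factors m" for q
      using that e[OF that] m(1) by auto
    show "4 * m = 2 ^ 2 * (\<Prod>q\<in>prime_factors m. q ^ multiplicity q m)"
    proof -
      have "(\<Prod>q\<in>prime_factors m. q ^ multiplicity q m) = m"
        using m0 by (intro prod_prime_power_eq) auto
      then show ?thesis by simp
    qed
  qed (use m in auto)
  moreover have "2 ^ card (prime_factors m) \<le> (\<Prod>q\<in>prime_factors m. multiplicity q m + 1)"
    by (rule two_power_card_le_prod) (rule e)
  ultimately show ?thesis by simp
qed

text \<open>Provides subgroups that may be added to the count of cyclic ones.\<close>

lemma four_dvd_not_cyclic: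
  assumes H: "subgroup H G" and no: "\<And>x. x \<in> H \<Longrightarrow> ord x \<noteq> 4" and K: "4 dvd card K"
  shows "K \<notin> cyclic_subgroups H n"
proof
  assume "K \<in> cyclic_subgroups H n"
  then obtain x where x: "x \<in> H" "K = generate G {x}" unfolding cyclic_subgroups_def by blast
  have xc: "x \<in> carrier G" using x subgroup_mem[OF H] by blast
  have "4 dvd ord x" using K x generate_pow_card[OF xc] by simp
  then obtain t where t: "ord x = 4 * t" by blast
  have "t \<noteq> 0" using ord_pos[OF xc] t by simp
  then have "ord (x [^] t) = 4" using ord_pow[OF xc, of t] t by simp
  then show False using no subgroup_pow[OF H x(1)] by blast
qed

text \<open>For \<open>m = 1\<close> the group itself is added to four cyclic subgroups. For
  \<open>m = 3\<close> the group and a Sylow 2-subgroup are added to eight, and the alternating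
  group of degree 4 has exactly these ten. Otherwise a prime \<open>q \<ge> 5\<close> divides
  \<open>m\<close>.\<close>

theorem card_subgroups_klein_ge:
  assumes "subgroup H G" "card H = 4 * m" "odd m" "squarefree m" "\<And>x. x \<in> H \<Longrightarrow> ord x \<noteq> 4"
  shows "5 * 2 ^ card (prime_factors m) \<le> card (subgroups_in H)"
  using assms
proof (induction m arbitrary: H rule: less_induct)
  case (less m)
  note H = less.prems(1) and cH = less.prems(2) and odd = less.prems(3) and sqf = less.prems(4)
    and no = less.prems(5)
  have m0: "m > 0" using odd by (metis even_zero gr0I)
  have fin: "finite (subgroups_in H)" using finite_subgroups_in[OF H] .
  have HH: "H \<in> subgroups_in H" using H unfolding subgroups_in_def by simp
  have H4: "H \<notin> cyclic_subgroups H n" for n using four_dvd_not_cyclic[OF H no] cH by simp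
  have finc: "finite (cyclic_subgroups H n)" for n
    using finite_subset[OF cyclic_subgroups_subset[OF H] fin] .
  have cyc: "4 * 2 ^ card (prime_factors m) \<le> card (cyclic_subgroups H (4 * m))"
    using card_cyclic_subgroups_klein_ge[OF H no odd] cH by simp
  consider "m = 1" | "m = 3" | "m \<noteq> 1" "m \<noteq> 3" by blast
  then show ?case
  proof cases
    case 1
    have "card (insert H (cyclic_subgroups H (4 * m))) \<le> card (subgroups_in H)"
      using HH cyclic_subgroups_subset[OF H] by (intro card_mono fin) auto
    then show ?thesis using cyc H4 finc 1 by simp
  next
    case 2
    have "(2::nat) ^ 2 dvd card H" using cH by simp
    then obtain K where K: "subgroup K G" "K \<subseteq> H" "card K = 2 ^ 2" by (rule prime_power_subgroup[OF H two_is_prime_nat])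
    have K4: "K \<notin> cyclic_subgroups H (4 * m)" using four_dvd_not_cyclic[OF H no] K(3) by simp
    have KH: "K \<noteq> H" using K(3) cH 2 by auto
    have "insert H (insert K (cyclic_subgroups H (4 * m))) \<subseteq> subgroups_in H"
      using HH K cyclic_subgroups_subset[OF H] unfolding subgroups_in_def by blast
    then have "card (insert H (insert K (cyclic_subgroups H (4 * m)))) \<le> card (subgroups_in H)"
      by (rule card_mono[OF fin])
    moreover have "card (insert H (insert K (cyclic_subgroups H (4 * m)))) = card (cyclic_subgroups H (4 * m)) + 2"
      using H4 K4 KH finc by simp
    moreover have "card (prime_factors m) = 1" unfolding 2 by (simp add: prime_prime_factors)
    ultimately show ?thesis using cyc by simp
  next
    case 3
    \<comment> \<open>If 3 divides \<open>m\<close>, then \<open>m div 3\<close> has another prime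
      factor, as \<open>m\<close> is squarefree and not 3.\<close>
    obtain q where q: "prime q" "q dvd m" "q \<noteq> 3"
    proof -
      obtain p where p: "prime p" "p dvd m" using 3 prime_factor_nat by blast
      show thesis
      proof (cases "p = 3")
        case True
        obtain m2 where m2: "m = 3 * m2" using p True by blast
        then have "m2 \<noteq> 1" using 3 by simp
        then obtain p' where p': "prime p'" "p' dvd m2" using prime_factor_nat by blast
        have "p' \<noteq> 3"
        proof
          assume "p' = 3"
          then have "3\<^sup>2 dvd m" using p' m2 by (auto simp: power2_eq_square)
          then show False using sqf squarefreeD[of m 3] by simp
        qed
        then show thesis using that p' m2 by simp
      qed (use that p in blast)
    qed
    obtain m1 where m1: "m = q * m1" using q by blast
    have oddm1: "odd m1" and oddq: "odd q" using odd m1 by auto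
    have sqf1: "squarefree m1" using squarefree_mono[OF _ sqf, of m1] m1 by simp
    have qm1: "\<not> q dvd m1"
    proof
      assume "q dvd m1"
      then have "q\<^sup>2 dvd m" using m1 by (auto simp: power2_eq_square)
      then show False using sqf squarefreeD[of m q] q(1) by (metis not_prime_unit)
    qed
    have q5: "q \<ge> 5"
    proof -
      have "q \<noteq> 0" "q \<noteq> 1" "q \<noteq> 2" "q \<noteq> 4" using q(1) oddq by auto
      then show ?thesis using q(3) by linarith
    qed
    have m10: "m1 > 0" using m0 m1 by simp
    have q4m1: "\<not> q dvd 4 * m1"
    proof
      assume "q dvd 4 * m1"
      then have "q dvd 4" using q(1) qm1 prime_dvd_mult_iff by blast
      then have "q \<le> 4" by (intro dvd_imp_le) auto
      then show False using q5 by simp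
    qed
    have w: "card (prime_factors m) = Suc (card (prime_factors m1))"
      using card_prime_factors_mult[of q m1] prime_imp_coprime[OF q(1) qm1] m10 q5 q(1) m1
      by (simp add: prime_prime_factors)
    have "q ^ 1 dvd card H" using cH m1 by simp
    then obtain Q where Q: "subgroup Q G" "Q \<subseteq> H" "card Q = q ^ 1" by (rule prime_power_subgroup[OF H q(1)])
    have cQ: "card Q = q" using Q(3) by simp
    have cH': "card H = q * (4 * m1)" using cH m1 by simp
    show ?thesis
    proof (cases "normalizes H Q")
      case True
      obtain C where C: "subgroup C G" "C \<subseteq> H" "Q \<inter> C = {\<one>}" "card C = 4 * m1"
        using prime_order_complement[OF H Q(1,2) cQ True q(1) cH' q4m1] .
      have "5 * 2 ^ card (prime_factors m1) \<le> card (subgroups_in C)"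
        using less.IH[OF _ C(1,4) oddm1 sqf1] no C(2) m10 m1 q5 by auto
      moreover have "Q \<noteq> {\<one>}" using cQ q5 by auto
      ultimately show ?thesis
        using card_subgroups_in_ge_double[OF H Q(1,2) _ True C(1-3)] w by simp
    next
      case False
      let ?O = "conjugates H Q"
      have max: "\<not> q ^ Suc 1 dvd card H"
      proof
        assume "q ^ Suc 1 dvd card H"
        then have "q dvd 4 * m1" unfolding cH' using q5 by simp
        then show False using q4m1 by simp
      qed
      have finO: "finite ?O" using finite_orb[OF H acts_conjugate_sets[OF H]] .
      have QO: "Q \<in> ?O"
        using orb_refl[OF H acts_conjugate_sets[OF H], of Q] Q(1) subgroup.subset by blast
      have "card ?O \<noteq> 1"
      proof
        assume "card ?O = 1"
        then have "?O = {Q}" using QO by (auto simp: card_1_singleton_iff)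
        have "conjugate g ` Q = Q" if "g \<in> H" for g
        proof -
          have "conjugate g ` Q \<in> ?O" unfolding orb_def using that by (rule imageI)
          then show ?thesis unfolding \<open>?O = {Q}\<close> by (rule singletonD)
        qed
        then show False using False unfolding normalizes_def by blast
      qed
      moreover have "card ?O \<noteq> 0" using QO finO by auto
      moreover have "q dvd card ?O - 1" using card_conjugates_cong_1[OF H q(1) max Q] .
      \<comment> \<open>The number of conjugates is 1 modulo \<open>q\<close> but not 1, so it is at
        least \<open>q + 1\<close>.\<close>
      ultimately have n6: "6 \<le> card ?O" using q5 dvd_imp_le[of q "card ?O - 1"] by linarith
      have cN: "card ?O * card (normalizer_in H Q) = card H" using card_conjugates[OF H q(1) max Q] .
      have "q dvd card (normalizer_in H Q)"
        using card_subgroup_dvd[OF Q(1) subgroup_in_normalizer(1,2)[OF H q(1) max Q]] cQ by simp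
      then obtain k where k: "card (normalizer_in H Q) = q * k" by blast
      have "q * (card ?O * k) = q * (4 * m1)" using cN k cH' by (simp add: mult_ac)
      then have nk: "card ?O * k = 2 ^ 2 * m1" using q5 by simp
      \<comment> \<open>The factor 4 of \<open>4 * m1\<close> is shared between the number of
        conjugates, with \<open>2 ^ b\<close>, and the cofactor \<open>k\<close> of the normalizer,
        with \<open>2 ^ j\<close>. The odd parts \<open>r\<close> and \<open>s\<close> split
        \<open>m1\<close>.\<close>
      obtain b r where br: "card ?O = 2 ^ b * r" "odd r"
        using two_power_times_odd[of "card ?O"] n6 by auto
      have "k \<noteq> 0" using nk m10 by (metis mult_0_right mult_is_0 neq0_conv power_not_zero zero_neq_numeral)
      then obtain j s where js: "k = 2 ^ j * s" "odd s"
        using two_power_times_odd by blast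
      have eq: "2 ^ (b + j) * (r * s) = 2 ^ 2 * m1" using nk br js by (simp add: power_add mult_ac)
      have "multiplicity 2 (2 ^ (b + j) * (r * s)) = b + j"
        by (rule multiplicity_eqI) (use br js in auto)
      moreover have "multiplicity 2 (2 ^ 2 * m1) = 2"
        by (rule multiplicity_eqI) (use oddm1 in auto)
      ultimately have bj: "b + j = 2" using eq by metis
      then have rs: "m1 = r * s" using eq by simp
      have "coprime r s"
      proof (rule coprimeI)
        fix d assume "d dvd r" "d dvd s"
        then have "d\<^sup>2 dvd m1" unfolding rs power2_eq_square by (rule mult_dvd_mono)
        then show "is_unit d" by (rule squarefreeD[OF sqf1])
      qed
      then have wrs: "card (prime_factors m1) = card (prime_factors r) + card (prime_factors s)"
        unfolding rs using m10 rs by (intro card_prime_factors_mult) auto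
      have "(j + 1) * 2 ^ card (prime_factors s) \<le> (\<Prod>p\<in>prime_factors k. multiplicity p k + 1)"
        using prod_multiplicity_ge[OF js(2,1)] .
      then have "card ?O * ((j + 1) * 2 ^ card (prime_factors s))
          \<le> card ?O * (\<Prod>p\<in>prime_factors k. multiplicity p k + 1)" by simp
      moreover have "6 * 2 ^ card (prime_factors m1) \<le> card ?O * ((j + 1) * 2 ^ card (prime_factors s))"
      proof -
        have "6 * 2 ^ card (prime_factors r) \<le> 2 ^ b * r * (3 - b)"
          using conjugate_count_bound[OF br(2)] bj n6 br(1) by simp
        moreover have "3 - b = j + 1" using bj by simp
        ultimately have "6 * 2 ^ card (prime_factors r) \<le> card ?O * (j + 1)" using br(1) by simp
        then have "6 * 2 ^ card (prime_factors r) * 2 ^ card (prime_factors s)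
            \<le> card ?O * (j + 1) * 2 ^ card (prime_factors s)" by (rule mult_right_mono) simp
        then show ?thesis unfolding wrs by (simp only: power_add mult.assoc)
      qed
      moreover have "4 * 2 ^ card (prime_factors m1) \<le> card (cyclic_subgroups H (4 * m1))"
        using card_cyclic_subgroups_klein_ge[OF H no oddm1] cH' by simp
      moreover have "card (cyclic_subgroups H (4 * m1)) + card ?O * (\<Prod>p\<in>prime_factors k. multiplicity p k + 1)
          \<le> card (subgroups_in H)"
        using card_subgroups_in_ge_conjugates[OF H q(1) max Q(1,2) cQ q4m1] cN k by simp
      \<comment> \<open>The cyclic subgroups of order prime to \<open>q\<close> contribute 4 and the
        groups around the conjugates 6 times \<open>2 ^ card (prime_factors m1)\<close>; and 4 + 6 =
        5 * 2, the 2 belonging to \<open>q\<close>.\<close>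
      ultimately show ?thesis unfolding w power_Suc by linarith
    qed
  qed
qed

text \<open>The hypothesis \<open>no\<close> says that the Sylow \<open>p\<close>-subgroups are not
  cyclic, which forces \<open>a \<ge> 2\<close> since groups of order 1 or \<open>p\<close> are
  cyclic. The factor of \<open>p\<close> is then \<open>a + p\<close> in place of
  \<open>a + 1\<close>, and it is below 5 only for \<open>a = p = 2\<close>.\<close>

lemma card_subgroups_noncyclic_sylow:
  assumes H: "subgroup H G" and p: "prime p" and no: "\<And>x. x \<in> H \<Longrightarrow> ord x \<noteq> p ^ multiplicity p (card H)"
  shows "5 * 2 ^ card (prime_factors (card H)) \<le> 2 * card (subgroups_in H)"
proof -
  define a where "a = multiplicity p (card H)"
  have H0: "card H \<noteq> 0" using subgroup_card_pos[OF H] by simp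
  obtain N where N: "card H = p ^ a * N" "\<not> p dvd N"
    using multiplicity_decompose'[of "card H" p] p H0 unfolding a_def by (metis not_prime_unit)
  have N0: "N \<noteq> 0" using N H0 by (metis mult_0_right)
  have "a \<noteq> 0" using no[OF subgroup.one_closed[OF H]] unfolding a_def[symmetric] by (metis ord_id power_0)
  moreover have "a \<noteq> 1"
  proof
    assume a1: "a = 1"
    then have "p dvd card H" using N(1) by simp
    then obtain x where "x \<in> H" "ord x = p" using cauchy_element[OF H p] by blast
    then show False using no[of x] a1 unfolding a_def by simp
  qed
  ultimately have a2: "2 \<le> a" by linarith
  have e: "multiplicity q N \<ge> 1" "prime q" "q \<noteq> p" if "q \<in> prime_factors N" for q
    using that N(2) by (auto simp: prime_factors_multiplicity not_dvd_imp_multiplicity_0)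
  have "card (prime_factors (card H)) = card (prime_factors (p ^ a)) + card (prime_factors N)"
    unfolding N(1) using N0 p prime_imp_coprime[OF p N(2)] prime_gt_0_nat[OF p]
    by (intro card_prime_factors_mult) auto
  then have w: "card (prime_factors (card H)) = Suc (card (prime_factors N))"
    using a2 p by (simp add: prime_factors_power prime_prime_factors prime_gt_0_nat)
  let ?P = "\<Prod>q\<in>prime_factors N. multiplicity q N + 1"
  have "(a + p) * ?P \<le> card (cyclic_subgroups H (card H))"
  proof (rule card_cyclic_subgroups_noncyclic_ge[OF H p a2])
    show "ord x \<noteq> p ^ a" if "x \<in> H" for x using no[OF that] unfolding a_def .
    show "prime q \<and> q \<noteq> p \<and> multiplicity q N > 0" if "q \<in> prime_factors N" for q
      using e[OF that] by simp
    have "(\<Prod>q\<in>prime_factors N. q ^ multiplicity q N) = N"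
      using N0 by (intro prod_prime_power_eq) auto
    then show "card H = p ^ a * (\<Prod>q\<in>prime_factors N. q ^ multiplicity q N)" using N(1) by simp
  qed auto
  then have cyc: "(a + p) * ?P \<le> card (subgroups_in H)"
    using card_mono[OF finite_subgroups_in[OF H] cyclic_subgroups_subset[OF H]] by (rule order_trans)
  have P: "2 ^ card (prime_factors N) \<le> ?P"
    by (rule two_power_card_le_prod) (rule e(1))
  have p2: "p \<ge> 2" using prime_ge_2_nat[OF p] .
  have "5 * 2 ^ card (prime_factors N) \<le> card (subgroups_in H)"
  proof (cases "a + p \<ge> 5")
    case True
    have "5 * 2 ^ card (prime_factors N) \<le> (a + p) * ?P" by (rule mult_le_mono[OF True P])
    then show ?thesis using cyc by linarith
  next
    case False
    then have ap: "a = 2" "p = 2" using a2 p2 by auto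
    show ?thesis
    proof (cases "squarefree N")
      case True
      have "ord x \<noteq> 4" if "x \<in> H" for x using no[OF that] ap unfolding a_def[symmetric] by simp
      then show ?thesis using card_subgroups_klein_ge[OF H _ _ True] N ap by simp
    next
      case False
      then obtain q where q: "q \<in> prime_factors N" "multiplicity q N \<noteq> 1"
        using squarefree_factorial_semiring'[OF N0] by blast
      \<comment> \<open>An odd prime with exponent at least 2 has a factor of at least 3, and 4 * 3
        exceeds 5 * 2.\<close>
      then have q2: "multiplicity q N + 1 \<ge> 3" using e(1)[OF q(1)] by linarith
      let ?T = "prime_factors N - {q}"
      have "?P = (multiplicity q N + 1) * (\<Prod>q\<in>?T. multiplicity q N + 1)"
        using q(1) by (simp add: prod.remove)
      moreover have "2 ^ card ?T \<le> (\<Prod>q\<in>?T. multiplicity q N + 1)"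
        by (rule two_power_card_le_prod) (use e(1) in auto)
      ultimately have "3 * 2 ^ card ?T \<le> ?P" using mult_le_mono[OF q2] by simp
      moreover have "card (prime_factors N) = Suc (card ?T)"
        using q(1) by (metis card_Suc_Diff1 finite_set_mset)
      ultimately show ?thesis using cyc ap by simp
    qed
  qed
  then show ?thesis unfolding w by simp
qed

section \<open>Cyclic subgroups described by element orders\<close>

lemma generate_eq_if_ord_eq_card:
  assumes P: "subgroup P G" and y: "y \<in> P" "ord y = card P"
  shows "generate G {y} = P"
  using card_subset_eq[OF subgroup_finite[OF P] generate_subset_subgroup[OF P y(1)]]
    generate_pow_card[OF subgroup_mem[OF P y(1)]] y(2) by simp

lemma ord_conjugate: "g \<in> carrier G \<Longrightarrow> x \<in> carrier G \<Longrightarrow> ord (conjugate g x) = ord x"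
  using conj_pow_eq_one_iff pow_eq_id by (metis conj_closed ord_unique)

text \<open>The group generated by \<open>x\<close> is a Sylow \<open>p\<close>-subgroup of
  \<open>H\<close>, and conjugating it onto \<open>P\<close> carries \<open>x\<close> to a
  generator.\<close>

lemma sylow_cyclic:
  assumes H: "subgroup H G" and p: "prime p" and x: "x \<in> H" "ord x = p ^ multiplicity p (card H)"
    and P: "subgroup P G" "P \<subseteq> H" "card P = p ^ multiplicity p (card H)"
  obtains y where "y \<in> P" "ord y = card P"
proof -
  let ?a = "multiplicity p (card H)" and ?X = "generate G {x}"
  have xc: "x \<in> carrier G" using x subgroup_mem[OF H] by blast
  have "card H \<noteq> 0" "\<not> is_unit p" using subgroup_card_pos[OF H] p by auto
  then have max: "\<not> p ^ Suc ?a dvd card H"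
    using multiplicity_geI[of "card H" p "Suc ?a"] by auto
  have X: "subgroup ?X G" "?X \<subseteq> H" "card ?X = p ^ ?a"
    using generate_is_subgroup[of "{x}"] generate_subset_subgroup[OF H x(1)] generate_pow_card[OF xc] xc x(2)
    by simp_all
  obtain g where g: "g \<in> H" "P = conjugate g ` ?X" using sylow_conjugate[OF H p max X P] .
  have "conjugate g x \<in> P" unfolding g(2) using generate.incl[of x "{x}" G] by blast
  moreover have "ord (conjugate g x) = card P"
    using ord_conjugate[OF subgroup_mem[OF H g(1)] xc] x(2) P(3) by simp
  ultimately show ?thesis using that by blast
qed

lemma cyclic_group_subgroupI:
  assumes P: "subgroup P G" and y: "y \<in> P" "ord y = card P"
  shows "cyclic_group (G\<lparr>carrier := P\<rparr>)"
proof -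
  have "generate (G\<lparr>carrier := P\<rparr>) {y} = P"
    using generate_consistent[of "{y}" P] P y generate_eq_if_ord_eq_card[OF P y] by simp
  then have "subgroup_generated (G\<lparr>carrier := P\<rparr>) {y} = G\<lparr>carrier := P\<rparr>"
    unfolding subgroup_generated_def using y(1) by simp
  then show ?thesis unfolding cyclic_group_def using y(1) by auto
qed

text \<open>If \<open>(x \<otimes> y) [^] n = \<one>\<close>, then \<open>x [^] n\<close> is the
  inverse of \<open>y [^] n\<close>; their common order divides two coprime numbers, so it is
  1.\<close>

lemma ord_mult_coprime:
  assumes x: "x \<in> carrier G" and y: "y \<in> carrier G" and c: "x \<otimes> y = y \<otimes> x" and cop: "coprime (ord x) (ord y)"
  shows "ord (x \<otimes> y) = ord x * ord y"
proof (rule dvd_antisym)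
  show "ord (x \<otimes> y) dvd ord x * ord y" using ord_mul_divides[OF c x y] .
  let ?n = "ord (x \<otimes> y)"
  have "x [^] ?n \<otimes> y [^] ?n = \<one>"
    using pow_mult_distrib[OF c x y, of ?n] pow_ord_eq_1[of "x \<otimes> y"] x y by simp
  then have inv: "x [^] ?n = inv (y [^] ?n)" using x y by (simp add: inv_equality)
  have ordpow: "ord (z [^] ?n) dvd ord z" if "z \<in> carrier G" for z
    using that by (metis nat_pow_closed nat_pow_one nat_pow_pow pow_eq_id pow_ord_eq_1 mult.commute)
  have "ord (x [^] ?n) = ord (y [^] ?n)" using inv y by simp
  then have "ord (x [^] ?n) dvd ord x" "ord (x [^] ?n) dvd ord y" using ordpow x y by metis+
  then have o1: "ord (x [^] ?n) = 1" using coprime_common_divisor_nat[OF cop] by simp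
  then have "ord (y [^] ?n) = 1" using \<open>ord (x [^] ?n) = ord (y [^] ?n)\<close> by simp
  then have "x [^] ?n = \<one>" "y [^] ?n = \<one>" using o1 ord_eq_1 x y by blast+
  then have "ord x dvd ?n" "ord y dvd ?n" using pow_eq_id x y by blast+
  then show "ord x * ord y dvd ?n" using cop by (simp add: divides_mult)
qed

text \<open>With \<open>t\<close> the index of \<open>K\<close>, the generator is
  \<open>w [^] t\<close>: a power of \<open>w\<close> killed by \<open>card K\<close> has an
  exponent divisible by \<open>t\<close>.\<close>

lemma subgroup_of_cyclic:
  assumes w: "w \<in> carrier G" and K: "subgroup K G" "K \<subseteq> generate G {w}"
  obtains y where "y \<in> K" "ord y = card K"
proof -
  have W: "subgroup (generate G {w}) G" using generate_is_subgroup[of "{w}"] w by simp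
  have "card K dvd ord w" using card_subgroup_dvd[OF K(1) W K(2)] generate_pow_card[OF w] by simp
  then obtain t where t: "ord w = card K * t" by blast
  have t0: "t \<noteq> 0" using ord_pos[OF w] t by simp
  define y where "y = w [^] t"
  have yc: "y \<in> carrier G" unfolding y_def using w by simp
  have oy: "ord y = card K" unfolding y_def using ord_pow[OF w, of t] t t0 by simp
  have "K \<subseteq> generate G {y}"
  proof
    fix x assume x: "x \<in> K"
    then obtain i :: nat where i: "x = w [^] i"
      using K(2) generate_pow_on_finite_carrier[OF finite_carrier w] by blast
    have "w [^] (i * card K) = \<one>" using pow_card_eq_one[OF K(1) x] i w by (simp add: nat_pow_pow)
    then have "card K * t dvd i * card K" using pow_eq_id[OF w] t by simp
    then have "t dvd i" using subgroup_card_pos[OF K(1)] by (simp add: mult.commute)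
    then obtain s where "i = t * s" by blast
    then have "x = y [^] s" unfolding y_def i using w by (simp add: nat_pow_pow)
    then show "x \<in> generate G {y}" using generate_pow_on_finite_carrier[OF finite_carrier yc] by blast
  qed
  moreover have "card (generate G {y}) = card K" using oy generate_pow_card[OF yc] by simp
  moreover have "finite (generate G {y})"
    using subgroup_finite generate_is_subgroup[of "{y}"] yc by simp
  ultimately have "K = generate G {y}" using card_subset_eq by metis
  then have "y \<in> K" using generate.incl[of y "{y}" G] by simp
  then show ?thesis using that oy by blast
qed

subsection \<open>Groups with cyclic Sylow subgroups\<close>

text \<open>Only an element of full \<open>p\<close>-power order is asked for; by conjugacy this
  makes every Sylow \<open>p\<close>-subgroup of \<open>H\<close> cyclic.\<close>

definition cyclic_sylows :: "'a set \<Rightarrow> bool" where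
  "cyclic_sylows H \<longleftrightarrow> (\<forall>p. prime p \<longrightarrow> (\<exists>x\<in>H. ord x = p ^ multiplicity p (card H)))"

text \<open>The elements of \<open>D\<close> of a given order \<open>n\<close> come in multiples of
  \<open>totient n\<close>, and \<open>p dvd n\<close> gives
  \<open>p - 1 dvd totient n\<close>.\<close>

lemma card_prime_divisible_order_dvd:
  assumes H: "subgroup H G" and p: "prime p" and D: "D \<subseteq> H"
    and closed: "\<And>x y. x \<in> D \<Longrightarrow> y \<in> H \<Longrightarrow> ord y = ord x \<Longrightarrow> y \<in> D"
    and dvd: "\<And>x. x \<in> D \<Longrightarrow> p dvd ord x"
  shows "p - 1 dvd card D"
proof -
  have fin: "finite D" using D subgroup_finite[OF H] finite_subset by blast
  have "card D = (\<Sum>n\<in>ord ` D. card {x \<in> D. ord x = n})"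
    using sum.image_gen[OF fin, of "\<lambda>_. 1::nat" ord] by simp
  moreover have "p - 1 dvd card {y \<in> D. ord y = ord x}" if x: "x \<in> D" for x
  proof -
    have "{y \<in> D. ord y = ord x} = {y \<in> H. ord y = ord x}" using D closed[OF x] by blast
    moreover have "p - 1 dvd totient (ord x)"
      using totient_dvd[OF dvd[OF x]] totient_prime[OF p] by simp
    ultimately show ?thesis using totient_dvd_card_ord[OF H, of "ord x"] dvd_trans by metis
  qed
  ultimately show ?thesis by (auto intro: dvd_sum)
qed

text \<open>For \<open>d = p e\<close>, Frobenius gives \<open>k e\<close> solutions of \<open>x ^ e = 1\<close> among the \<open>d\<close> solutions of
  \<open>x ^ d = 1\<close>; the orders of the remaining ones are multiples of \<open>p\<close>, hence \<open>p - 1\<close> divides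
  \<open>(p - k) e\<close>, and therefore \<open>p - k\<close>.\<close>

lemma card_solutions_eq:
  assumes H: "subgroup H G" and Z: "cyclic_sylows H"
  shows "card H = e * c \<Longrightarrow> (\<And>p p'. prime p \<Longrightarrow> prime p' \<Longrightarrow> p dvd e \<Longrightarrow> p' dvd c \<Longrightarrow> p' \<le> p)
    \<Longrightarrow> card {x \<in> H. x [^] e = \<one>} = e"
proof (induction c arbitrary: e rule: less_induct)
  case (less c)
  have pos: "card H > 0" using subgroup_card_pos[OF H] .
  then have e0: "e > 0" and c0: "c > 0" using less.prems(1) by auto
  have finH: "finite H" using subgroup_finite[OF H] .
  have Hc: "\<And>x. x \<in> H \<Longrightarrow> x \<in> carrier G" using subgroup_mem[OF H] .
  show ?case
  proof (cases "c = 1")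
    case True
    then have "{x \<in> H. x [^] e = \<one>} = H" using pow_card_eq_one[OF H] less.prems(1) by auto
    then show ?thesis using less.prems(1) True by simp
  next
    case False
    \<comment> \<open>Moving the largest prime of \<open>c\<close> over to \<open>e\<close>
      preserves the condition on the primes and makes \<open>c\<close> smaller.\<close>
    define p where "p = Max (prime_factors c)"
    have "prime_factors c \<noteq> {}" using False c0 prime_factor_nat[OF False] by (auto simp: prime_factors_dvd)
    then have "p \<in> prime_factors c" unfolding p_def by (intro Max_in) auto
    then have p: "prime p" "p dvd c" by auto
    have pmax: "p' \<le> p" if "prime p'" "p' dvd c" for p'
      unfolding p_def using that c0 by (intro Max_ge) (auto simp: prime_factors_dvd)
    obtain c' where c': "c = p * c'" using p(2) by blast
    have p1: "p > 1" using prime_gt_1_nat[OF p(1)] .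
    let ?d = "e * p" and ?B = "{x \<in> H. x [^] e = \<one>}"
    have cH: "card H = ?d * c'" using less.prems(1) c' by simp
    have "c' < c" using c' c0 p1 by simp
    then have Bd: "card {x \<in> H. x [^] ?d = \<one>} = ?d"
    proof (rule less.IH[OF _ cH])
      fix r r' assume r: "prime r" "prime r'" "r dvd ?d" "r' dvd c'"
      have r'c: "r' dvd c" using r(4) c' by simp
      consider "r dvd e" | "r dvd p" using r(1,3) prime_dvd_mult_iff by blast
      then show "r' \<le> r"
      proof cases
        case 1
        then show ?thesis using less.prems(2)[OF r(1,2) 1 r'c] by simp
      next
        case 2
        then have "r = p" using r(1) p(1) primes_dvd_imp_eq by blast
        then show ?thesis using pmax[OF r(2) r'c] by simp
      qed
    qed
    let ?D = "{x \<in> H. x [^] ?d = \<one>} - ?B"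
    have sub: "?B \<subseteq> {x \<in> H. x [^] ?d = \<one>}"
    proof clarify
      fix x assume "x \<in> H" "x [^] e = \<one>"
      then show "x [^] ?d = \<one>" using Hc nat_pow_pow[of x e p] by simp
    qed
    have mem: "x \<in> ?D \<longleftrightarrow> x \<in> H \<and> ord x dvd ?d \<and> \<not> ord x dvd e" for x
      using pow_eq_id Hc by blast
    have "p - 1 dvd card ?D"
    proof (rule card_prime_divisible_order_dvd[OF H p(1)])
      show "y \<in> ?D" if "x \<in> ?D" "y \<in> H" "ord y = ord x" for x y
        using that unfolding mem by simp
      show "p dvd ord x" if x: "x \<in> ?D" for x
      proof (rule ccontr)
        assume "\<not> p dvd ord x"
        then have "coprime (ord x) p" using p(1) by (simp add: prime_imp_coprime coprime_commute)
        then have "ord x dvd e" using x unfolding mem by (simp add: coprime_dvd_mult_left_iff)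
        then show False using x unfolding mem by blast
      qed
    qed blast
    \<comment> \<open>Here cyclic Sylow subgroups enter: some element has as order the full
      \<open>p\<close>-part of \<open>?d\<close>, which does not divide \<open>e\<close>. This
      yields \<open>k < p\<close>.\<close>
    moreover have Dne: "?D \<noteq> {}"
    proof -
      define j where "j = multiplicity p ?d"
      obtain x where x: "x \<in> H" "ord x = p ^ multiplicity p (card H)"
        using Z p(1) unfolding cyclic_sylows_def by blast
      have "p ^ j dvd card H" unfolding j_def cH using multiplicity_dvd[of p ?d] by simp
      then have "p ^ j dvd ord x"
        using x(2) pos p(1) by (metis le_imp_power_dvd multiplicity_geI not_prime_unit less_irrefl)
      then obtain t where t: "ord x = p ^ j * t" by blast
      have "t \<noteq> 0" using ord_pos[OF Hc[OF x(1)]] t by simp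
      then have o: "ord (x [^] t) = p ^ j" using ord_pow[OF Hc[OF x(1)], of t] t by simp
      have "j = Suc (multiplicity p e)" unfolding j_def
        using e0 p(1) p1 by (simp add: prime_elem_multiplicity_mult_distrib)
      then have "\<not> p ^ j dvd e" using e0 p(1) multiplicity_geI[of e p j] by (metis Suc_n_not_le_n not_prime_unit less_irrefl)
      then have "x [^] t \<in> ?D"
        unfolding mem o using subgroup_pow[OF H x(1)] multiplicity_dvd[of p ?d] unfolding j_def by simp
      then show ?thesis by blast
    qed
    moreover have cD: "card ?D = ?d - card ?B"
      using card_Diff_subset[OF _ sub] finH Bd by simp
    obtain k where k: "card ?B = e * k" using frobenius[OF H, of e] less.prems(1) by (metis dvdE dvd_triv_left)
    have "card ?D > 0" using Dne finH by (simp add: card_gt_0_iff)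
    then have "k < p" using cD k e0 by (simp add: diff_mult_distrib2[symmetric])
    have k1: "k \<ge> 1"
    proof -
      have "\<one> \<in> ?B" using subgroup.one_closed[OF H] by simp
      then have "card ?B \<noteq> 0" using finH by auto
      then show ?thesis using k by (cases k) auto
    qed
    have "card ?D = e * (p - k)" using cD k by (simp add: diff_mult_distrib2)
    ultimately have "p - 1 dvd e * (p - k)" by simp
    \<comment> \<open>Every prime factor of \<open>e\<close> is at least \<open>p\<close>, hence
      larger than \<open>p - 1\<close>.\<close>
    moreover have "coprime (p - 1) e"
    proof (rule coprimeI)
      fix u assume u: "u dvd p - 1" "u dvd e"
      show "is_unit u"
      proof (rule ccontr)
        assume "\<not> is_unit u"
        then obtain r where r: "prime r" "r dvd u" using prime_factor_nat[of u] by auto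
        have "r dvd p - 1" "r dvd e" using r(2) u dvd_trans by blast+
        then have "r \<le> p - 1" "p \<le> r"
          using dvd_imp_le[of r "p - 1"] p1 less.prems(2)[OF r(1) p(1) _ p(2)] by simp_all
        then show False using p1 by simp
      qed
    qed
    ultimately have "p - 1 dvd p - k" by (simp add: coprime_dvd_mult_right_iff)
    then have "p - 1 \<le> p - k" using \<open>k < p\<close> by (intro dvd_imp_le) auto
    then have "k = 1" using k1 \<open>k < p\<close> by linarith
    then show ?thesis using k by simp
  qed
qed

text \<open>For the largest prime \<open>q\<close>, the equation
  \<open>x [^] (q ^ b) = \<one>\<close> has exactly \<open>q ^ b\<close> solutions, so they form the
  Sylow subgroup generated by \<open>z\<close>, and the solution set is invariant under conjugation.
  The last clause lets cyclic Sylow subgroups pass to a complement.\<close>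

lemma largest_sylow_normal:
  assumes H: "subgroup H G" and Z: "cyclic_sylows H" and H1: "card H \<noteq> 1"
  obtains z k where "z \<in> H" "normalizes H (generate G {z})" "ord z > 1" "card H = ord z * k" "coprime (ord z) k"
    "\<And>p. prime p \<Longrightarrow> p dvd k \<Longrightarrow> multiplicity p k = multiplicity p (card H)"
proof -
  have pos: "card H > 0" using subgroup_card_pos[OF H] .
  have Hc: "\<And>x. x \<in> H \<Longrightarrow> x \<in> carrier G" using subgroup_mem[OF H] .
  define q where "q = Max (prime_factors (card H))"
  have "prime_factors (card H) \<noteq> {}" using pos prime_factor_nat[OF H1] by (auto simp: prime_factors_dvd)
  then have "q \<in> prime_factors (card H)" unfolding q_def by (intro Max_in) auto
  then have q: "prime q" "q dvd card H" by auto
  have qmax: "p \<le> q" if "prime p" "p dvd card H" for p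
    unfolding q_def using that pos by (intro Max_ge) (auto simp: prime_factors_dvd)
  define b where "b = multiplicity q (card H)"
  obtain k where k: "card H = q ^ b * k" "\<not> q dvd k"
    using multiplicity_decompose'[of "card H" q] q pos unfolding b_def by (metis less_irrefl not_prime_unit)
  have b0: "b > 0" unfolding b_def using q pos by (simp add: prime_multiplicity_gt_zero_iff)
  obtain z where z: "z \<in> H" "ord z = q ^ b" using Z q(1) unfolding cyclic_sylows_def b_def by blast
  have zc: "z \<in> carrier G" using Hc z by blast
  let ?B = "{x \<in> H. x [^] (q ^ b) = \<one>}"
  have "card ?B = q ^ b"
  proof (rule card_solutions_eq[OF H Z k(1)])
    fix p p' assume r: "prime p" "prime p'" "p dvd q ^ b" "p' dvd k"
    have "p = q" using r(1,3) q(1) prime_dvd_power primes_dvd_imp_eq by blast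
    then show "p' \<le> p" using qmax[OF r(2)] r(4) k(1) by simp
  qed
  moreover have "generate G {z} \<subseteq> ?B"
  proof
    fix x assume x: "x \<in> generate G {z}"
    have "x \<in> H" using x generate_subset_subgroup[OF H z(1)] by blast
    moreover have "x [^] card (generate G {z}) = \<one>"
      using pow_card_eq_one[OF generate_is_subgroup x] zc by simp
    ultimately show "x \<in> ?B" using generate_pow_card[OF zc] z(2) by simp
  qed
  moreover have "finite ?B" using subgroup_finite[OF H] by simp
  ultimately have eq: "generate G {z} = ?B"
    using card_subset_eq[of ?B "generate G {z}"] generate_pow_card[OF zc] z(2) by simp
  have n: "normalizes H (generate G {z})"
    unfolding normalizes_def
  proof
    fix g assume g: "g \<in> H"
    have "conjugate g ` ?B \<subseteq> ?B" using conj_pow_solutions_closed[OF H g] by blast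
    moreover have "?B \<subseteq> carrier G" using Hc by blast
    then have "card (conjugate g ` ?B) = card ?B" by (rule card_conjugate_image[OF Hc[OF g]])
    ultimately show "conjugate g ` generate G {z} = generate G {z}"
      unfolding eq by (rule card_subset_eq[OF \<open>finite ?B\<close>])
  qed
  have mk: "multiplicity p k = multiplicity p (card H)" if p: "prime p" "p dvd k" for p
  proof -
    have "p \<noteq> q" using p(2) k(2) by blast
    then have "\<not> p dvd q ^ b" using p(1) q(1) prime_dvd_power primes_dvd_imp_eq by blast
    then have "multiplicity p (q ^ b) = 0" by (rule not_dvd_imp_multiplicity_0)
    moreover have "k \<noteq> 0" "q ^ b \<noteq> 0" using k(1) pos by auto
    ultimately show ?thesis unfolding k(1) using p(1) by (simp add: prime_elem_multiplicity_mult_distrib)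
  qed
  have cop: "coprime (ord z) k" using z(2) k(2) q(1) by (simp add: prime_imp_coprime)
  have z1: "ord z > 1" unfolding z(2) by (rule one_less_power[OF prime_gt_1_nat[OF q(1)] b0])
  have cz: "card H = ord z * k" using z(2) k(1) by simp
  show ?thesis by (rule that[OF z(1) n z1 cz cop mk])
qed

text \<open>\<open>H\<close> acts on a cyclic normal subgroup by power maps. These commute, so every
  commutator acts trivially.\<close>

lemma commutators_centralize_cyclic_normal:
  assumes H: "subgroup H G" and z: "z \<in> H" and n: "normalizes H (generate G {z})"
  shows "derived G H \<subseteq> stab H conjugate z"
  unfolding derived_def
proof (rule generate_subgroup_incl[OF _ stab_subgroup[OF H acts_conjugate[OF H] z]], rule subsetI)
  have Hc: "\<And>x. x \<in> H \<Longrightarrow> x \<in> carrier G" using subgroup_mem[OF H] .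
  have zc: "z \<in> carrier G" using Hc z .
  have pow: "\<exists>i::nat. conjugate g z = z [^] i" if g: "g \<in> H" for g
  proof -
    have "conjugate g z \<in> generate G {z}"
      using normalizes_conjugate_in[OF n g] generate.incl[of z "{z}" G] by blast
    then show ?thesis using generate_pow_on_finite_carrier[OF finite_carrier zc] by blast
  qed
  fix c assume "c \<in> derived_set G H"
  then obtain g h where gh: "g \<in> H" "h \<in> H" "c = g \<otimes> h \<otimes> inv g \<otimes> inv h" by blast
  note cc = Hc[OF gh(1)] Hc[OF gh(2)]
  have cH: "c \<in> H" unfolding gh(3)
    using gh(1,2) H by (simp add: subgroup.m_closed subgroup.m_inv_closed)
  obtain i j :: nat where ij: "conjugate g z = z [^] i" "conjugate h z = z [^] j" using pow gh by metis
  have "conjugate (g \<otimes> h) z = conjugate (h \<otimes> g) z"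
    using ij cc zc by (simp add: conj_conj conj_pow nat_pow_pow mult.commute)
  moreover have "c \<otimes> (h \<otimes> g) = g \<otimes> h"
    unfolding gh(3) using cc by (simp add: m_assoc inv_solve_left flip: m_assoc[of "inv h" h g] m_assoc[of "inv g" g])
  moreover have hg: "inv (h \<otimes> g) \<in> H" using gh(1,2) H by (simp add: subgroup.m_closed subgroup.m_inv_closed)
  then obtain l :: nat where l: "conjugate (inv (h \<otimes> g)) z = z [^] l" using pow by blast
  \<comment> \<open>Writing \<open>z\<close> as the image of a power of \<open>z\<close> under
    \<open>h \<otimes> g\<close> lets the commutator turn that into the image under
    \<open>g \<otimes> h\<close>, which is the same.\<close>
  have "z = conjugate (h \<otimes> g) (z [^] l)" using l cc zc conj_inv'[of "h \<otimes> g" z] by simp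
  ultimately have "conjugate c z = z"
    using cc zc Hc[OF cH] conj_conj[of c "h \<otimes> g" "z [^] l"] by (simp add: conj_pow)
  then show "c \<in> stab H conjugate z" unfolding stab_def using cH by simp
qed

text \<open>Modulo \<open>Q\<close>, every element of \<open>H\<close> is represented in
  \<open>C\<close>, so a commutator of \<open>H\<close> is one of \<open>C\<close> up to a factor
  from \<open>Q\<close>. The facts \<open>rel_mult\<close> and \<open>rel_inv\<close> carry out this
  computation without forming the quotient.\<close>

lemma derived_subset_set_mult:
  assumes H: "subgroup H G" and Q: "subgroup Q G" "Q \<subseteq> H" and n: "normalizes H Q"
    and C: "subgroup C G" "C \<subseteq> H" and QC: "Q <#> C = H" and D: "subgroup (Q <#> derived G C) G"
  shows "derived G H \<subseteq> Q <#> derived G C"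
  unfolding derived_def[of G H]
proof (rule generate_subgroup_incl[OF _ D], rule subsetI)
  have Hc: "\<And>x. x \<in> H \<Longrightarrow> x \<in> carrier G" and QH: "\<And>x. x \<in> Q \<Longrightarrow> x \<in> H"
    and CH: "\<And>x. x \<in> C \<Longrightarrow> x \<in> H"
    using subgroup_mem[OF H] Q C by blast+
  have rel_mult: "\<exists>w\<in>Q. (u \<otimes> c) \<otimes> (v \<otimes> d) = w \<otimes> (c \<otimes> d)"
    if "u \<in> Q" "v \<in> Q" "c \<in> H" "d \<in> H" for u v c d
  proof -
    have cv: "conjugate c v \<in> Q" using normalizes_conjugate_in[OF n that(3,2)] .
    note cc = Hc[OF QH[OF that(1)]] Hc[OF QH[OF that(2)]] Hc[OF that(3)] Hc[OF that(4)] Hc[OF QH[OF cv]]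
    have "(u \<otimes> c) \<otimes> (v \<otimes> d) = u \<otimes> (c \<otimes> v) \<otimes> d" using cc by (simp add: m_assoc)
    also have "\<dots> = (u \<otimes> conjugate c v) \<otimes> (c \<otimes> d)"
      unfolding mult_conjugate[OF cc(3,2)] using cc by (simp add: m_assoc)
    finally show ?thesis using subgroup.m_closed[OF Q(1) that(1) cv] by blast
  qed
  have rel_inv: "\<exists>w\<in>Q. inv (u \<otimes> c) = w \<otimes> inv c" if "u \<in> Q" "c \<in> H" for u c
  proof -
    have ic: "inv c \<in> H" and iu: "inv u \<in> Q"
      using subgroup.m_inv_closed[OF H that(2)] subgroup.m_inv_closed[OF Q(1) that(1)] .
    have "inv (u \<otimes> c) = inv c \<otimes> inv u" using inv_mult_group Hc QH that by simp
    also have "\<dots> = conjugate (inv c) (inv u) \<otimes> inv c" using mult_conjugate Hc[OF ic] Hc[OF QH[OF iu]] by blast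
    finally show ?thesis using normalizes_conjugate_in[OF n ic iu] by blast
  qed
  fix x assume "x \<in> derived_set G H"
  then obtain g h where gh: "g \<in> H" "h \<in> H" "x = g \<otimes> h \<otimes> inv g \<otimes> inv h" by blast
  obtain u c where g: "u \<in> Q" "c \<in> C" "g = u \<otimes> c" using gh(1) QC[symmetric] unfolding set_mult_def by auto
  obtain v d where h: "v \<in> Q" "d \<in> C" "h = v \<otimes> d" using gh(2) QC[symmetric] unfolding set_mult_def by auto
  have cH: "c \<in> H" "d \<in> H" "inv c \<in> H" "inv d \<in> H" "c \<otimes> d \<in> H" "c \<otimes> d \<otimes> inv c \<in> H"
    using CH g(2) h(2) H by (simp_all add: subgroup.m_closed subgroup.m_inv_closed)
  obtain w1 where w1: "w1 \<in> Q" "g \<otimes> h = w1 \<otimes> (c \<otimes> d)"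
    using rel_mult[OF g(1) h(1) cH(1,2)] g(3) h(3) by auto
  obtain w2 where w2: "w2 \<in> Q" "inv g = w2 \<otimes> inv c" using rel_inv[OF g(1) cH(1)] g(3) by auto
  obtain w3 where w3: "w3 \<in> Q" "inv h = w3 \<otimes> inv d" using rel_inv[OF h(1) cH(2)] h(3) by auto
  obtain w4 where w4: "w4 \<in> Q" "g \<otimes> h \<otimes> inv g = w4 \<otimes> (c \<otimes> d \<otimes> inv c)"
    using rel_mult[OF w1(1) w2(1) cH(5,3)] w1(2) w2(2) by auto
  obtain w5 where w5: "w5 \<in> Q" "x = w5 \<otimes> (c \<otimes> d \<otimes> inv c \<otimes> inv d)"
    using rel_mult[OF w4(1) w3(1) cH(6,4)] w4(2) w3(2) gh(3) by auto
  have "c \<otimes> d \<otimes> inv c \<otimes> inv d \<in> derived G C"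
    unfolding derived_def using g(2) h(2) by (intro generate.incl) blast
  then show "x \<in> Q <#> derived G C" unfolding set_mult_iff using w5 by blast
qed

text \<open>Let \<open>C\<close> complement the normal Sylow subgroup generated by \<open>z\<close>,
  and let \<open>y\<close> generate the derived subgroup of \<open>C\<close>. Being in the derived
  subgroup of \<open>H\<close>, \<open>y\<close> commutes with \<open>z\<close>; the orders are
  coprime, so \<open>z \<otimes> y\<close> generates a cyclic group containing all commutators of
  \<open>H\<close>.\<close>

theorem derived_cyclic:
  assumes "subgroup H G" "cyclic_sylows H"
  shows "\<exists>y\<in>derived G H. ord y = card (derived G H)"
  using assms
proof (induction "card H" arbitrary: H rule: less_induct)
  case (less H)
  note H = less.prems(1) and Z = less.prems(2)
  have Hc: "\<And>x. x \<in> H \<Longrightarrow> x \<in> carrier G" using subgroup_mem[OF H] .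
  have dH: "subgroup (derived G H) G" using derived_is_subgroup[OF subgroup.subset[OF H]] .
  show ?case
  proof (cases "card H = 1")
    case True
    have "derived G H \<subseteq> H" using derived_incl[OF subset_refl H] .
    moreover have "H = {\<one>}" using True subgroup.one_closed[OF H] by (auto simp: card_1_singleton_iff)
    ultimately have "derived G H = {\<one>}" using subgroup.one_closed[OF dH] by blast
    then show ?thesis by simp
  next
    case False
    obtain z k where z: "z \<in> H" "normalizes H (generate G {z})" "ord z > 1" "card H = ord z * k"
        "coprime (ord z) k"
      and mk: "\<And>p. prime p \<Longrightarrow> p dvd k \<Longrightarrow> multiplicity p k = multiplicity p (card H)"
      using largest_sylow_normal[OF H Z False] by metis
    let ?Q = "generate G {z}"
    have zc: "z \<in> carrier G" using Hc z(1) .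
    have Q: "subgroup ?Q G" "?Q \<subseteq> H" "card ?Q = ord z"
      using generate_is_subgroup[of "{z}"] generate_subset_subgroup[OF H z(1)] generate_pow_card[OF zc] zc by simp_all
    have "x \<otimes> y = y \<otimes> x" if xy: "x \<in> ?Q" "y \<in> ?Q" for x y
    proof -
      obtain i j :: nat where "x = z [^] i" "y = z [^] j"
        using xy generate_pow_on_finite_carrier[OF finite_carrier zc] by blast
      then show ?thesis using zc by (simp add: nat_pow_mult add.commute)
    qed
    moreover have "card H = card ?Q * k" "coprime (card ?Q) k" using z(4,5) Q(3) by simp_all
    ultimately obtain C where C: "subgroup C G" "C \<subseteq> H" "?Q \<inter> C = {\<one>}" "card C = k" "?Q <#> C = H"
      using abelian_normal_complement[OF H Q(1,2) z(2)] by blast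
    have ZC: "cyclic_sylows C"
      unfolding cyclic_sylows_def
    proof (intro allI impI)
      fix p :: nat assume p: "prime p"
      show "\<exists>x\<in>C. ord x = p ^ multiplicity p (card C)"
      proof (cases "p dvd k")
        case True
        have m: "multiplicity p (card C) = multiplicity p (card H)" using mk[OF p True] C(4) by simp
        obtain K where K: "subgroup K G" "K \<subseteq> C" "card K = p ^ multiplicity p (card H)"
          using prime_power_subgroup[OF C(1) p, of "multiplicity p (card H)"] multiplicity_dvd[of p "card C"] m by auto
        obtain x where x: "x \<in> H" "ord x = p ^ multiplicity p (card H)"
          using Z p unfolding cyclic_sylows_def by blast
        have "K \<subseteq> H" using K(2) C(2) by blast
        obtain y where "y \<in> K" "ord y = card K"
          using sylow_cyclic[OF H p x K(1) \<open>K \<subseteq> H\<close> K(3)] .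
        then show ?thesis using K(2,3) m by auto
      next
        case False
        then have "multiplicity p (card C) = 0" using C(4) not_dvd_imp_multiplicity_0 by simp
        then show ?thesis using subgroup.one_closed[OF C(1)] by (intro bexI[of _ \<one>]) simp_all
      qed
    qed
    have "card C < card H" using z(3,4) C(4) subgroup_card_pos[OF C(1)] by simp
    then obtain y where y: "y \<in> derived G C" "ord y = card (derived G C)"
      using less.hyps C(1) ZC by blast
    have dC: "subgroup (derived G C) G" "derived G C \<subseteq> C"
      using derived_is_subgroup[OF subgroup.subset[OF C(1)]] derived_incl[OF subset_refl C(1)] .
    have yc: "y \<in> carrier G" using y(1) dC(1) subgroup_mem by blast
    have "y \<in> stab H conjugate z"
      using y(1) mono_derived[OF C(2)] commutators_centralize_cyclic_normal[OF H z(1,2)] by blast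
    then have yz: "z \<otimes> y = y \<otimes> z" using stab_conjugate[OF H z(1)] by auto
    let ?w = "z \<otimes> y" and ?D = "?Q <#> derived G C"
    have "ord y dvd k" using card_subgroup_dvd[OF dC(1) C(1) dC(2)] y(2) C(4) by simp
    then have "coprime (ord z) (ord y)" using coprime_divisors[OF dvd_refl _ z(5)] by blast
    then have ow: "ord ?w = ord z * ord y" using ord_mult_coprime[OF zc yc yz] by simp
    have D: "subgroup ?D G"
      using subgroup_set_mult[OF Q(1) dC(1)] normalizes_conjugate_in[OF z(2)] dC(2) C(2) by blast
    have "?Q \<inter> derived G C = {\<one>}"
      using C(3) dC subgroup.one_closed[OF Q(1)] subgroup.one_closed[OF dC(1)] by blast
    then have "card ?D = ord z * ord y" using card_set_mult[OF Q(1) dC(1)] Q(3) y(2) by simp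
    moreover have "?w \<in> ?D" unfolding set_mult_iff using generate.incl[of z "{z}" G] y(1) by blast
    ultimately have gw: "generate G {?w} = ?D" using generate_eq_if_ord_eq_card[OF D] ow by simp
    have "derived G H \<subseteq> generate G {?w}"
      unfolding gw by (rule derived_subset_set_mult[OF H Q(1,2) z(2) C(1,2,5) D])
    then obtain v where "v \<in> derived G H" "ord v = card (derived G H)"
      using subgroup_of_cyclic[OF _ dH] zc yc by blast
    then show ?thesis by blast
  qed
qed

section \<open>The abelian quotient and metacyclicity\<close>

lemma abelian_cyclic_sylows:
  assumes comm: "\<And>x y. x \<in> carrier G \<Longrightarrow> y \<in> carrier G \<Longrightarrow> x \<otimes> y = y \<otimes> x"
    and Z: "cyclic_sylows (carrier G)"
  shows "cyclic_group G"
proof -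
  let ?n = "card (carrier G)"
  have n0: "?n > 0" using subgroup_card_pos[OF subgroup_self] .
  have "\<exists>x\<in>carrier G. ord x = (\<Prod>p\<in>T. p ^ multiplicity p ?n)"
    if "finite T" "\<And>p. p \<in> T \<Longrightarrow> prime p" for T
    using that
  proof (induction T rule: finite_induct)
    case empty
    show ?case by (intro bexI[of _ \<one>]) simp_all
  next
    case (insert p T)
    obtain x where x: "x \<in> carrier G" "ord x = (\<Prod>p\<in>T. p ^ multiplicity p ?n)" using insert by blast
    obtain y where y: "y \<in> carrier G" "ord y = p ^ multiplicity p ?n"
      using Z insert.prems unfolding cyclic_sylows_def by blast
    have "coprime (ord y) (ord x)"
      unfolding x(2) y(2) using insert by (intro coprime_prod_prime_powers) auto
    then have "ord (y \<otimes> x) = ord y * ord x" using ord_mult_coprime[OF y(1) x(1) comm[OF y(1) x(1)]] by simp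
    then show ?case using x y insert.hyps by (intro bexI[of _ "y \<otimes> x"]) simp_all
  qed
  from this[of "prime_factors ?n"] obtain x where "x \<in> carrier G" "ord x = ?n"
    using prod_prime_power_eq[of "prime_factors ?n" ?n] n0 by auto
  then show ?thesis using cyclic_group_subgroupI[OF subgroup_self] by simp
qed

text \<open>The derived subgroup is the cyclic normal subgroup. Cyclic Sylow subgroups pass to the
  quotient because the coset of an element of full \<open>p\<close>-power order has an order
  divisible by the full \<open>p\<close>-part of the index.\<close>

theorem metacyclic_if_cyclic_sylows:
  assumes Z: "cyclic_sylows (carrier G)"
  shows "metacyclic_group G"
proof -
  let ?N = "derived G (carrier G)"
  interpret N: normal ?N G by (rule derived_self_is_normal)
  interpret L: comm_group "G Mod ?N" by (rule derived_quot_is_comm_group)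
  interpret L: finite_group "G Mod ?N"
    by unfold_locales (simp add: carrier_FactGroup)
  have N: "subgroup ?N G" by (rule N.subgroup_axioms)
  obtain y where "y \<in> ?N" "ord y = card ?N" using derived_cyclic[OF subgroup_self Z] by blast
  then have "cyclic_group (G\<lparr>carrier := ?N\<rparr>)" by (rule cyclic_group_subgroupI[OF N])
  moreover have "cyclic_group (G Mod ?N)"
  proof (rule L.abelian_cyclic_sylows)
    show "x \<otimes>\<^bsub>G Mod ?N\<^esub> y = y \<otimes>\<^bsub>G Mod ?N\<^esub> x" if "x \<in> carrier (G Mod ?N)" "y \<in> carrier (G Mod ?N)" for x y
      using L.m_comm[OF that] .
    let ?l = "card (carrier (G Mod ?N))"
    have cG: "card (carrier G) = ?l * card ?N"
      using lagrange[OF N] unfolding order_def FactGroup_def by simp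
    have l0: "?l \<noteq> 0" and N0: "card ?N \<noteq> 0"
      using L.subgroup_card_pos[OF L.subgroup_self] subgroup_card_pos[OF N] by auto
    show "L.cyclic_sylows (carrier (G Mod ?N))"
      unfolding L.cyclic_sylows_def
    proof (intro allI impI)
      fix p :: nat assume p: "prime p"
      obtain x where x: "x \<in> carrier G" "ord x = p ^ multiplicity p (card (carrier G))"
        using Z p unfolding cyclic_sylows_def by blast
      define X where "X = ?N #> x"
      have X: "X \<in> carrier (G Mod ?N)" unfolding X_def carrier_FactGroup using x(1) by blast
      define n where "n = L.ord X"
      have n0: "n \<noteq> 0" unfolding n_def using L.ord_pos[OF X] by simp
      have "?N #> (x [^] n) = X [^]\<^bsub>G Mod ?N\<^esub> n" unfolding X_def using N.FactGroup_pow[OF x(1)] by simp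
      also have "\<dots> = ?N" unfolding n_def using L.pow_ord_eq_1[OF X] by simp
      finally have "x [^] n \<in> ?N" using coset_join1[OF _ _ N] x(1) by blast
      then have "(x [^] n) [^] card ?N = \<one>" by (rule pow_card_eq_one[OF N])
      then have "ord x dvd n * card ?N" using x(1) pow_eq_id by (simp add: nat_pow_pow)
      \<comment> \<open>Comparing exponents of \<open>p\<close> in \<open>?l * card ?N\<close> and
        \<open>n * card ?N\<close> cancels those of \<open>card ?N\<close>.\<close>
      then have "multiplicity p (card (carrier G)) \<le> multiplicity p (n * card ?N)"
        unfolding x(2) using n0 N0 p by (intro multiplicity_geI) auto
      then have "multiplicity p ?l \<le> multiplicity p n"
        unfolding cG using n0 N0 l0 p by (simp add: prime_elem_multiplicity_mult_distrib)
      then have "p ^ multiplicity p ?l dvd n" by (rule multiplicity_dvd')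
      then obtain t where t: "n = p ^ multiplicity p ?l * t" by blast
      have "t \<noteq> 0" using n0 t by (metis mult_0_right)
      then have "L.ord (X [^]\<^bsub>G Mod ?N\<^esub> t) = p ^ multiplicity p ?l"
        using L.ord_pow[OF X, of t] t unfolding n_def by simp
      then show "\<exists>x\<in>carrier (G Mod ?N). L.ord x = p ^ multiplicity p ?l"
        using L.nat_pow_closed[OF X] by blast
    qed
  qed
  ultimately show ?thesis unfolding metacyclic_group_def using N.normal_axioms by blast
qed

end

theorem theorem4p13:
  fixes G :: "('a, 'b) monoid_scheme"
  assumes "group G"
    and "finite (carrier G)"
    and "subgroup_ratio G < 5 / 2"
  shows "(\<forall>p P. sylow_subgroup p P G \<longrightarrow> cyclic_group (G\<lparr>carrier := P\<rparr>)) \<and> metacyclic_group G"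
proof -
  interpret finite_group G using assms(1,2) by (simp add: finite_group_def finite_group_axioms_def)
  have n0: "card (carrier G) > 0" using subgroup_card_pos[OF subgroup_self] .
  have "{p. prime p \<and> p dvd order G} = prime_factors (card (carrier G))"
    unfolding order_def using n0 by (auto simp: prime_factors_dvd)
  then have np: "num_prime_divisors G = card (prime_factors (card (carrier G)))"
    unfolding num_prime_divisors_def by simp
  have "{H. subgroup H G} = subgroups_in (carrier G)"
    unfolding subgroups_in_def using subgroup.subset by blast
  then have ns: "num_subgroups G = card (subgroups_in (carrier G))"
    unfolding num_subgroups_def by simp
  have "real (num_subgroups G) < 5 / 2 * 2 ^ num_prime_divisors G"
    using assms(3) unfolding subgroup_ratio_def by (simp add: divide_simps split: if_splits)
  then have "real (2 * num_subgroups G) < real (5 * 2 ^ num_prime_divisors G)" by simp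
  then have less: "2 * card (subgroups_in (carrier G)) < 5 * 2 ^ card (prime_factors (card (carrier G)))"
    unfolding np ns by linarith
  have Z: "cyclic_sylows (carrier G)"
    unfolding cyclic_sylows_def
  proof (intro allI impI, rule ccontr)
    fix p :: nat assume p: "prime p" and "\<not> (\<exists>x\<in>carrier G. ord x = p ^ multiplicity p (card (carrier G)))"
    then show False using card_subgroups_noncyclic_sylow[OF subgroup_self p] less by force
  qed
  have "cyclic_group (G\<lparr>carrier := P\<rparr>)" if "sylow_subgroup p P G" for p P
  proof -
    have p: "prime p" and P: "subgroup P G" "card P = p ^ multiplicity p (card (carrier G))"
      using that unfolding sylow_subgroup_def order_def by auto
    obtain x where "x \<in> carrier G" "ord x = p ^ multiplicity p (card (carrier G))"
      using Z p unfolding cyclic_sylows_def by blast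
    then obtain y where "y \<in> P" "ord y = card P"
      using sylow_cyclic[OF subgroup_self p _ _ P(1) subgroup.subset[OF P(1)] P(2)] by blast
    then show ?thesis by (rule cyclic_group_subgroupI[OF P(1)])
  qed
  then show ?thesis using metacyclic_if_cyclic_sylows[OF Z] by blast
qed

end
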